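(* Let $\{x_t : t\in\mathbb{N}\}$ be an $\mathbb{R}^r$-valued process whose law $P_\theta$ depends on $\theta=(\theta_1,\dots,\theta_m)^T\in\Theta$, with $\Theta\subset\mathbb{R}^m$ open and true value $\theta^0\in\Theta$, and let $e_t(\theta)$, $\Sigma_t(\theta)$, $\alpha_t(\theta)$ and $Q_n(\theta)$ be as defined in the context. Suppose that there exist positive constants $C_1,C_2$ such that for all $t\ge 1$ conditions (a) and (b) hold, and that (c) and (d) hold: (a) $E_{\theta^0}\left\{\left|\frac{\partial\alpha_t(\theta)}{\partial\theta_i}\right|^4\right\}\le C_1$ for $i=1,\dots,m$; (b) $E_{\theta^0}\left\{\left|\frac{\partial^2\alpha_t(\theta)}{\partial\theta_i\partial\theta_j}-E_\theta\left(\frac{\partial^2\alpha_t(\theta)}{\partial\theta_i\partial\theta_j}\,\Big|\,F_{t-1}\right)\right|^2\right\}\le C_2$ for $i,j=1,\dots,m$; (c) $\lim_{n\to\infty}\frac{1}{2n}\sum_{t=1}^n E_{\theta^0}\left\{\frac{\partial^2\alpha_t(\theta)}{\partial\theta_i\partial\theta_j}\,\Big|\,F_{t-1}\right\}=V_{ij}$ a.s. for $i,j=1,\dots,m$, where $V=(V_{ij})_{1\le i,j\le m}$ is a strictly positive definite matrix of constants; (d) for $i,j=1,\dots,m$, $$\lim_{n\to\infty}\ \sup_{\Delta\downarrow 0}\ (n\Delta)^{-1}\left|\sum_{t=1}^n\left(\left\{\frac{\partial^2\alpha_t(\theta)}{\partial\theta_i\partial\theta_j}\right\}_{\theta=\theta^*}-\left\{\frac{\partial^2\alpha_t(\theta)}{\partial\theta_i\partial\theta_j}\right\}_{\theta=\theta^0}\right)\right|<\infty\quad\text{a.s.},$$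 where $\theta^*$ is a point of the straight line joining $\theta^0$ to every $\theta$ such that $\|\theta-\theta^0\|<\Delta$, $0<\Delta$. Then there exists a sequence of estimators $\widehat\theta_n=(\widehat\theta_1,\dots,\widehat\theta_m)^T$ such that $\widehat\theta_n\to\theta^0$ a.s. and, for any $\epsilon>0$, there exist an event $E$ with $P_{\theta^0}(E)>1-\epsilon$ and an $n_0$ such that on $E$, for any $n>n_0$, $\{\partial Q_n(\theta)/\partial\theta_i\}_{\theta=\widehat\theta_n}=0$ for $i=1,\dots,m$, and $Q_n(\theta)$ attains a relative minimum at $\widehat\theta_n$.
   Context: The process $\{x_t:t\in\mathbb{N}\}$ ($t\ge1$) is defined on $(\Omega,F,P_\theta)$. $E_\theta(\cdot)$ and $E_\theta(\cdot|\cdot)$ denote expectation and conditional expectation under $P_\theta$. The true value $\theta^0$ is an interior point of the open set $\Theta$; a.s. statements are under $P_{\theta^0}$. $F_t$ is the $\sigma$-algebra generated by $x_1,\dots,x_t$, and $F_0=\{\emptyset,\Omega\}$. $\|\cdot\|$ is the Euclidean norm. Estimators $\widehat\theta_n$ are based on the observations $x_1,\dots,x_n$. Standing assumptions: $E_\theta(\|x_t\|^2)<\infty$ for all $\theta$ and $t$. Put $$e_t(\theta)=x_t-E_\theta(x_t|F_{t-1}),\qquad \Sigma_t(\theta)=E_\theta[e_t(\theta)e_t^T(\theta)|F_{t-1}],$$ where $\Sigma_t(\theta)$ is invertible, and $e_t(\theta)$, $\Sigma_t(\theta)$ are almost surely twice continuously differentiable in $\theta\in\Theta$. Define $$\alpha_t(\theta)=\log\det\Sigma_t(\theta)+e_t^T(\theta)\Sigma_t^{-1}(\theta)e_t(\theta),\qquad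 Q_n(\theta)=\frac12\sum_{t=1}^n\alpha_t(\theta)+\frac{rn}{2}\log(2\pi),$$ so $Q_n$ is minus the Gaussian quasi-log-likelihood (the process need not be Gaussian). Convention: $E_{\theta^0}\{h(\theta)\}$ means $[E_\theta\{h(\theta)\}]_{\theta=\theta^0}$, i.e. the functions and derivatives inside are evaluated at $\theta=\theta^0$ and the (conditional) expectation is under $P_{\theta^0}$; in (b), $E_\theta(\cdot|F_{t-1})$ is likewise taken at $\theta=\theta^0$. *)

theory Defs
  imports "HOL-Probability.Probability"
begin

text \<open>
  \<open>partial i f \<theta>\<close> is the partial derivative of \<open>f\<close> with respect to the coordinate \<open>\<theta>\<^sub>i\<close>;
  the second-order derivative with respect to \<open>\<theta>\<^sub>i\<close> and \<open>\<theta>\<^sub>j\<close> is \<open>partial i (partial j f)\<close>.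
\<close>

definition partial :: "'m::finite \<Rightarrow> (real^'m \<Rightarrow> real) \<Rightarrow> real^'m \<Rightarrow> real" where
  "partial i f \<theta> = deriv (\<lambda>h. f (\<theta> + h *\<^sub>R axis i 1)) 0"

definition twice_continuously_differentiable_on ::
    "('a::real_normed_vector \<Rightarrow> 'b::real_normed_vector) \<Rightarrow> 'a set \<Rightarrow> bool" where
  "twice_continuously_differentiable_on f U \<longleftrightarrow>
     (\<exists>(f' :: 'a \<Rightarrow> 'a \<Rightarrow>\<^sub>L 'b) (f'' :: 'a \<Rightarrow> 'a \<Rightarrow>\<^sub>L ('a \<Rightarrow>\<^sub>L 'b)).
        (\<forall>u\<in>U. (f has_derivative blinfun_apply (f' u)) (at u)) \<and>
        (\<forall>u\<in>U. (f' has_derivative blinfun_apply (f'' u)) (at u)) \<and>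
        continuous_on U f'')"

definition strictly_positive_definite :: "real^'m^'m \<Rightarrow> bool" where
  "strictly_positive_definite V \<longleftrightarrow> transpose V = V \<and> (\<forall>v. v \<noteq> 0 \<longrightarrow> 0 < v \<bullet> (V *v v))"

definition natural_sigma ::
    "'w measure \<Rightarrow> (nat \<Rightarrow> 'w \<Rightarrow> 'b::topological_space) \<Rightarrow> nat \<Rightarrow> 'w measure" where
  "natural_sigma M x t =
     sigma (space M) {x s -` A \<inter> space M | s A. s \<in> {1..t} \<and> A \<in> sets borel}"

text \<open>
  \<open>is_cond_exp P G f g\<close>: the random variable \<open>g\<close> is a version of the conditional expectation
  of \<open>f\<close> given \<open>G\<close> under \<open>P\<close>.  The conditional mean and covariance of the process enter through
  arbitrary versions: conditional expectations are determined only up to null sets, separately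
  for every parameter, whereas smoothness in the parameter depends on the choice of versions.
\<close>

definition is_cond_exp ::
    "'w measure \<Rightarrow> 'w measure \<Rightarrow> ('w \<Rightarrow> real) \<Rightarrow> ('w \<Rightarrow> real) \<Rightarrow> bool" where
  "is_cond_exp P G f g \<longleftrightarrow>
     g \<in> borel_measurable G \<and> (AE w in P. g w = real_cond_exp P G f w)"

definition innovation ::
    "(nat \<Rightarrow> 'w \<Rightarrow> real^'r) \<Rightarrow> (nat \<Rightarrow> 'p \<Rightarrow> 'w \<Rightarrow> real^'r) \<Rightarrow> nat \<Rightarrow> 'p \<Rightarrow> 'w \<Rightarrow> real^'r" where
  "innovation x \<mu> t \<theta> w = x t w - \<mu> t \<theta> w"

definition is_cond_mean ::
    "'w measure \<Rightarrow> ('p \<Rightarrow> 'w measure) \<Rightarrow> 'p set \<Rightarrow> (nat \<Rightarrow> 'w \<Rightarrow> real^'r)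
      \<Rightarrow> (nat \<Rightarrow> 'p \<Rightarrow> 'w \<Rightarrow> real^'r) \<Rightarrow> bool" where
  "is_cond_mean M P \<Theta> x \<mu> \<longleftrightarrow>
     (\<forall>t\<ge>1. \<forall>\<theta>\<in>\<Theta>. \<forall>k.
        is_cond_exp (P \<theta>) (natural_sigma M x (t - 1)) (\<lambda>w. x t w $ k) (\<lambda>w. \<mu> t \<theta> w $ k))"

definition is_cond_cov ::
    "'w measure \<Rightarrow> ('p \<Rightarrow> 'w measure) \<Rightarrow> 'p set \<Rightarrow> (nat \<Rightarrow> 'w \<Rightarrow> real^'r)
      \<Rightarrow> (nat \<Rightarrow> 'p \<Rightarrow> 'w \<Rightarrow> real^'r) \<Rightarrow> (nat \<Rightarrow> 'p \<Rightarrow> 'w \<Rightarrow> real^'r^'r) \<Rightarrow> bool" where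
  "is_cond_cov M P \<Theta> x \<mu> S \<longleftrightarrow>
     (\<forall>t\<ge>1. \<forall>\<theta>\<in>\<Theta>. \<forall>k l.
        is_cond_exp (P \<theta>) (natural_sigma M x (t - 1))
          (\<lambda>w. innovation x \<mu> t \<theta> w $ k * innovation x \<mu> t \<theta> w $ l) (\<lambda>w. S t \<theta> w $ k $ l))"

definition qml_alpha ::
    "(nat \<Rightarrow> 'w \<Rightarrow> real^'r) \<Rightarrow> (nat \<Rightarrow> 'p \<Rightarrow> 'w \<Rightarrow> real^'r) \<Rightarrow> (nat \<Rightarrow> 'p \<Rightarrow> 'w \<Rightarrow> real^'r^'r)
      \<Rightarrow> nat \<Rightarrow> 'w \<Rightarrow> 'p \<Rightarrow> real" where
  "qml_alpha x \<mu> S t w \<theta> =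
     ln (det (S t \<theta> w))
     + innovation x \<mu> t \<theta> w \<bullet> (matrix_inv (S t \<theta> w) *v innovation x \<mu> t \<theta> w)"

definition qml_Q ::
    "(nat \<Rightarrow> 'w \<Rightarrow> real^'r) \<Rightarrow> (nat \<Rightarrow> 'p \<Rightarrow> 'w \<Rightarrow> real^'r) \<Rightarrow> (nat \<Rightarrow> 'p \<Rightarrow> 'w \<Rightarrow> real^'r^'r)
      \<Rightarrow> nat \<Rightarrow> 'w \<Rightarrow> 'p \<Rightarrow> real" where
  "qml_Q x \<mu> S n w \<theta> =
     (1 / 2) * (\<Sum>t=1..n. qml_alpha x \<mu> S t w \<theta>) + real CARD('r) * real n / 2 * ln (2 * pi)"

definition qml_score ::
    "(nat \<Rightarrow> 'w \<Rightarrow> real^'r) \<Rightarrow> (nat \<Rightarrow> real^'m \<Rightarrow> 'w \<Rightarrow> real^'r)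
      \<Rightarrow> (nat \<Rightarrow> real^'m \<Rightarrow> 'w \<Rightarrow> real^'r^'r) \<Rightarrow> nat \<Rightarrow> 'm \<Rightarrow> real^'m \<Rightarrow> 'w \<Rightarrow> real" where
  "qml_score x \<mu> S t i \<theta> w = partial i (qml_alpha x \<mu> S t w) \<theta>"

definition qml_hess ::
    "(nat \<Rightarrow> 'w \<Rightarrow> real^'r) \<Rightarrow> (nat \<Rightarrow> real^'m \<Rightarrow> 'w \<Rightarrow> real^'r)
      \<Rightarrow> (nat \<Rightarrow> real^'m \<Rightarrow> 'w \<Rightarrow> real^'r^'r) \<Rightarrow> nat \<Rightarrow> 'm \<Rightarrow> 'm \<Rightarrow> real^'m \<Rightarrow> 'w \<Rightarrow> real" where
  "qml_hess x \<mu> S t i j \<theta> w = partial i (partial j (qml_alpha x \<mu> S t w)) \<theta>"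

text \<open>
  Since \<open>qml_alpha\<close> is only almost surely differentiable in the parameter, its derivatives are
  random variables only up to a null set on which \<open>deriv\<close> is arbitrary, possibly not measurable.
  Moments and conditional expectations of the derivatives are therefore taken under the
  completion of the probability measure; for measurable functions this makes no difference.
\<close>

definition qml_cond_hess ::
    "'w measure \<Rightarrow> 'w measure \<Rightarrow> (nat \<Rightarrow> 'w \<Rightarrow> real^'r) \<Rightarrow> (nat \<Rightarrow> real^'m \<Rightarrow> 'w \<Rightarrow> real^'r)
      \<Rightarrow> (nat \<Rightarrow> real^'m \<Rightarrow> 'w \<Rightarrow> real^'r^'r) \<Rightarrow> nat \<Rightarrow> 'm \<Rightarrow> 'm \<Rightarrow> real^'m \<Rightarrow> 'w \<Rightarrow> real" where
  "qml_cond_hess M P0 x \<mu> S t i j \<theta> =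
     real_cond_exp (completion P0) (natural_sigma M x (t - 1)) (qml_hess x \<mu> S t i j \<theta>)"

end

theory Submission
  imports Defs "HOL-Library.Discrete_Functions"
begin

text \<open>
  At \<open>\<theta>0\<close> the scores and the centred second derivatives of \<open>qml_alpha\<close> are martingale differences with
  bounded second moments, so their partial sums are almost surely \<open>o(n\<^bsup>7/8\<^esup>)\<close>. With (c) and (d), the Hessian of
  \<open>qml_Q n\<close> on the shrinking ball \<open>K\<^sub>n\<close> around \<open>\<theta>0\<close> of radius \<open>\<rho>\<^sub>n\<close> proportional to \<open>n\<^bsup>-1/8\<^esup>\<close> is eventually
  bounded below by a positive multiple of \<open>n\<close>, whereas the gradient at \<open>\<theta>0\<close> is \<open>o(n \<rho>\<^sub>n)\<close>. Hence
  eventually \<open>qml_Q n\<close> is strongly convex on \<open>K\<^sub>n\<close> and its minimiser over \<open>K\<^sub>n\<close> is interior. The radii being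
  deterministic, a single sequence of estimators serves every \<open>\<epsilon>\<close>, and any choice inside \<open>K\<^sub>n\<close> is consistent.
  Measurability comes from minimising over a countable dense subset of \<open>K\<^sub>n\<close>: by strong convexity the
  approximate minimisers form a Cauchy sequence.
\<close>

section \<open>Iterated differentiability and strong convexity\<close>

text \<open>The exponent 7/8 is one choice from the open interval (3/4, 1). It must be below 1 for
  radii of order n^(7/8 - 1) to shrink, and above 3/4 for the second-moment argument along the
  squares k^2 to be summable: there an expectation of order k^2 is divided by k^(4 a) with a = 7/8.

  That the scores are martingale differences is not obtained by exchanging derivative and
  expectation but read off an explicit formula. Jacobi's formula and the constancy of trace
  (\<Sigma>^-1 \<Sigma>) write the derivative of \<alpha>_t at \<theta>0 as a combination of e_k e_l
  - \<Sigma>_kl and e_k, which are conditionally centred, with coefficients known at time t - 1.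

  These coefficients carry no moment bound, and (b) controls the second derivatives only after
  centring. Conditional expectations are therefore computed on sets known at time t - 1 where the
  unbounded factor is truncated, and these sets exhaust the space.

  Derivatives are unspecified on null sets. Adapted versions of them are built from difference
  quotients along a fixed sequence of steps.\<close>

primrec times_differentiable_on :: "nat \<Rightarrow> (real^'m \<Rightarrow> real) \<Rightarrow> (real^'m) set \<Rightarrow> bool" where
  "times_differentiable_on 0 f U \<longleftrightarrow> True"
| "times_differentiable_on (Suc k) f U \<longleftrightarrow>
     (\<exists>F :: real^'m \<Rightarrow> real^'m. (\<forall>u\<in>U. (f has_derivative (\<lambda>v. F u \<bullet> v)) (at u)) \<and>
        (\<forall>i. times_differentiable_on k (\<lambda>u. F u $ i) U))"

lemma times_differentiable_on_SucD:
  "times_differentiable_on (Suc k) f U \<Longrightarrow> times_differentiable_on k f U"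
proof (induction k arbitrary: f)
  case (Suc k)
  then obtain F where F: "\<And>u. u \<in> U \<Longrightarrow> (f has_derivative (\<lambda>v. F u \<bullet> v)) (at u)"
    "\<And>i. times_differentiable_on (Suc k) (\<lambda>u. F u $ i) U"
    by (simp only: times_differentiable_on.simps) blast
  have "\<And>i. times_differentiable_on k (\<lambda>u. F u $ i) U"
    using F(2) Suc.IH by blast
  then show ?case
    using F(1) by auto
qed simp

lemma times_differentiable_on_subset:
  "times_differentiable_on k f U \<Longrightarrow> W \<subseteq> U \<Longrightarrow> times_differentiable_on k f W"
  by (induction k arbitrary: f) (auto, blast)

lemma times_differentiable_on_const: "times_differentiable_on k (\<lambda>_. c) U"
proof (induction k arbitrary: c)
  case (Suc k)
  show ?case
    by (auto intro!: exI[of _ "\<lambda>_. 0"] Suc)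
qed simp

lemma times_differentiable_on_add:
  "times_differentiable_on k f U \<Longrightarrow> times_differentiable_on k g U \<Longrightarrow>
     times_differentiable_on k (\<lambda>u. f u + g u) U"
proof (induction k arbitrary: f g)
  case (Suc k)
  from Suc.prems(1) obtain F where
    F: "\<And>u. u \<in> U \<Longrightarrow> (f has_derivative (\<lambda>v. F u \<bullet> v)) (at u)"
    "\<And>i. times_differentiable_on k (\<lambda>u. F u $ i) U"
    unfolding times_differentiable_on.simps by blast
  from Suc.prems(2) obtain G where
    G: "\<And>u. u \<in> U \<Longrightarrow> (g has_derivative (\<lambda>v. G u \<bullet> v)) (at u)"
    "\<And>i. times_differentiable_on k (\<lambda>u. G u $ i) U"
    unfolding times_differentiable_on.simps by blast
  have "((\<lambda>u. f u + g u) has_derivative (\<lambda>v. (F u + G u) \<bullet> v)) (at u)" if "u \<in> U" for u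
    unfolding inner_add_left by (intro has_derivative_add F(1) G(1) that)
  moreover have "times_differentiable_on k (\<lambda>u. (F u + G u) $ i) U" for i
    unfolding vector_add_component by (intro Suc.IH F(2) G(2))
  ultimately show ?case
    by (auto intro!: exI[of _ "\<lambda>u. F u + G u"])
qed simp

text \<open>Recursion through the components of the gradient gives closure by induction on the
  order, with no second-derivative formula. The new gradient contains \<open>f\<close> and
  \<open>g\<close> undifferentiated, so the step also needs
  \<open>times_differentiable_on_SucD\<close>.\<close>

lemma times_differentiable_on_mult:
  "times_differentiable_on k f U \<Longrightarrow> times_differentiable_on k g U \<Longrightarrow>
     times_differentiable_on k (\<lambda>u. f u * g u) U"
proof (induction k arbitrary: f g)
  case (Suc k)
  from Suc.prems(1) obtain F where
    F: "\<And>u. u \<in> U \<Longrightarrow> (f has_derivative (\<lambda>v. F u \<bullet> v)) (at u)"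
    "\<And>i. times_differentiable_on k (\<lambda>u. F u $ i) U"
    unfolding times_differentiable_on.simps by blast
  from Suc.prems(2) obtain G where
    G: "\<And>u. u \<in> U \<Longrightarrow> (g has_derivative (\<lambda>v. G u \<bullet> v)) (at u)"
    "\<And>i. times_differentiable_on k (\<lambda>u. G u $ i) U"
    unfolding times_differentiable_on.simps by blast
  have "((\<lambda>u. f u * g u) has_derivative (\<lambda>v. (f u *\<^sub>R G u + g u *\<^sub>R F u) \<bullet> v)) (at u)"
    if "u \<in> U" for u
    using has_derivative_mult[OF F(1)[OF that] G(1)[OF that]]
    by (simp add: inner_add_left mult.commute)
  moreover have "times_differentiable_on k f U" "times_differentiable_on k g U"
    using Suc.prems times_differentiable_on_SucD by blast+
  then have "times_differentiable_on k (\<lambda>u. (f u *\<^sub>R G u + g u *\<^sub>R F u) $ i) U" for i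
    unfolding vector_add_component vector_scaleR_component real_scaleR_def
    by (intro times_differentiable_on_add Suc.IH F(2) G(2))
  ultimately show ?case
    by (auto intro!: exI[of _ "\<lambda>u. f u *\<^sub>R G u + g u *\<^sub>R F u"])
qed simp

lemma times_differentiable_on_sum:
  "(\<And>i. i \<in> I \<Longrightarrow> times_differentiable_on k (f i) U) \<Longrightarrow>
     times_differentiable_on k (\<lambda>u. \<Sum>i\<in>I. f i u) U"
  by (induction I rule: infinite_finite_induct)
    (auto intro: times_differentiable_on_add times_differentiable_on_const)

lemma times_differentiable_on_prod:
  "(\<And>i. i \<in> I \<Longrightarrow> times_differentiable_on k (f i) U) \<Longrightarrow>
     times_differentiable_on k (\<lambda>u. \<Prod>i\<in>I. f i u) U"
  by (induction I rule: infinite_finite_induct)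
    (auto intro: times_differentiable_on_mult times_differentiable_on_const)

lemma times_differentiable_on_inverse:
  assumes "times_differentiable_on k f U" "\<And>u. u \<in> U \<Longrightarrow> f u \<noteq> 0"
  shows "times_differentiable_on k (\<lambda>u. inverse (f u)) U"
  using assms(1)
proof (induction k)
  case (Suc k)
  then obtain F where
    *: "\<And>u. u \<in> U \<Longrightarrow> (f has_derivative (\<lambda>v. F u \<bullet> v)) (at u)"
    "\<And>i. times_differentiable_on k (\<lambda>u. F u $ i) U"
    by auto
  have inv: "times_differentiable_on k (\<lambda>u. inverse (f u)) U"
    using Suc times_differentiable_on_SucD by blast
  have "((\<lambda>u. inverse (f u)) has_derivative
      (\<lambda>v. ((- 1 * inverse (f u) * inverse (f u)) *\<^sub>R F u) \<bullet> v)) (at u)" if "u \<in> U" for u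
    using assms(2)[OF that] by (auto intro!: derivative_eq_intros *(1)[OF that])
  moreover have "times_differentiable_on k
      (\<lambda>u. ((- 1 * inverse (f u) * inverse (f u)) *\<^sub>R F u) $ i) U" for i
    unfolding vector_scaleR_component real_scaleR_def
    by (intro times_differentiable_on_mult times_differentiable_on_const inv *(2))
  ultimately show ?case
    by (auto intro!: exI[of _ "\<lambda>u. (- 1 * inverse (f u) * inverse (f u)) *\<^sub>R F u"])
qed simp

lemma times_differentiable_on_ln:
  assumes "times_differentiable_on k f U" "\<And>u. u \<in> U \<Longrightarrow> f u > 0"
  shows "times_differentiable_on k (\<lambda>u. ln (f u)) U"
proof (cases k)
  case (Suc k')
  then obtain F where
    *: "\<And>u. u \<in> U \<Longrightarrow> (f has_derivative (\<lambda>v. F u \<bullet> v)) (at u)"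
    "\<And>i. times_differentiable_on k' (\<lambda>u. F u $ i) U"
    using assms(1) by auto
  have inv: "times_differentiable_on k' (\<lambda>u. inverse (f u)) U"
    using assms Suc times_differentiable_on_SucD times_differentiable_on_inverse
    by (metis less_irrefl)
  have "((\<lambda>u. ln (f u)) has_derivative (\<lambda>v. (inverse (f u) *\<^sub>R F u) \<bullet> v)) (at u)"
    if "u \<in> U" for u
    using assms(2)[OF that]
    by (auto intro!: derivative_eq_intros *(1)[OF that] simp: field_simps)
  moreover have "times_differentiable_on k' (\<lambda>u. (inverse (f u) *\<^sub>R F u) $ i) U" for i
    unfolding vector_scaleR_component real_scaleR_def
    by (intro times_differentiable_on_mult inv *(2))
  ultimately show ?thesis
    unfolding Suc by (auto intro!: exI[of _ "\<lambda>u. inverse (f u) *\<^sub>R F u"])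
qed simp

lemma times_differentiable_on_cong:
  assumes "open U" "\<And>u. u \<in> U \<Longrightarrow> f u = g u" "times_differentiable_on k f U"
  shows "times_differentiable_on k g U"
proof (cases k)
  case (Suc k')
  then obtain F where
    *: "\<And>u. u \<in> U \<Longrightarrow> (f has_derivative (\<lambda>v. F u \<bullet> v)) (at u)"
    "\<And>i. times_differentiable_on k' (\<lambda>u. F u $ i) U"
    using assms(3) by auto
  have "(g has_derivative (\<lambda>v. F u \<bullet> v)) (at u)" if "u \<in> U" for u
    by (rule has_derivative_transform_within_open[OF *(1)[OF that] assms(1) that])
      (simp add: assms(2))
  then show ?thesis
    unfolding Suc using *(2) by auto
qed simp

section \<open>Gradients and partial derivatives\<close>

lemma has_real_derivative_along_axis:
  fixes f :: "real^'m \<Rightarrow> real"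
  assumes "(f has_derivative (\<lambda>v. F \<bullet> v)) (at u)"
  shows "((\<lambda>h. f (u + h *\<^sub>R axis i 1)) has_real_derivative F $ i) (at 0)"
proof -
  have "((\<lambda>h. f (u + h *\<^sub>R axis i 1)) has_derivative (\<lambda>h. F \<bullet> (h *\<^sub>R axis i 1))) (at 0)"
    using assms by (intro has_derivative_compose[of "\<lambda>h. u + h *\<^sub>R axis i 1" _ 0 UNIV f, simplified])
      (auto intro!: derivative_eq_intros)
  then show ?thesis
    by (simp add: has_field_derivative_def inner_axis mult.commute[of _ "F $ i"])
qed

lemma partial_eqI:
  "(f has_derivative (\<lambda>v. F \<bullet> v)) (at u) \<Longrightarrow> partial i f u = F $ i"
  unfolding partial_def by (intro DERIV_imp_deriv has_real_derivative_along_axis)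

lemma times_differentiable_on_partial:
  assumes "open U" "times_differentiable_on (Suc k) f U"
  shows "times_differentiable_on k (partial i f) U"
    and "u \<in> U \<Longrightarrow> (f has_derivative (\<lambda>v. (\<chi> i. partial i f u) \<bullet> v)) (at u)"
proof -
  from assms(2) obtain F where
    *: "\<And>u. u \<in> U \<Longrightarrow> (f has_derivative (\<lambda>v. F u \<bullet> v)) (at u)"
    "\<And>i. times_differentiable_on k (\<lambda>u. F u $ i) U"
    by auto
  show "times_differentiable_on k (partial i f) U"
    by (rule times_differentiable_on_cong[OF assms(1) _ *(2)]) (simp add: partial_eqI[OF *(1)])
  assume "u \<in> U"
  then have "(\<chi> i. partial i f u) = F u"
    by (simp add: vec_eq_iff partial_eqI[OF *(1)])
  then show "(f has_derivative (\<lambda>v. (\<chi> i. partial i f u) \<bullet> v)) (at u)"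
    using *(1)[OF \<open>u \<in> U\<close>] by simp
qed

lemma partial_cong_open:
  assumes "open U" "u \<in> U" "\<And>v. v \<in> U \<Longrightarrow> f v = g v"
  shows "partial i f u = partial i g u"
proof -
  have "\<forall>\<^sub>F h in nhds (0::real). u + h *\<^sub>R axis i 1 \<in> U"
  proof (rule topological_tendstoD)
    show "((\<lambda>h. u + h *\<^sub>R axis i 1) \<longlongrightarrow> u) (nhds (0::real))"
      by (rule tendsto_eq_intros filterlim_ident refl | simp)+
  qed (use assms in auto)
  then have "\<forall>\<^sub>F h in nhds (0::real). f (u + h *\<^sub>R axis i 1) = g (u + h *\<^sub>R axis i 1)"
    by eventually_elim (rule assms(3))
  then show ?thesis
    unfolding partial_def by (intro deriv_cong_ev refl)
qed

text \<open>Meant for \<open>L\<close> a coordinate of the innovation or an entry of the covariance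
  matrix. Derivatives that are bounded linear maps become gradient vectors by evaluating them on the
  vectors \<open>axis j 1\<close>.\<close>

lemma twice_continuously_differentiable_on_imp_times_differentiable_on:
  fixes f :: "real^'m \<Rightarrow> 'b::real_normed_vector"
  assumes "twice_continuously_differentiable_on f U" and L: "bounded_linear L"
  shows "times_differentiable_on 2 (\<lambda>u. L (f u)) U"
proof -
  from assms obtain f' :: "real^'m \<Rightarrow> (real^'m) \<Rightarrow>\<^sub>L 'b"
    and f'' :: "real^'m \<Rightarrow> (real^'m) \<Rightarrow>\<^sub>L ((real^'m) \<Rightarrow>\<^sub>L 'b)"
    where f': "\<And>u. u \<in> U \<Longrightarrow> (f has_derivative blinfun_apply (f' u)) (at u)"
      and f'': "\<And>u. u \<in> U \<Longrightarrow> (f' has_derivative blinfun_apply (f'' u)) (at u)"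
    unfolding twice_continuously_differentiable_on_def by blast
  have expand: "g v = (\<chi> j. g (axis j 1)) \<bullet> v" if "linear g" for g :: "real^'m \<Rightarrow> real" and v
  proof -
    have "g v = g (\<Sum>j\<in>UNIV. v $ j *\<^sub>R axis j 1)"
      using basis_expansion[of v] by (simp add: scalar_mult_eq_scaleR)
    also have "\<dots> = (\<Sum>j\<in>UNIV. v $ j * g (axis j 1))"
      using that by (simp add: linear_sum linear_scale)
    also have "\<dots> = (\<chi> j. g (axis j 1)) \<bullet> v"
      by (simp add: inner_vec_def mult.commute)
    finally show ?thesis .
  qed
  have lin: "linear (\<lambda>v. L (blinfun_apply A v))" for A :: "(real^'m) \<Rightarrow>\<^sub>L 'b"
    using bounded_linear_compose[OF L blinfun.bounded_linear_right] bounded_linear.linear by blast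
  have lin2: "linear (\<lambda>v. L (blinfun_apply (blinfun_apply A v) z))"
    for A :: "(real^'m) \<Rightarrow>\<^sub>L ((real^'m) \<Rightarrow>\<^sub>L 'b)" and z
    using bounded_linear_compose[OF L bounded_linear_compose[OF blinfun.bounded_linear_left
        blinfun.bounded_linear_right]] bounded_linear.linear by blast
  define F where "F u = (\<chi> j. L (blinfun_apply (f' u) (axis j 1)))" for u
  define G where "G i u = (\<chi> j. L (blinfun_apply (blinfun_apply (f'' u) (axis j 1)) (axis i 1)))" for i u
  have F: "((\<lambda>u. L (f u)) has_derivative (\<lambda>v. F u \<bullet> v)) (at u)" if "u \<in> U" for u
  proof -
    have "((\<lambda>u. L (f u)) has_derivative (\<lambda>v. L (blinfun_apply (f' u) v))) (at u)"
      by (rule bounded_linear.has_derivative[OF L f'[OF that]])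
    also have "(\<lambda>v. L (blinfun_apply (f' u) v)) = (\<lambda>v. F u \<bullet> v)"
      unfolding F_def by (rule ext) (rule expand[OF lin])
    finally show ?thesis .
  qed
  have G: "((\<lambda>u. F u $ i) has_derivative (\<lambda>v. G i u \<bullet> v)) (at u)" if "u \<in> U" for u i
  proof -
    have "((\<lambda>u. L (blinfun_apply (f' u) (axis i 1))) has_derivative
        (\<lambda>v. L (blinfun_apply (blinfun_apply (f'' u) v) (axis i 1)))) (at u)"
      by (rule bounded_linear.has_derivative[OF L bounded_linear.has_derivative[OF
          blinfun.bounded_linear_left f''[OF that]]])
    also have "(\<lambda>v. L (blinfun_apply (blinfun_apply (f'' u) v) (axis i 1))) = (\<lambda>v. G i u \<bullet> v)"
      unfolding G_def by (rule ext) (rule expand[OF lin2])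
    finally show ?thesis
      by (simp add: F_def)
  qed
  have "times_differentiable_on (Suc 0) (\<lambda>u. F u $ i) U" for i
    unfolding times_differentiable_on.simps using G by blast
  then show ?thesis
    unfolding numeral_2_eq_2 times_differentiable_on.simps(2)[of "Suc 0"] using F by blast
qed

section \<open>Strong convexity and condition (d)\<close>

text \<open>Taylor's formula of order two, with Lagrange remainder, for the restriction of
  \<open>f\<close> to the segment; the Hessian bound is applied at the intermediate point.\<close>

lemma strong_convexity_lower_bound:
  fixes f :: "real^'m \<Rightarrow> real"
  assumes U: "open U" "closed_segment p q \<subseteq> U" and f: "times_differentiable_on 2 f U"
    and c: "\<And>u v. u \<in> closed_segment p q \<Longrightarrow>
      c * (norm v)\<^sup>2 \<le> (\<Sum>i\<in>UNIV. \<Sum>j\<in>UNIV. v $ i * v $ j * partial i (partial j f) u)"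
  shows "f q \<ge> f p + (\<chi> i. partial i f p) \<bullet> (q - p) + c / 2 * (norm (q - p))\<^sup>2"
proof -
  define y where "y s = p + s *\<^sub>R (q - p)" for s :: real
  have yU: "y s \<in> closed_segment p q" if "0 \<le> s" "s \<le> 1" for s
    using that unfolding y_def closed_segment_def by (auto simp: algebra_simps intro!: exI[of _ s])
  have yd: "(y has_derivative (\<lambda>h. h *\<^sub>R (q - p))) (at s)" for s
    unfolding y_def by (auto intro!: derivative_eq_intros)
  have along: "((\<lambda>s. g (y s)) has_real_derivative (\<chi> i. partial i g (y s)) \<bullet> (q - p)) (at s)"
    if "0 \<le> s" "s \<le> 1" "times_differentiable_on (Suc k) g U" for g s k
  proof -
    have "(g has_derivative (\<lambda>v. (\<chi> i. partial i g (y s)) \<bullet> v)) (at (y s))"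
      using that yU U by (intro times_differentiable_on_partial) auto
    from has_derivative_compose[OF yd this] show ?thesis
      by (simp add: has_field_derivative_def mult_commute_abs)
  qed
  have f1: "times_differentiable_on (Suc 0) (partial j f) U" for j
    using f times_differentiable_on_partial(1)[OF U(1)] unfolding numeral_2_eq_2 by blast
  \<comment> \<open>The successive derivatives of \<open>f\<close> along the segment, in the form
    that \<open>Maclaurin\<close> expects; with two terms it reads only the orders 0, 1 and
    2.\<close>
  define diff where "diff m s = (if m = 0 then f (y s) else
      if m = 1 then (\<chi> i. partial i f (y s)) \<bullet> (q - p) else
      (\<Sum>j\<in>UNIV. ((\<chi> i. partial i (partial j f) (y s)) \<bullet> (q - p)) * (q - p) $ j))"
    for m :: nat and s
  have "\<exists>t>0. t < 1 \<and> f (y 1) = (\<Sum>m<2. diff m 0 / fact m * 1 ^ m) + diff 2 t / fact 2 * 1 ^ 2"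
  proof (rule Maclaurin)
    show "diff 0 = (\<lambda>s. f (y s))" by (simp add: diff_def[abs_def])
    show "\<forall>m t. m < 2 \<and> 0 \<le> t \<and> t \<le> 1 \<longrightarrow> DERIV (diff m) t :> diff (Suc m) t"
    proof safe
      fix m :: nat and t :: real assume t: "m < 2" "0 \<le> t" "t \<le> 1"
      then consider "m = 0" | "m = 1" by linarith
      then show "DERIV (diff m) t :> diff (Suc m) t"
      proof cases
        case 1
        have "times_differentiable_on (Suc (Suc 0)) f U"
          using f unfolding numeral_2_eq_2 .
        from along[OF t(2,3) this] show ?thesis
          unfolding 1 by (simp add: diff_def[abs_def])
      next
        case 2
        have "((\<lambda>s. \<Sum>j\<in>UNIV. partial j f (y s) * (q - p) $ j) has_real_derivative diff 2 t) (at t)"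
          unfolding diff_def by (auto intro!: derivative_eq_intros along[OF t(2,3) f1])
        then show ?thesis
          unfolding 2 by (simp add: diff_def[abs_def] inner_vec_def numeral_2_eq_2)
      qed
    qed
  qed auto
  then obtain t where t: "0 < t" "t < 1" "f (y 1) = diff 0 0 + diff 1 0 + diff 2 t / 2"
    by (auto simp: numeral_2_eq_2)
  have "diff 2 t = (\<Sum>i\<in>UNIV. \<Sum>j\<in>UNIV. (q - p) $ i * (q - p) $ j * partial i (partial j f) (y t))"
    unfolding diff_def inner_vec_def
    by (subst sum.swap) (simp add: sum_distrib_left sum_distrib_right mult_ac)
  also have "\<dots> \<ge> c * (norm (q - p))\<^sup>2"
    using c[OF yU, of t "q - p"] t by simp
  finally show ?thesis
    using t(3) by (simp add: diff_def y_def)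
qed

lemma partial_add_const:
  assumes "open U" "times_differentiable_on (Suc k) f U" "u \<in> U"
  shows "partial i (\<lambda>v. f v + b) u = partial i f u"
proof -
  have "((\<lambda>v. f v + b) has_derivative (\<lambda>v. (\<chi> i. partial i f u) \<bullet> v)) (at u)"
    using has_derivative_add[OF times_differentiable_on_partial(2)[OF assms] has_derivative_const[of b]]
    by simp
  from partial_eqI[OF this] show ?thesis
    by simp
qed

text \<open>Extracts from (d) a bound linear in the radius: a finite limsup lies below some
  constant, eventually the supremum does too, and \<open>u\<close> itself is a point of
  \<open>closed_segment \<theta>0 u\<close>.\<close>

lemma local_Lipschitz_of_limsup:
  fixes h :: "nat \<Rightarrow> 'a::euclidean_space \<Rightarrow> real"
  assumes "limsup (\<lambda>n. SUP \<Delta>\<in>{0<..<\<delta>}. SUP \<theta>\<in>ball \<theta>0 \<Delta>. SUP \<theta>s\<in>closed_segment \<theta>0 \<theta>.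
      ereal (inverse (real n * \<Delta>) * \<bar>h n \<theta>s\<bar>)) < \<infinity>"
  obtains K where "\<forall>\<^sub>F n in sequentially. \<forall>\<Delta>\<in>{0<..<\<delta>}. \<forall>u\<in>ball \<theta>0 \<Delta>. \<bar>h n u\<bar> \<le> K * (real n * \<Delta>)"
proof -
  let ?g = "\<lambda>n. SUP \<Delta>\<in>{0<..<\<delta>}. SUP \<theta>\<in>ball \<theta>0 \<Delta>. SUP \<theta>s\<in>closed_segment \<theta>0 \<theta>.
      ereal (inverse (real n * \<Delta>) * \<bar>h n \<theta>s\<bar>)"
  have "limsup ?g \<noteq> \<infinity>"
    using assms by simp
  then obtain K :: nat where "limsup ?g < ereal (real K)"
    using less_PInf_Ex_of_nat by blast
  then have "\<forall>\<^sub>F n in sequentially. ?g n < ereal (real K)"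
    by (rule Limsup_lessD)
  \<comment> \<open>For \<open>n = 0\<close> the convention \<open>inverse 0 = 0\<close> makes the
    supremum vanish whatever \<open>h\<close> is, so positive \<open>n\<close> are selected.\<close>
  then have "\<forall>\<^sub>F n in sequentially. \<forall>\<Delta>\<in>{0<..<\<delta>}. \<forall>u\<in>ball \<theta>0 \<Delta>. \<bar>h n u\<bar> \<le> real K * (real n * \<Delta>)"
    using eventually_gt_at_top[of 0]
  proof eventually_elim
    case (elim n)
    show ?case
    proof (intro ballI)
      fix \<Delta> u assume \<Delta>: "\<Delta> \<in> {0<..<\<delta>}" and u: "u \<in> ball \<theta>0 \<Delta>"
      have "ereal (inverse (real n * \<Delta>) * \<bar>h n u\<bar>) \<le> ?g n"
        by (rule SUP_upper2[OF \<Delta>], rule SUP_upper2[OF u], rule SUP_upper2[of u]) auto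
      also note elim(1)
      finally have "inverse (real n * \<Delta>) * \<bar>h n u\<bar> < real K"
        by simp
      moreover have "real n * \<Delta> > 0"
        using elim(2) \<Delta> by simp
      ultimately show "\<bar>h n u\<bar> \<le> real K * (real n * \<Delta>)"
        by (simp add: field_simps)
    qed
  qed
  then show thesis
    by (rule that)
qed

section \<open>Determinants, inverse matrices and quadratic forms\<close>

lemma
  fixes A :: "real^'n^'n"
  assumes "invertible A"
  shows matrix_inv_right: "A ** matrix_inv A = mat 1"
    and matrix_inv_left: "matrix_inv A ** A = mat 1"
proof -
  have "A ** matrix_inv A = mat 1 \<and> matrix_inv A ** A = mat 1"
    unfolding matrix_inv_def by (rule someI_ex) (use assms in \<open>simp only: invertible_def\<close>)
  then show "A ** matrix_inv A = mat 1" "matrix_inv A ** A = mat 1"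
    by simp_all
qed

section \<open>Jacobi's formula and derivatives of the inverse\<close>

text \<open>With \<open>B = C ** A\<close>, row \<open>i\<close> of \<open>B\<close> is a
  combination of the rows of \<open>A\<close>, and only its multiple \<open>C $ i $ i\<close> of row
  \<open>i\<close> survives in the determinant. Summation gives the trace of
  \<open>C\<close>.\<close>

lemma det_replace_row_trace:
  fixes A B :: "real^'n^'n"
  assumes "det A \<noteq> 0"
  shows "(\<Sum>i\<in>UNIV. det (\<chi> j. if j = i then B $ j else A $ j)) = det A * trace (matrix_inv A ** B)"
proof -
  have inv: "invertible A" using assms invertible_det_nz by blast
  define C where "C = B ** matrix_inv A"
  have CA: "C ** A = B"
    unfolding C_def by (simp only: matrix_mul_assoc[symmetric] matrix_inv_left[OF inv] matrix_mul_rid)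
  have "det (\<chi> j. if j = i then B $ j else A $ j) = C $ i $ i * det A" for i
  proof -
    have "B $ i = (\<Sum>k\<in>UNIV. (C $ i) $ k *s row k A)"
      unfolding CA[symmetric] by (simp add: vec_eq_iff matrix_matrix_mult_def row_def)
    then have "(\<chi> j. if j = i then B $ j else A $ j) =
        (\<chi> j. if j = i then (\<Sum>k\<in>UNIV. (C $ i) $ k *s row k A) else row j A)"
      by (auto simp: vec_eq_iff row_def)
    then show ?thesis
      using cramer_lemma_transpose[of i "C $ i" A] by simp
  qed
  then have "(\<Sum>i\<in>UNIV. det (\<chi> j. if j = i then B $ j else A $ j)) = det A * trace C"
    by (simp add: trace_def sum_distrib_left mult.commute)
  then show ?thesis
    unfolding C_def by (simp only: trace_mul_sym[of B])
qed

text \<open>Jacobi's formula: the product rule in the Leibniz expansion replaces one row at a time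
  by its derivative.\<close>

lemma det_has_real_derivative:
  fixes A :: "real \<Rightarrow> real^'n^'n"
  assumes "\<And>k l. ((\<lambda>h. A h $ k $ l) has_real_derivative A' $ k $ l) (at s)" "det (A s) \<noteq> 0"
  shows "((\<lambda>h. det (A h)) has_real_derivative det (A s) * trace (matrix_inv (A s) ** A')) (at s)"
proof -
  have prod: "(\<Prod>j\<in>UNIV. (if j = i then A' $ j else A s $ j) $ p j) =
      A' $ i $ p i * (\<Prod>j\<in>UNIV - {i}. A s $ j $ p j)" for i p
    by (subst prod.remove[of UNIV i]) (auto intro!: prod.cong)
  have "((\<lambda>h. det (A h)) has_real_derivative
     (\<Sum>p | p permutes UNIV. of_int (sign p) *
        (\<Sum>i\<in>UNIV. A' $ i $ p i * (\<Prod>j\<in>UNIV - {i}. A s $ j $ p j)))) (at s)"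
    unfolding det_def
    by (intro DERIV_sum DERIV_cmult has_field_derivative_prod assms)
  also have "(\<Sum>p | p permutes UNIV. of_int (sign p) *
        (\<Sum>i\<in>UNIV. A' $ i $ p i * (\<Prod>j\<in>UNIV - {i}. A s $ j $ p j))) =
      (\<Sum>i\<in>UNIV. det (\<chi> j. if j = i then A' $ j else A s $ j))"
    unfolding det_def by (subst sum.swap) (simp add: prod sum_distrib_left)
  finally show ?thesis
    unfolding det_replace_row_trace[OF assms(2)] .
qed

text \<open>Makes the entries of the inverse quotients of polynomials in the entries of
  \<open>A\<close>; both the differentiability and the measurability of \<open>matrix_inv\<close>
  rest on this.\<close>

lemma matrix_inv_cramer:
  fixes A :: "real^'n^'n"
  assumes "det A \<noteq> 0"
  shows "matrix_inv A $ k $ l = det (\<chi> i j. if j = k then axis l 1 $ i else A $ i $ j) / det A"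
proof -
  have "A *v (matrix_inv A *v axis l 1) = axis l 1"
    using assms by (simp add: matrix_vector_mul_assoc matrix_inv_right invertible_det_nz)
  then have "(matrix_inv A *v axis l 1) $ k =
      det (\<chi> i j. if j = k then axis l 1 $ i else A $ i $ j) / det A"
    unfolding cramer[OF assms] by simp
  then show ?thesis
    by (simp add: matrix_vector_mult_basis column_def)
qed

lemma times_differentiable_on_det:
  fixes A :: "real^'m \<Rightarrow> real^'n^'n"
  assumes "\<And>k l. times_differentiable_on n (\<lambda>u. A u $ k $ l) U"
  shows "times_differentiable_on n (\<lambda>u. det (A u)) U"
  unfolding det_def
  by (intro times_differentiable_on_sum times_differentiable_on_mult
      times_differentiable_on_prod times_differentiable_on_const assms)

lemma times_differentiable_on_matrix_inv:
  fixes A :: "real^'m \<Rightarrow> real^'n^'n"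
  assumes "open U" and A: "\<And>k l. times_differentiable_on n (\<lambda>u. A u $ k $ l) U"
    and nz: "\<And>u. u \<in> U \<Longrightarrow> det (A u) \<noteq> 0"
  shows "times_differentiable_on n (\<lambda>u. matrix_inv (A u) $ k $ l) U"
proof (rule times_differentiable_on_cong[OF assms(1)])
  have "times_differentiable_on n (\<lambda>u. if j = k then axis l 1 $ i else A u $ i $ j) U" for i j
    using A by (cases "j = k") (auto intro: times_differentiable_on_const)
  then show "times_differentiable_on n
      (\<lambda>u. det (\<chi> i j. if j = k then axis l 1 $ i else A u $ i $ j) * inverse (det (A u))) U"
    using nz A by (intro times_differentiable_on_mult times_differentiable_on_inverse
        times_differentiable_on_det) simp_all
  show "det (\<chi> i j. if j = k then axis l 1 $ i else A u $ i $ j) * inverse (det (A u)) =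
      matrix_inv (A u) $ k $ l" if "u \<in> U" for u
    using matrix_inv_cramer[OF nz[OF that]] by (simp add: divide_inverse)
qed

text \<open>Differentiate the constant trace of \<open>A\<^sup>-\<^sup>1 A\<close>.\<close>

lemma trace_matrix_inv_derivative:
  fixes A :: "real \<Rightarrow> real^'n^'n"
  assumes A: "\<And>k l. ((\<lambda>h. A h $ k $ l) has_real_derivative A' $ k $ l) (at s)"
    and R: "\<And>k l. ((\<lambda>h. matrix_inv (A h) $ k $ l) has_real_derivative R' $ k $ l) (at s)"
    and inv: "\<forall>\<^sub>F h in nhds s. det (A h) \<noteq> 0"
  shows "trace (matrix_inv (A s) ** A') = - (\<Sum>k\<in>UNIV. \<Sum>l\<in>UNIV. R' $ k $ l * A s $ l $ k)"
proof -
  have "((\<lambda>h. \<Sum>k\<in>UNIV. \<Sum>l\<in>UNIV. matrix_inv (A h) $ k $ l * A h $ l $ k) has_real_derivative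
     (\<Sum>k\<in>UNIV. \<Sum>l\<in>UNIV. R' $ k $ l * A s $ l $ k + A' $ l $ k * matrix_inv (A s) $ k $ l)) (at s)"
    by (intro DERIV_sum DERIV_mult A R)
  moreover have "\<forall>\<^sub>F h in nhds s. (\<Sum>k\<in>UNIV. \<Sum>l\<in>UNIV. matrix_inv (A h) $ k $ l * A h $ l $ k) =
      trace (mat 1 :: real^'n^'n)"
    using inv
  proof eventually_elim
    case (elim h)
    have "(\<Sum>k\<in>UNIV. \<Sum>l\<in>UNIV. matrix_inv (A h) $ k $ l * A h $ l $ k) =
        trace (matrix_inv (A h) ** A h)"
      by (simp add: trace_def matrix_matrix_mult_def)
    then show ?case
      using elim by (simp add: matrix_inv_left invertible_det_nz)
  qed
  then have "((\<lambda>h. \<Sum>k\<in>UNIV. \<Sum>l\<in>UNIV. matrix_inv (A h) $ k $ l * A h $ l $ k)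
      has_real_derivative 0) (at s)"
    by (subst DERIV_cong_ev[OF refl _ refl]) auto
  ultimately have "(\<Sum>k\<in>UNIV. \<Sum>l\<in>UNIV. R' $ k $ l * A s $ l $ k + A' $ l $ k * matrix_inv (A s) $ k $ l) = 0"
    using DERIV_unique by blast
  then show ?thesis
    by (simp add: sum.distrib trace_def matrix_matrix_mult_def mult.commute)
qed

text \<open>The derivative of \<open>ln (det A)\<close> is a trace in \<open>A'\<close>; trading
  \<open>A'\<close> for the derivative \<open>R'\<close> of the inverse gives it the same
  coefficients as the quadratic form, so that \<open>e e^T - A\<close> appears. When
  \<open>A\<close> is the conditional covariance of \<open>e\<close>, both this matrix and
  \<open>e\<close> are conditionally centred.\<close>

lemma quasi_likelihood_derivative:
  fixes A :: "real \<Rightarrow> real^'n^'n" and e :: "real \<Rightarrow> real^'n"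
  assumes A: "\<And>k l. ((\<lambda>h. A h $ k $ l) has_real_derivative A' $ k $ l) (at s)"
    and R: "\<And>k l. ((\<lambda>h. matrix_inv (A h) $ k $ l) has_real_derivative R' $ k $ l) (at s)"
    and e: "\<And>k. ((\<lambda>h. e h $ k) has_real_derivative e' $ k) (at s)"
    and pos: "\<forall>\<^sub>F h in nhds s. det (A h) > 0"
    and sym: "\<And>k l. A s $ k $ l = A s $ l $ k"
  shows "((\<lambda>h. ln (det (A h)) + e h \<bullet> (matrix_inv (A h) *v e h)) has_real_derivative
     (\<Sum>k\<in>UNIV. \<Sum>l\<in>UNIV. R' $ k $ l * (e s $ k * e s $ l - A s $ k $ l)) +
     (\<Sum>k\<in>UNIV. (\<Sum>l\<in>UNIV. e' $ l * (matrix_inv (A s) $ l $ k + matrix_inv (A s) $ k $ l)) * e s $ k))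
     (at s)"
proof -
  let ?R = "matrix_inv (A s)"
  have pos_s: "det (A s) > 0"
    using eventually_nhds_x_imp_x[OF pos] .
  have nz: "\<forall>\<^sub>F h in nhds s. det (A h) \<noteq> 0"
    using pos by eventually_elim simp
  have "((\<lambda>h. ln (det (A h))) has_real_derivative
      inverse (det (A s)) * (det (A s) * trace (?R ** A'))) (at s)"
    using pos_s by (intro DERIV_chain2[OF DERIV_ln] det_has_real_derivative A) auto
  then have 1: "((\<lambda>h. ln (det (A h))) has_real_derivative
      - (\<Sum>k\<in>UNIV. \<Sum>l\<in>UNIV. R' $ k $ l * A s $ l $ k)) (at s)"
    using pos_s by (simp add: trace_matrix_inv_derivative[OF A R nz] field_simps)
  have "((\<lambda>h. \<Sum>k\<in>UNIV. e h $ k * (\<Sum>l\<in>UNIV. matrix_inv (A h) $ k $ l * e h $ l)) has_real_derivative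
      (\<Sum>k\<in>UNIV. e' $ k * (\<Sum>l\<in>UNIV. ?R $ k $ l * e s $ l) +
        (\<Sum>l\<in>UNIV. R' $ k $ l * e s $ l + e' $ l * ?R $ k $ l) * e s $ k)) (at s)"
    by (intro DERIV_sum DERIV_mult R e)
  then have 2: "((\<lambda>h. e h \<bullet> (matrix_inv (A h) *v e h)) has_real_derivative
      (\<Sum>k\<in>UNIV. e' $ k * (\<Sum>l\<in>UNIV. ?R $ k $ l * e s $ l) +
        (\<Sum>l\<in>UNIV. R' $ k $ l * e s $ l + e' $ l * ?R $ k $ l) * e s $ k)) (at s)"
    by (simp add: inner_vec_def matrix_vector_mult_def)
  \<comment> \<open>Symmetry of \<open>A s\<close> aligns the trace term with
    \<open>e s $ k * e s $ l\<close>; exchanging \<open>k\<close> and \<open>l\<close> merges the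
    two halves of the derivative of the quadratic form.\<close>
  show ?thesis
    using DERIV_add[OF 1 2]
    by (rule DERIV_cong) (simp add: sum.distrib sum_distrib_left sum_distrib_right algebra_simps
        sum_subtractf sym, subst sum.swap, simp add: mult_ac)
qed

section \<open>Positivity\<close>

text \<open>On the segment from the identity to \<open>A\<close>, a nonpositive end value of the
  determinant would force a zero strictly before \<open>A\<close>, yet the quadratic form is
  positive definite there.\<close>

lemma det_pos_if_psd_invertible:
  fixes A :: "real^'n^'n"
  assumes psd: "\<And>v. 0 \<le> v \<bullet> (A *v v)" and inv: "invertible A"
  shows "det A > 0"
proof (rule ccontr)
  assume "\<not> det A > 0"
  define g where "g s = det ((1 - s) *\<^sub>R mat 1 + s *\<^sub>R A)" for s :: real
  have "continuous_on {0..1} g"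
    unfolding g_def det_def
    by (intro continuous_intros)
  moreover have "g 0 = 1" "g 1 = det A"
    by (auto simp: g_def)
  ultimately obtain s where s: "0 \<le> s" "s \<le> 1" "g s = 0"
    using IVT2'[of g 1 0 0] \<open>\<not> det A > 0\<close> by auto
  have "det A \<noteq> 0"
    using inv by (simp add: invertible_det_nz)
  then have "s \<noteq> 1"
    using s \<open>g 1 = det A\<close> by auto
  obtain v :: "real^'n" where v: "v \<noteq> 0" "((1 - s) *\<^sub>R mat 1 + s *\<^sub>R A) *v v = 0"
    using s(3) unfolding g_def by (metis invertible_det_nz invertible_left_inverse matrix_left_invertible_ker)
  have "0 = v \<bullet> (((1 - s) *\<^sub>R mat 1 + s *\<^sub>R A) *v v)"
    using v by simp
  also have "\<dots> = (1 - s) * (v \<bullet> v) + s * (v \<bullet> (A *v v))"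
    by (simp add: matrix_vector_mult_add_rdistrib scaleR_matrix_vector_assoc[symmetric] inner_add_right)
  also have "\<dots> > 0"
    using s \<open>s \<noteq> 1\<close> v psd[of v] by (intro add_pos_nonneg) auto
  finally show False by simp
qed

lemma det_pos_on_connected:
  fixes A :: "real^'m \<Rightarrow> real^'n^'n"
  assumes "connected U" "open U" "\<And>k l. times_differentiable_on (Suc 0) (\<lambda>u. A u $ k $ l) U"
    and nz: "\<And>u. u \<in> U \<Longrightarrow> det (A u) \<noteq> 0" and "u0 \<in> U" "det (A u0) > 0" "u \<in> U"
  shows "det (A u) > 0"
proof (rule ccontr)
  assume "\<not> det (A u) > 0"
  have "times_differentiable_on (Suc 0) (\<lambda>u. det (A u)) U"
    by (intro times_differentiable_on_det assms)
  then have "continuous_on U (\<lambda>u. det (A u))"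
    using assms(2) by (force simp: continuous_on_eq_continuous_at intro: has_derivative_continuous)
  then have "connected ((\<lambda>u. det (A u)) ` U)"
    using assms(1) connected_continuous_image by blast
  then have "0 \<in> (\<lambda>u. det (A u)) ` U"
    using \<open>\<not> det (A u) > 0\<close> assms(5-7) unfolding connected_iff_interval
    by (metis imageI less_imp_le not_less)
  then show False using nz by auto
qed

text \<open>The constant is the minimum of the quadratic form over the compact unit sphere;
  homogeneity does the rest.\<close>

lemma strictly_positive_definite_lower_bound:
  fixes V :: "real^'m^'m"
  assumes "strictly_positive_definite V"
  obtains c where "c > 0" "\<And>v. c * (norm v)\<^sup>2 \<le> v \<bullet> (V *v v)"
proof -
  let ?q = "\<lambda>v. v \<bullet> (V *v v)"
  have "continuous_on (sphere 0 1) ?q"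
    by (rule continuous_on_inner[OF continuous_on_id matrix_vector_mult_linear_continuous_on])
  moreover have "sphere (0 :: real^'m) 1 \<noteq> {}"
    by simp
  ultimately obtain u where u: "u \<in> sphere 0 1" "\<And>v. v \<in> sphere 0 1 \<Longrightarrow> ?q u \<le> ?q v"
    using continuous_attains_inf[OF compact_sphere, of 0 1 ?q] by blast
  have "u \<noteq> 0"
    using u(1) by auto
  then have "?q u > 0"
    using assms unfolding strictly_positive_definite_def by blast
  moreover have "?q u * (norm v)\<^sup>2 \<le> ?q v" for v
  proof (cases "v = 0")
    case False
    have "?q u \<le> ?q ((1 / norm v) *\<^sub>R v)"
      using False by (intro u(2)) simp
    also have "\<dots> = ?q v / (norm v)\<^sup>2"
      by (simp add: scaleR_matrix_vector_assoc[symmetric] matrix_vector_mult_scaleR power2_eq_square)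
    finally show ?thesis
      using False by (simp add: pos_le_divide_eq)
  qed simp
  ultimately show thesis
    by (rule that)
qed

text \<open>Each pair of indices costs at most \<open>\<epsilon> * (norm v)\<^sup>2\<close>, which
  allows the Hessian to be compared with \<open>V\<close> entry by entry.\<close>

lemma quadratic_form_perturbation:
  fixes V :: "real^'m^'m"
  assumes "\<And>i j. \<bar>A i j - V $ i $ j\<bar> \<le> \<epsilon>"
  shows "v \<bullet> (V *v v) - (real CARD('m))\<^sup>2 * \<epsilon> * (norm v)\<^sup>2 \<le>
    (\<Sum>i\<in>UNIV. \<Sum>j\<in>UNIV. v $ i * v $ j * A i j)"
proof -
  have term_le: "v $ i * v $ j * (V $ i $ j - A i j) \<le> \<epsilon> * (norm v)\<^sup>2" for i j
  proof -
    have "v $ i * v $ j * (V $ i $ j - A i j) \<le> \<bar>v $ i\<bar> * \<bar>v $ j\<bar> * \<bar>A i j - V $ i $ j\<bar>"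
      by (metis abs_ge_self abs_minus_commute abs_mult)
    also have "\<dots> \<le> (norm v * norm v) * \<epsilon>"
      by (intro mult_mono component_le_norm_cart assms) auto
    finally show ?thesis
      by (simp add: power2_eq_square mult.commute)
  qed
  have "v \<bullet> (V *v v) - (\<Sum>i\<in>UNIV. \<Sum>j\<in>UNIV. v $ i * v $ j * A i j) =
      (\<Sum>i\<in>UNIV. \<Sum>j\<in>UNIV. v $ i * v $ j * (V $ i $ j - A i j))"
    by (simp add: inner_vec_def matrix_vector_mult_def sum_distrib_left right_diff_distrib
        sum_subtractf mult_ac)
  also have "\<dots> \<le> (\<Sum>i\<in>(UNIV :: 'm set). \<Sum>j\<in>(UNIV :: 'm set). \<epsilon> * (norm v)\<^sup>2)"
    by (intro sum_mono term_le)
  finally show ?thesis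
    by (simp add: power2_eq_square algebra_simps)
qed

section \<open>Measurable minimisers\<close>

lemma dense_sequence:
  fixes K :: "'a::euclidean_space set"
  assumes "K \<noteq> {}"
  obtains d :: "nat \<Rightarrow> 'a" where "range d \<subseteq> K" "K \<subseteq> closure (range d)"
proof -
  obtain D where D: "countable D" "D \<subseteq> K" "K \<subseteq> closure D"
    by (rule separable)
  then have "D \<noteq> {}"
    using assms by auto
  then have "range (from_nat_into D) = D"
    using D(1) by (rule range_from_nat_into)
  then show thesis
    using that[of "from_nat_into D"] D by simp
qed

text \<open>Choosing the least admissible index makes this a function with countably many values,
  determined by the countably many numbers \<open>f (d l)\<close>. Measurability in a random
  \<open>f\<close> is then elementary.\<close>

definition approx_argmin :: "(nat \<Rightarrow> 'a) \<Rightarrow> ('a \<Rightarrow> real) \<Rightarrow> nat \<Rightarrow> 'a" where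
  "approx_argmin d f k = d (LEAST j. \<forall>l. f (d j) \<le> f (d l) + inverse (Suc k))"

text \<open>Success is phrased through the computed sequence alone, not through smoothness or
  convexity of \<open>f\<close>, so that it is an observable event.\<close>

definition argmin_found :: "(nat \<Rightarrow> real^'m) \<Rightarrow> real^'m \<Rightarrow> real \<Rightarrow> (real^'m \<Rightarrow> real) \<Rightarrow> bool" where
  "argmin_found d a r f \<longleftrightarrow> Cauchy (approx_argmin d f) \<and> lim (approx_argmin d f) \<in> ball a r"

text \<open>The default value is the centre, so that an unsuccessful search does not endanger
  consistency.\<close>

definition argmin_in_ball :: "(nat \<Rightarrow> real^'m) \<Rightarrow> real^'m \<Rightarrow> real \<Rightarrow> (real^'m \<Rightarrow> real) \<Rightarrow> real^'m" where
  "argmin_in_ball d a r f = (if argmin_found d a r f then lim (approx_argmin d f) else a)"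

lemma approx_argmin_measurable:
  assumes [measurable]: "\<And>l. (\<lambda>w. f w (d l)) \<in> borel_measurable G"
  shows "(\<lambda>w. approx_argmin d (f w) k :: 'a::topological_space) \<in> borel_measurable G"
proof -
  have "(\<lambda>w. LEAST j. \<forall>l. f w (d j) \<le> f w (d l) + inverse (Suc k)) \<in> measurable G (count_space UNIV)"
    by measurable
  then show ?thesis
    unfolding approx_argmin_def by (rule measurable_compose) simp
qed

lemma argmin_found_measurable:
  assumes "\<And>l. (\<lambda>w. f w (d l)) \<in> borel_measurable G"
  shows "{w \<in> space G. argmin_found d a r (f w)} \<in> sets G"
proof -
  note [measurable] = approx_argmin_measurable[where f = f and d = d, OF assms]
  have "(\<lambda>w. lim (\<lambda>k. approx_argmin d (f w) k)) \<in> borel_measurable G"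
    by measurable
  then have 1: "(\<lambda>w. lim (approx_argmin d (f w))) -` ball a r \<inter> space G \<in> sets G"
    by (intro measurable_sets[of _ G borel]) auto
  have 2: "{w \<in> space G. Cauchy (\<lambda>k. approx_argmin d (f w) k)} \<in> sets G"
    by (rule sets_Collect_Cauchy) measurable
  have "{w \<in> space G. argmin_found d a r (f w)} = {w \<in> space G. Cauchy (\<lambda>k. approx_argmin d (f w) k)} \<inter>
      ((\<lambda>w. lim (approx_argmin d (f w))) -` ball a r \<inter> space G)"
    unfolding argmin_found_def by auto
  then show ?thesis
    using 1 2 by auto
qed

lemma argmin_in_ball_measurable:
  assumes "\<And>l. (\<lambda>w. f w (d l)) \<in> borel_measurable G"
  shows "(\<lambda>w. argmin_in_ball d a r (f w)) \<in> borel_measurable G"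
proof -
  note [measurable] = approx_argmin_measurable[where f = f and d = d, OF assms]
  have "(\<lambda>w. lim (\<lambda>k. approx_argmin d (f w) k)) \<in> borel_measurable G"
    by measurable
  then show ?thesis
    unfolding argmin_in_ball_def
    by (intro measurable_If argmin_found_measurable assms) auto
qed

lemma argmin_in_ball_mem: "argmin_in_ball d a r f = a \<or> argmin_in_ball d a r f \<in> ball a r"
  unfolding argmin_in_ball_def argmin_found_def by auto

text \<open>By continuity some point of the dense sequence comes within
  \<open>inverse (Suc k)\<close> of the true minimum, so the \<open>LEAST\<close> is taken over a
  nonempty set. A second use of density extends the comparison from the sequence to all of
  \<open>K\<close>.\<close>

lemma approx_argmin_le:
  fixes K :: "(real^'m) set"
  assumes f: "continuous_on K f" and K: "compact K"
    and d: "range d \<subseteq> K" "K \<subseteq> closure (range d)" and u: "u \<in> K"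
  shows "f (approx_argmin d f k) \<le> f u + inverse (Suc k)"
proof -
  obtain b where b: "b \<in> K" "\<And>v. v \<in> K \<Longrightarrow> f b \<le> f v"
    using continuous_attains_inf[OF K _ f] u by auto
  have dense: "\<exists>j. f (d j) < f v + e" if v: "v \<in> K" and e: "e > 0" for v e
  proof -
    obtain \<delta> where \<delta>: "\<delta> > 0" "\<forall>v'\<in>K. dist v' v < \<delta> \<longrightarrow> dist (f v') (f v) < e"
      using f v e unfolding continuous_on_iff by blast
    obtain j where "dist (d j) v < \<delta>"
      using d(2) v \<delta>(1) closure_approachable[of v "range d"] by auto
    then have "dist (f (d j)) (f v) < e"
      using \<delta>(2) d(1) by auto
    then show ?thesis
      by (intro exI[of _ j]) (simp add: dist_real_def)
  qed
  obtain j where "f (d j) < f b + inverse (Suc k)"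
    using dense[OF b(1), of "inverse (Suc k)"] by auto
  then have "\<exists>j. \<forall>l. f (d j) \<le> f (d l) + inverse (Suc k)"
    using b(2) d(1) by (intro exI[of _ j] allI) (smt (verit) range_subsetD)
  then have *: "\<forall>l. f (approx_argmin d f k) \<le> f (d l) + inverse (Suc k)"
    unfolding approx_argmin_def by (rule LeastI_ex)
  show ?thesis
  proof (rule field_le_epsilon)
    fix e :: real assume "e > 0"
    then obtain l where "f (d l) < f u + e"
      using dense[OF u] by blast
    then show "f (approx_argmin d f k) \<le> f u + inverse (Suc k) + e"
      using *[rule_format, of l] by simp
  qed
qed

lemma approx_argmin_mem: "range d \<subseteq> K \<Longrightarrow> approx_argmin d f k \<in> K"
  unfolding approx_argmin_def by auto

lemma lim_approx_argmin:
  fixes K :: "(real^'m) set"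
  assumes f: "continuous_on K f" and K: "compact K"
    and d: "range d \<subseteq> K" "K \<subseteq> closure (range d)"
    and C: "Cauchy (approx_argmin d f)"
  shows "lim (approx_argmin d f) \<in> K" "u \<in> K \<Longrightarrow> f (lim (approx_argmin d f)) \<le> f u"
proof -
  have lim: "approx_argmin d f \<longlonglongrightarrow> lim (approx_argmin d f)"
    using C Cauchy_convergent convergent_LIMSEQ_iff by blast
  show mem: "lim (approx_argmin d f) \<in> K"
    by (rule closed_sequentially[OF compact_imp_closed[OF K] _ lim])
      (rule approx_argmin_mem[OF d(1)])
  assume u: "u \<in> K"
  have "(\<lambda>k. f (approx_argmin d f k)) \<longlonglongrightarrow> f (lim (approx_argmin d f))"
    using continuous_on_tendsto_compose[OF f lim mem] approx_argmin_mem[OF d(1)] by simp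
  moreover have "(\<lambda>k. f u + inverse (real (Suc k))) \<longlonglongrightarrow> f u + 0"
    by (intro tendsto_intros LIMSEQ_inverse_real_of_nat)
  ultimately show "f (lim (approx_argmin d f)) \<le> f u"
    using approx_argmin_le[OF f K d u] by (intro tendsto_le[OF sequentially_bot]) auto
qed

lemma times_differentiable_on_imp_continuous_on:
  assumes "times_differentiable_on (Suc k) f U" "W \<subseteq> U"
  shows "continuous_on W f"
proof (rule continuous_at_imp_continuous_on, rule ballI)
  fix u assume "u \<in> W"
  then show "isCont f u"
    using assms has_derivative_continuous by (force simp: times_differentiable_on.simps)
qed

text \<open>Strong convexity acts twice: at midpoints it forces approximate minimisers together, and
  at the centre it weighs against the gradient, which is too small to let the minimiser reach the
  sphere.\<close>

lemma argmin_found_if_strongly_convex: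
  assumes U: "open U" "cball a r \<subseteq> U" and f: "times_differentiable_on 2 f U"
    and d: "range d \<subseteq> cball a r" "cball a r \<subseteq> closure (range d)"
    and c: "c > 0" "\<And>u v. u \<in> cball a r \<Longrightarrow>
      c * (norm v)\<^sup>2 \<le> (\<Sum>i\<in>UNIV. \<Sum>j\<in>UNIV. v $ i * v $ j * partial i (partial j f) u)"
    and grad: "norm (\<chi> i. partial i f a) < c * r / 2"
  shows "argmin_found d a r f"
proof -
  let ?K = "cball a r"
  let ?g = "\<lambda>u. \<chi> i. partial i f u"
  have cont: "continuous_on ?K f"
    using f U times_differentiable_on_imp_continuous_on unfolding numeral_2_eq_2 by blast
  have lower: "f q \<ge> f p + ?g p \<bullet> (q - p) + c / 2 * (norm (q - p))\<^sup>2" if "p \<in> ?K" "q \<in> ?K" for p q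
  proof (rule strong_convexity_lower_bound[OF U(1) _ f])
    have "closed_segment p q \<subseteq> ?K"
      using that closed_segment_subset convex_cball by blast
    then show "closed_segment p q \<subseteq> U" "\<And>u v. u \<in> closed_segment p q \<Longrightarrow>
      c * (norm v)\<^sup>2 \<le> (\<Sum>i\<in>UNIV. \<Sum>j\<in>UNIV. v $ i * v $ j * partial i (partial j f) u)"
      using U(2) c(2) by blast+
  qed
  define y where "y = approx_argmin d f"
  have yK: "y k \<in> ?K" for k
    unfolding y_def by (rule approx_argmin_mem[OF d(1)])
  have y_le: "f (y k) \<le> f u + inverse (Suc k)" if "u \<in> ?K" for u k
    unfolding y_def by (rule approx_argmin_le[OF cont compact_cball d that])
  \<comment> \<open>Add the lower bounds from the midpoint towards \<open>y k\<close> and towards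
    \<open>y l\<close>: the gradient terms cancel, and the two quadratic terms give twice
    \<open>c / 2\<close> times a quarter of the squared distance.\<close>
  have dist: "c / 4 * (norm (y k - y l))\<^sup>2 \<le> inverse (Suc k) + inverse (Suc l)" for k l
  proof -
    define m where "m = midpoint (y k) (y l)"
    have m: "m \<in> ?K"
      unfolding m_def using yK midpoint_in_closed_segment closed_segment_subset convex_cball by blast
    have km: "y k - m = (1/2) *\<^sub>R (y k - y l)" and lm: "y l - m = - ((1/2) *\<^sub>R (y k - y l))"
      unfolding m_def midpoint_def by (simp_all add: vec_eq_iff field_simps)
    have "f (y k) \<ge> f m + ?g m \<bullet> ((1/2) *\<^sub>R (y k - y l)) + c / 2 * (norm ((1/2) *\<^sub>R (y k - y l)))\<^sup>2"
      using lower[OF m yK, of k] unfolding km .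
    moreover have "f (y l) \<ge> f m + ?g m \<bullet> (- ((1/2) *\<^sub>R (y k - y l))) + c / 2 * (norm ((1/2) *\<^sub>R (y k - y l)))\<^sup>2"
      using lower[OF m yK, of l] unfolding lm norm_minus_cancel .
    moreover have "f (y k) \<le> f m + inverse (Suc k)" "f (y l) \<le> f m + inverse (Suc l)"
      using y_le m by blast+
    moreover have "(norm ((1/2) *\<^sub>R (y k - y l)))\<^sup>2 = (norm (y k - y l))\<^sup>2 / 4"
      by (simp add: power_divide)
    ultimately show ?thesis
      by (simp only: inner_minus_right)
  qed
  have "Cauchy y"
  proof (rule metric_CauchyI)
    fix e :: real assume e: "e > 0"
    \<comment> \<open>Two reciprocals, each below \<open>c * e\<^sup>2 / 8\<close>, stay below
      \<open>c / 4 * e\<^sup>2\<close>.\<close>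
    obtain N where N: "inverse (real (Suc N)) < c * e\<^sup>2 / 8"
      using reals_Archimedean[of "c * e\<^sup>2 / 8"] c(1) e by auto
    show "\<exists>N. \<forall>k\<ge>N. \<forall>l\<ge>N. dist (y k) (y l) < e"
    proof (intro exI[of _ N] allI impI)
      fix k l assume kl: "k \<ge> N" "l \<ge> N"
      have "inverse (real (Suc k)) \<le> inverse (real (Suc N))" "inverse (real (Suc l)) \<le> inverse (real (Suc N))"
        using kl by (auto intro!: le_imp_inverse_le)
      then have "c / 4 * (norm (y k - y l))\<^sup>2 < c / 4 * e\<^sup>2"
        using dist[of k l] N by linarith
      then have "(norm (y k - y l))\<^sup>2 < e\<^sup>2"
        using c(1) by simp
      then show "dist (y k) (y l) < e"
        using e by (simp add: dist_norm power2_less_imp_less)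
    qed
  qed
  then have C: "Cauchy (approx_argmin d f)"
    unfolding y_def .
  define u where "u = lim (approx_argmin d f)"
  have r: "r > 0"
    using grad c(1) le_less_trans[OF norm_ge_zero grad] by (simp add: zero_less_mult_iff)
  have a: "a \<in> ?K" using r by simp
  have u: "u \<in> ?K" "f u \<le> f a"
    unfolding u_def using lim_approx_argmin[OF cont compact_cball d C] a by auto
  \<comment> \<open>As \<open>f u \<le> f a\<close>, the quadratic gain from \<open>a\<close> to
    \<open>u\<close> is paid for by the gradient at \<open>a\<close>; dividing by
    \<open>norm (u - a)\<close> bounds the distance by less than \<open>r\<close>.\<close>
  have "\<bar>?g a \<bullet> (u - a)\<bar> \<le> norm (?g a) * norm (u - a)"
    by (rule Cauchy_Schwarz_ineq2)
  then have "c / 2 * (norm (u - a))\<^sup>2 \<le> norm (?g a) * norm (u - a)"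
    using lower[OF a u(1)] u(2) by linarith
  then have "norm (u - a) \<noteq> 0 \<Longrightarrow> c / 2 * norm (u - a) \<le> norm (?g a)"
    by (simp add: power2_eq_square)
  then have "norm (u - a) \<noteq> 0 \<Longrightarrow> c * norm (u - a) < c * r"
    using grad by linarith
  then have "norm (u - a) < r"
    using r c(1) by (cases "norm (u - a) = 0") auto
  then show ?thesis
    unfolding argmin_found_def u_def[symmetric] using C by (simp add: dist_norm norm_minus_commute)
qed

section \<open>Martingale differences with bounded second moments\<close>

lemma (in prob_space) orthogonal_sum_second_moment:
  fixes X :: "nat \<Rightarrow> 'a \<Rightarrow> real"
  assumes meas[measurable]: "\<And>t. t \<in> I \<Longrightarrow> X t \<in> borel_measurable M"
    and sq: "\<And>t. t \<in> I \<Longrightarrow> integrable M (\<lambda>w. (X t w)\<^sup>2)"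
    and bnd: "\<And>t. t \<in> I \<Longrightarrow> expectation (\<lambda>w. (X t w)\<^sup>2) \<le> C"
    and orth: "\<And>s t. s \<in> I \<Longrightarrow> t \<in> I \<Longrightarrow> s < t \<Longrightarrow> expectation (\<lambda>w. X s w * X t w) = 0"
    and I: "finite I"
  shows "integrable M (\<lambda>w. (\<Sum>t\<in>I. X t w)\<^sup>2)"
    and "expectation (\<lambda>w. (\<Sum>t\<in>I. X t w)\<^sup>2) \<le> C * card I"
proof -
  have int: "integrable M (\<lambda>w. X s w * X t w)" if "s \<in> I" "t \<in> I" for s t
  proof (rule Bochner_Integration.integrable_bound[OF Bochner_Integration.integrable_add[OF sq[OF that(1)] sq[OF that(2)]]])
    have "\<bar>a * b\<bar> \<le> a\<^sup>2 + b\<^sup>2" for a b :: real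
      using sum_squares_bound[of "\<bar>a\<bar>" "\<bar>b\<bar>"] abs_ge_zero[of "a * b"]
      unfolding abs_mult power2_abs mult.assoc by linarith
    then show "AE w in M. norm (X s w * X t w) \<le> norm ((X s w)\<^sup>2 + (X t w)\<^sup>2)"
      by (auto simp: abs_of_nonneg)
  qed (use that in measurable)
  have expand: "(\<Sum>t\<in>I. X t w)\<^sup>2 = (\<Sum>s\<in>I. \<Sum>t\<in>I. X s w * X t w)" for w
    by (simp add: power2_eq_square sum_product)
  show "integrable M (\<lambda>w. (\<Sum>t\<in>I. X t w)\<^sup>2)"
    unfolding expand by (intro Bochner_Integration.integrable_sum int)
  have orth': "expectation (\<lambda>w. X s w * X t w) = (if s = t then expectation (\<lambda>w. (X s w)\<^sup>2) else 0)"
    if "s \<in> I" "t \<in> I" for s t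
    using orth[OF that] orth[OF that(2,1)] that
    by (cases s t rule: linorder_cases) (auto simp: power2_eq_square mult.commute)
  have "expectation (\<lambda>w. (\<Sum>t\<in>I. X t w)\<^sup>2) = (\<Sum>s\<in>I. \<Sum>t\<in>I. expectation (\<lambda>w. X s w * X t w))"
    unfolding expand using int
    by (subst Bochner_Integration.integral_sum) (auto intro!: sum.cong Bochner_Integration.integral_sum)
  also have "\<dots> = (\<Sum>s\<in>I. expectation (\<lambda>w. (X s w)\<^sup>2))"
    using I by (intro sum.cong refl) (simp add: orth')
  also have "\<dots> \<le> (\<Sum>s\<in>I. C)"
    by (intro sum_mono bnd)
  finally show "expectation (\<lambda>w. (\<Sum>t\<in>I. X t w)\<^sup>2) \<le> C * card I"
    by (simp add: mult.commute)
qed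

text \<open>Exchanging sum and integral, the random series has finite expectation. It therefore
  converges almost surely, and its terms tend to 0.\<close>

lemma AE_tendsto_0_if_summable_expectation:
  fixes T :: "nat \<Rightarrow> 'a \<Rightarrow> real"
  assumes T: "\<And>k. integrable M (T k)" "\<And>k w. T k w \<ge> 0"
    and bnd: "\<And>k. integral\<^sup>L M (T k) \<le> b k" and b: "summable b"
  shows "AE w in M. (\<lambda>k. T k w) \<longlonglongrightarrow> 0"
proof -
  have "(\<integral>\<^sup>+ w. (\<Sum>k. ennreal (T k w)) \<partial>M) = (\<Sum>k. \<integral>\<^sup>+ w. ennreal (T k w) \<partial>M)"
    using T(1) by (intro nn_integral_suminf) (auto intro: borel_measurable_integrable)
  also have "\<dots> = (\<Sum>k. ennreal (integral\<^sup>L M (T k)))"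
    using T by (simp add: nn_integral_eq_integral)
  also have "\<dots> \<le> (\<Sum>k. ennreal (b k))"
    by (intro suminf_le ennreal_leI bnd) auto
  also have "\<dots> < \<infinity>"
  proof -
    have "b k \<ge> 0" for k
      using bnd[of k] T(2) by (meson Bochner_Integration.integral_nonneg order_trans)
    then show ?thesis
      using b by (subst suminf_ennreal2) auto
  qed
  finally have "AE w in M. (\<Sum>k. ennreal (T k w)) \<noteq> \<infinity>"
    using T(1) by (intro nn_integral_noteq_infinite) auto
  then show ?thesis
  proof eventually_elim
    case (elim w)
    then have "summable (\<lambda>k. T k w)"
      using T(2) by (intro summable_suminf_not_top) auto
    then show ?case
      by (rule summable_LIMSEQ_zero)
  qed
qed

text \<open>
  The partial sums are controlled at the squares \<open>k\<^sup>2\<close>, and inside a block \<open>[k\<^sup>2, (k + 1)\<^sup>2)\<close> by the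
  sum of all the squared increments; a block is short enough for this to replace a maximal inequality.
\<close>

lemma (in prob_space) orthogonal_sequence_AE_tendsto_0:
  fixes X :: "nat \<Rightarrow> 'a \<Rightarrow> real"
  assumes meas: "\<And>t. t \<ge> 1 \<Longrightarrow> X t \<in> borel_measurable M"
    and sq: "\<And>t. t \<ge> 1 \<Longrightarrow> integrable M (\<lambda>w. (X t w)\<^sup>2)"
    and bnd: "\<And>t. t \<ge> 1 \<Longrightarrow> expectation (\<lambda>w. (X t w)\<^sup>2) \<le> C"
    and orth: "\<And>s t. 1 \<le> s \<Longrightarrow> s < t \<Longrightarrow> expectation (\<lambda>w. X s w * X t w) = 0"
  shows "AE w in M. (\<lambda>n. real n powr (- 7 / 8) * (\<Sum>t=1..n. X t w)) \<longlonglongrightarrow> 0"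
proof -
  have C: "C \<ge> 0"
    using bnd[of 1] by (meson Bochner_Integration.integral_nonneg order_refl order_trans zero_le_power2)
  define B where "B k w = (\<Sum>t\<in>{1..k\<^sup>2}. X t w)\<^sup>2 +
    (\<Sum>n\<in>{k\<^sup>2..<(k + 1)\<^sup>2}. (\<Sum>t\<in>{k\<^sup>2<..n}. X t w)\<^sup>2)" for k :: nat and w
  \<comment> \<open>For \<open>n \<ge> k\<^sup>2\<close> the square of
    \<open>real n powr (- 7 / 8)\<close> is at most \<open>real k powr (- 7 / 2)\<close>. Against an
    expectation of order \<open>k\<^sup>2\<close> this leaves the summable power -3/2.\<close>
  define T where "T k w = real k powr (- 7 / 2) * B k w" for k w
  have moment: "integrable M (\<lambda>w. (\<Sum>t\<in>I. X t w)\<^sup>2)"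
    "expectation (\<lambda>w. (\<Sum>t\<in>I. X t w)\<^sup>2) \<le> C * card I" if "finite I" "I \<subseteq> {1..}" for I
    using that by (auto intro!: orthogonal_sum_second_moment meas sq bnd orth)
  have int_B: "integrable M (B k)" for k
    unfolding B_def by (intro Bochner_Integration.integrable_add Bochner_Integration.integrable_sum moment) auto
  \<comment> \<open>The constant is 7 = 1 + 4 + 2: \<open>k\<^sup>2\<close> from the first square
    and \<open>4 * k\<^sup>2 + 2 * k\<close> from the block, with
    \<open>k \<le> k\<^sup>2\<close>.\<close>
  have exp_B: "expectation (B k) \<le> 7 * C * (real k)\<^sup>2" for k
  proof -
    have "expectation (B k) = expectation (\<lambda>w. (\<Sum>t\<in>{1..k\<^sup>2}. X t w)\<^sup>2) +
      (\<Sum>n\<in>{k\<^sup>2..<(k + 1)\<^sup>2}. expectation (\<lambda>w. (\<Sum>t\<in>{k\<^sup>2<..n}. X t w)\<^sup>2))"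
    proof -
      have "integrable M (\<lambda>w. (\<Sum>t\<in>{1..k\<^sup>2}. X t w)\<^sup>2)"
        "integrable M (\<lambda>w. (\<Sum>t\<in>{k\<^sup>2<..n}. X t w)\<^sup>2)" for n
        by (auto intro!: moment)
      then show ?thesis
        unfolding B_def by simp
    qed
    \<comment> \<open>A block has \<open>2 * k + 1\<close> indices, and each of its inner sums has
      at most \<open>2 * k\<close> terms.\<close>
    also have "\<dots> \<le> C * (real k)\<^sup>2 + (\<Sum>n\<in>{k\<^sup>2..<(k + 1)\<^sup>2}. C * (2 * real k))"
    proof (intro add_mono sum_mono)
      show "expectation (\<lambda>w. (\<Sum>t\<in>{1..k\<^sup>2}. X t w)\<^sup>2) \<le> C * (real k)\<^sup>2"
        using moment(2)[of "{1..k\<^sup>2}"] by auto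
      fix n assume n: "n \<in> {k\<^sup>2..<(k + 1)\<^sup>2}"
      have "n - k\<^sup>2 \<le> 2 * k"
        using n by (auto simp: power2_eq_square)
      then have "real (n - k\<^sup>2) \<le> 2 * real k"
        by linarith
      then have "C * real (n - k\<^sup>2) \<le> C * (2 * real k)"
        using C by (rule mult_left_mono)
      then show "expectation (\<lambda>w. (\<Sum>t\<in>{k\<^sup>2<..n}. X t w)\<^sup>2) \<le> C * (2 * real k)"
        using moment(2)[of "{k\<^sup>2<..n}"] by (auto simp: subset_eq)
    qed
    also have "\<dots> = C * ((real k)\<^sup>2 + (2 * real k + 1) * (2 * real k))"
      by (simp add: power2_eq_square algebra_simps)
    also have "\<dots> \<le> C * (7 * (real k)\<^sup>2)"
    proof -
      have "real k \<le> (real k)\<^sup>2"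
        by (cases k) (auto simp: power2_eq_square)
      then show ?thesis
        by (intro mult_left_mono C) (simp add: power2_eq_square algebra_simps)
    qed
    finally show ?thesis by simp
  qed
  have "AE w in M. (\<lambda>k. T k w) \<longlonglongrightarrow> 0"
  proof (rule AE_tendsto_0_if_summable_expectation)
    show "integrable M (T k)" for k
      unfolding T_def using int_B by simp
    show "T k w \<ge> 0" for k w
      unfolding T_def B_def by (auto intro!: mult_nonneg_nonneg sum_nonneg add_nonneg_nonneg)
    show "expectation (T k) \<le> 7 * C * real k powr (- 3 / 2)" for k
    proof -
      have "expectation (T k) = real k powr (- 7 / 2) * expectation (B k)"
        unfolding T_def by simp
      also have "\<dots> \<le> real k powr (- 7 / 2) * (7 * C * (real k)\<^sup>2)"
        by (intro mult_left_mono exp_B) auto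
      also have "\<dots> = 7 * C * (real k powr (- 7 / 2) * real k powr 2)"
        by (cases "k = 0") auto
      also have "\<dots> = 7 * C * real k powr (- 3 / 2)"
        unfolding powr_add[symmetric] by simp
      finally show ?thesis .
    qed
    show "summable (\<lambda>k. 7 * C * real k powr (- 3 / 2))"
      by (intro summable_mult) (simp add: summable_real_powr_iff)
  qed
  then show ?thesis
  proof eventually_elim
    case (elim w)
    have sqrt_top: "filterlim floor_sqrt at_top sequentially"
      unfolding filterlim_at_top eventually_sequentially le_floor_sqrt_iff by blast
    have "(\<lambda>n. 2 * T (floor_sqrt n) w) \<longlonglongrightarrow> 2 * 0"
      by (intro tendsto_mult tendsto_const filterlim_compose[OF elim sqrt_top])
    then have lim: "(\<lambda>n. 2 * T (floor_sqrt n) w) \<longlonglongrightarrow> 0" by simp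
    have "\<bar>(real n powr (- 7 / 8) * (\<Sum>t=1..n. X t w))\<^sup>2\<bar> \<le> 2 * T (floor_sqrt n) w" if "n \<ge> 1" for n
    proof -
      define k where "k = floor_sqrt n"
      have k: "k \<ge> 1" "k\<^sup>2 \<le> n" "n < (k + 1)\<^sup>2"
        using that Suc_floor_sqrt_power2_gt[of n] unfolding k_def
        by (auto simp: Suc_le_eq)
      have split: "{1..n} = {1..k\<^sup>2} \<union> {k\<^sup>2<..n}"
        using k by auto
      have "(\<Sum>t=1..n. X t w) = (\<Sum>t\<in>{1..k\<^sup>2}. X t w) + (\<Sum>t\<in>{k\<^sup>2<..n}. X t w)"
        unfolding split by (rule sum.union_disjoint) auto
      then have "(\<Sum>t=1..n. X t w)\<^sup>2 = ((\<Sum>t\<in>{1..k\<^sup>2}. X t w) + (\<Sum>t\<in>{k\<^sup>2<..n}. X t w))\<^sup>2"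
        by (rule arg_cong)
      \<comment> \<open>The second square is one of the nonnegative terms collected in
        \<open>B k\<close>, because \<open>n\<close> lies in the block starting at
        \<open>k\<^sup>2\<close>.\<close>
      also have "\<dots> \<le> 2 * ((\<Sum>t\<in>{1..k\<^sup>2}. X t w)\<^sup>2 + (\<Sum>t\<in>{k\<^sup>2<..n}. X t w)\<^sup>2)"
        (is "(?a + ?b)\<^sup>2 \<le> _")
        using sum_squares_bound[of ?a ?b] by (simp add: power2_sum)
      also have "\<dots> \<le> 2 * B k w"
        unfolding B_def using k
        by (intro mult_left_mono add_left_mono member_le_sum[of n _ "\<lambda>n. (\<Sum>t\<in>{k\<^sup>2<..n}. X t w)\<^sup>2"]) auto
      finally have S: "(\<Sum>t=1..n. X t w)\<^sup>2 \<le> 2 * B k w" .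
      have "(real n powr (- 7 / 8))\<^sup>2 = real n powr (- 7 / 4)"
        unfolding power2_eq_square powr_add[symmetric] by simp
      also have "\<dots> \<le> real (k\<^sup>2) powr (- 7 / 4)"
        using k by (intro powr_mono2') (auto simp del: of_nat_power)
      also have "\<dots> = real k powr (- 7 / 2)"
      proof -
        have "real (k\<^sup>2) = real k powr 2"
          using k by simp
        then show ?thesis
          by (simp only: powr_powr) simp
      qed
      finally have "(real n powr (- 7 / 8))\<^sup>2 * (\<Sum>t=1..n. X t w)\<^sup>2 \<le> real k powr (- 7 / 2) * (2 * B k w)"
        using S by (intro mult_mono) auto
      then show ?thesis
        unfolding T_def k_def[symmetric] by (simp add: power_mult_distrib)
    qed
    then have "\<forall>\<^sub>F n in sequentially.
        norm ((real n powr (- 7 / 8) * (\<Sum>t=1..n. X t w))\<^sup>2) \<le> 2 * T (floor_sqrt n) w"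
      unfolding eventually_sequentially real_norm_def by blast
    from Lim_null_comparison[OF this lim]
    have "(\<lambda>n. (real n powr (- 7 / 8) * (\<Sum>t=1..n. X t w))\<^sup>2) \<longlonglongrightarrow> 0" .
    then show ?case
      by (simp add: tendsto_null_power)
  qed
qed

lemma (in sigma_finite_subalgebra) integral_mult_eq_0_if_cond_exp_0:
  assumes "Y \<in> borel_measurable F" "X \<in> borel_measurable M"
    and "integrable M (\<lambda>x. Y x * X x)" and "AE x in M. real_cond_exp M F X x = 0"
  shows "(\<integral>x. Y x * X x \<partial>M) = 0"
proof -
  have "(\<integral>x. Y x * X x \<partial>M) = (\<integral>x. Y x * real_cond_exp M F X x \<partial>M)"
    using assms by (intro real_cond_exp_intg(2)[symmetric])
  also have "\<dots> = 0"
    using assms(4) by (intro integral_eq_zero_AE) auto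
  finally show ?thesis .
qed

lemma (in finite_measure) integrable_if_square_integrable:
  fixes X :: "'a \<Rightarrow> real"
  assumes "X \<in> borel_measurable M" "integrable M (\<lambda>x. (X x)\<^sup>2)"
  shows "integrable M X"
proof (rule Bochner_Integration.integrable_bound)
  show "integrable M (\<lambda>x. 1 + (X x)\<^sup>2)"
    using assms by simp
  have "\<bar>a\<bar> \<le> 1 + a\<^sup>2" for a :: real
    using sum_squares_bound[of 1 "\<bar>a\<bar>"] abs_ge_zero[of a] by simp
  then show "AE x in M. norm (X x) \<le> norm (1 + (X x)\<^sup>2)"
    by (auto simp: abs_of_nonneg)
qed (use assms in auto)

lemma integrable_mult_if_square_integrable:
  fixes X Y :: "'a \<Rightarrow> real"
  assumes "X \<in> borel_measurable M" "integrable M (\<lambda>x. (X x)\<^sup>2)"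
    and "Y \<in> borel_measurable M" "integrable M (\<lambda>x. (Y x)\<^sup>2)"
  shows "integrable M (\<lambda>x. X x * Y x)"
proof (rule Bochner_Integration.integrable_bound)
  show "integrable M (\<lambda>x. (X x)\<^sup>2 + (Y x)\<^sup>2)"
    using assms by simp
  have "\<bar>a * b\<bar> \<le> a\<^sup>2 + b\<^sup>2" for a b :: real
    using sum_squares_bound[of "\<bar>a\<bar>" "\<bar>b\<bar>"] abs_ge_zero[of "a * b"] unfolding abs_mult power2_abs mult.assoc by linarith
  then show "AE x in M. norm (X x * Y x) \<le> norm ((X x)\<^sup>2 + (Y x)\<^sup>2)"
    by (auto simp: abs_of_nonneg)
qed (use assms in auto)

text \<open>For \<open>s < t\<close> the variable \<open>X s\<close> is measurable for
  \<open>F (t - 1)\<close> and comes out of the conditional expectation, so martingale differences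
  are orthogonal. Stating the moment bound as a nonnegative integral makes it include square
  integrability.\<close>

lemma (in prob_space) martingale_difference_AE_tendsto_0:
  fixes X :: "nat \<Rightarrow> 'a \<Rightarrow> real"
  assumes F: "\<And>t. subalgebra M (F t)" "\<And>s t. s \<le> t \<Longrightarrow> subalgebra (F t) (F s)"
    and meas: "\<And>t. t \<ge> 1 \<Longrightarrow> X t \<in> borel_measurable (F t)"
    and bnd: "\<And>t. t \<ge> 1 \<Longrightarrow> (\<integral>\<^sup>+ w. ennreal ((X t w)\<^sup>2) \<partial>M) \<le> ennreal C" and C: "C \<ge> 0"
    and md: "\<And>t. t \<ge> 1 \<Longrightarrow> AE w in M. real_cond_exp M (F (t - 1)) (X t) w = 0"
  shows "AE w in M. (\<lambda>n. real n powr (- 7 / 8) * (\<Sum>t=1..n. X t w)) \<longlonglongrightarrow> 0"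
proof (rule orthogonal_sequence_AE_tendsto_0)
  show XM: "X t \<in> borel_measurable M" if "t \<ge> 1" for t
    using measurable_from_subalg[OF F(1) meas[OF that]] .
  show sq: "integrable M (\<lambda>w. (X t w)\<^sup>2)" if "t \<ge> 1" for t
  proof (rule integrableI_bounded)
    show "(\<integral>\<^sup>+ w. ennreal (norm ((X t w)\<^sup>2)) \<partial>M) < \<infinity>"
      using bnd[OF that] by (simp add: le_less_trans)
  qed (use XM[OF that] in measurable)
  show "expectation (\<lambda>w. (X t w)\<^sup>2) \<le> C" if "t \<ge> 1" for t
    using bnd[OF that] sq[OF that] C by (simp add: nn_integral_eq_integral)
  show "expectation (\<lambda>w. X s w * X t w) = 0" if "1 \<le> s" "s < t" for s t
  proof -
    interpret G: finite_measure_subalgebra M "F (t - 1)"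
      by unfold_locales (rule F)
    show ?thesis
      using that by (intro G.integral_mult_eq_0_if_cond_exp_0 integrable_mult_if_square_integrable
          measurable_from_subalg[OF F(2) meas] XM sq md) auto
  qed
qed

section \<open>Conditional expectations by truncation\<close>

text \<open>Pulling out a known factor requires an integrable product. The indicator of
  \<open>\<bar>b x\<bar> \<le> k\<close> is a bounded known factor, and these sets exhaust the
  space.\<close>

lemma (in finite_measure_subalgebra) real_cond_exp_eq_0_local:
  fixes Y b :: "'a \<Rightarrow> real"
  assumes Y: "integrable M Y" and b: "b \<in> borel_measurable F"
    and loc: "\<And>k::nat. AE x in M. real_cond_exp M F (\<lambda>x. indicator {x \<in> space M. \<bar>b x\<bar> \<le> k} x * Y x) x = 0"
  shows "AE x in M. real_cond_exp M F Y x = 0"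
proof -
  have space: "space F = space M"
    using subalg unfolding subalgebra_def by simp
  define G where "G k = {x \<in> space M. \<bar>b x\<bar> \<le> real k}" for k :: nat
  have GF: "G k \<in> sets F" for k
    unfolding G_def space[symmetric] using b by measurable
  then have GM: "G k \<in> sets M" for k
    using subalg unfolding subalgebra_def by auto
  have "AE x in M. \<forall>k. x \<in> G k \<longrightarrow> real_cond_exp M F Y x = 0"
    unfolding AE_all_countable
  proof
    fix k
    have "AE x in M. real_cond_exp M F (\<lambda>x. indicator (G k) x * Y x) x = indicator (G k) x * real_cond_exp M F Y x"
      using GF GM Y integrable_mult_indicator[OF GM Y]
      by (intro real_cond_exp_mult) (auto intro: borel_measurable_integrable)
    with loc[of k, folded G_def] show "AE x in M. x \<in> G k \<longrightarrow> real_cond_exp M F Y x = 0"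
      by eventually_elim (auto simp: indicator_def)
  qed
  with AE_space show ?thesis
  proof eventually_elim
    case (elim x)
    obtain k :: nat where "\<bar>b x\<bar> \<le> k"
      using real_arch_simple by blast
    then show ?case
      using elim unfolding G_def by blast
  qed
qed

text \<open>Needed for (b), which gives integrability of the centred variable but not of
  \<open>f\<close>. Where the conditional expectation is bounded, \<open>f\<close> is the sum of two
  integrable terms and linearity applies.\<close>

lemma (in finite_measure_subalgebra) real_cond_exp_diff_self:
  assumes f[measurable]: "f \<in> borel_measurable M"
    and D: "integrable M (\<lambda>x. f x - real_cond_exp M F f x)"
  shows "AE x in M. real_cond_exp M F (\<lambda>x. f x - real_cond_exp M F f x) x = 0"
proof (rule real_cond_exp_eq_0_local[OF D borel_measurable_cond_exp])
  fix k :: nat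
  let ?g = "real_cond_exp M F f"
  define G where "G = {x \<in> space M. \<bar>?g x\<bar> \<le> real k}"
  have space: "space F = space M"
    using subalg unfolding subalgebra_def by simp
  have GF[measurable]: "G \<in> sets F"
    unfolding G_def space[symmetric] by measurable
  then have GM[measurable]: "G \<in> sets M"
    using subalg unfolding subalgebra_def by auto
  have ig: "integrable M (\<lambda>x. indicator G x * ?g x)"
    by (rule integrable_const_bound[of _ "real k"])
      (auto simp: G_def indicator_def intro!: AE_I2)
  have "integrable M (\<lambda>x. indicator G x * (f x - ?g x) + indicator G x * ?g x)"
    using integrable_mult_indicator[OF GM D] ig by (intro Bochner_Integration.integrable_add) auto
  then have iF: "integrable M (\<lambda>x. indicator G x * f x)"
    by (simp add: algebra_simps)
  have "AE x in M. real_cond_exp M F (\<lambda>x. indicator G x * f x - indicator G x * ?g x) x =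
      real_cond_exp M F (\<lambda>x. indicator G x * f x) x - real_cond_exp M F (\<lambda>x. indicator G x * ?g x) x"
    using iF ig by (rule real_cond_exp_diff)
  moreover have "AE x in M. real_cond_exp M F (\<lambda>x. indicator G x * f x) x = indicator G x * ?g x"
    using iF by (intro real_cond_exp_mult) auto
  moreover have "AE x in M. real_cond_exp M F (\<lambda>x. indicator G x * ?g x) x = indicator G x * ?g x"
    using ig by (intro real_cond_exp_F_meas) auto
  ultimately show "AE x in M. real_cond_exp M F
      (\<lambda>x. indicator {x \<in> space M. \<bar>?g x\<bar> \<le> real k} x * (f x - ?g x)) x = 0"
    unfolding G_def[symmetric] right_diff_distrib by eventually_elim simp
qed

text \<open>The sum \<open>Y\<close> is integrable while the separate products
  \<open>b i * Z i\<close> may not be. They become integrable where the sum of all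
  \<open>\<bar>b i x\<bar>\<close> is bounded.\<close>

lemma (in finite_measure_subalgebra) real_cond_exp_linear_combination_0:
  fixes b Z :: "'i \<Rightarrow> 'a \<Rightarrow> real"
  assumes Y: "integrable M Y" and eq: "AE x in M. Y x = (\<Sum>i\<in>I. b i x * Z i x)"
    and I: "finite I"
    and b[measurable]: "\<And>i. i \<in> I \<Longrightarrow> b i \<in> borel_measurable F"
    and Z: "\<And>i. i \<in> I \<Longrightarrow> integrable M (Z i)"
      "\<And>i. i \<in> I \<Longrightarrow> AE x in M. real_cond_exp M F (Z i) x = 0"
  shows "AE x in M. real_cond_exp M F Y x = 0"
proof (rule real_cond_exp_eq_0_local[OF Y, of "\<lambda>x. \<Sum>i\<in>I. \<bar>b i x\<bar>"])
  show bF: "(\<lambda>x. \<Sum>i\<in>I. \<bar>b i x\<bar>) \<in> borel_measurable F"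
    by measurable
  fix k :: nat
  define G where "G = {x \<in> space M. \<bar>\<Sum>i\<in>I. \<bar>b i x\<bar>\<bar> \<le> real k}"
  have space: "space F = space M"
    using subalg unfolding subalgebra_def by simp
  have GF[measurable]: "G \<in> sets F"
    unfolding G_def space[symmetric] using bF by measurable
  then have GM[measurable]: "G \<in> sets M"
    using subalg unfolding subalgebra_def by auto
  have cF[measurable]: "(\<lambda>x. indicator G x * b i x) \<in> borel_measurable F" if "i \<in> I" for i
    using b[OF that] by measurable
  have cM: "(\<lambda>x. indicator G x * b i x) \<in> borel_measurable M" if "i \<in> I" for i
    using measurable_from_subalg[OF subalg cF[OF that]] .
  have c_le: "\<bar>indicator G x * b i x\<bar> \<le> real k" if "i \<in> I" for i x
  proof (cases "x \<in> G")
    case True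
    have "\<bar>b i x\<bar> \<le> (\<Sum>i\<in>I. \<bar>b i x\<bar>)"
      using that I by (intro member_le_sum) auto
    then show ?thesis
      using True unfolding G_def by auto
  qed auto
  have int: "integrable M (\<lambda>x. indicator G x * b i x * Z i x)" if "i \<in> I" for i
  proof (rule Bochner_Integration.integrable_bound)
    show "integrable M (\<lambda>x. real k * Z i x)"
      using Z(1)[OF that] by simp
    show "AE x in M. norm (indicator G x * b i x * Z i x) \<le> norm (real k * Z i x)"
      using c_le[OF that] by (auto simp: abs_mult intro!: mult_right_mono)
    show "(\<lambda>x. indicator G x * b i x * Z i x) \<in> borel_measurable M"
      using cM[OF that] borel_measurable_integrable[OF Z(1)[OF that]] by (rule borel_measurable_times)
  qed
  have 1: "AE x in M. real_cond_exp M F (\<lambda>x. indicator G x * b i x * Z i x) x = 0" if "i \<in> I" for i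
    using real_cond_exp_mult[OF cF[OF that] borel_measurable_integrable[OF Z(1)[OF that]] int[OF that]] Z(2)[OF that]
    by eventually_elim simp
  have 2: "AE x in M. real_cond_exp M F (\<lambda>x. \<Sum>i\<in>I. indicator G x * b i x * Z i x) x =
      (\<Sum>i\<in>I. real_cond_exp M F (\<lambda>x. indicator G x * b i x * Z i x) x)"
  proof -
    \<comment> \<open>Extended by 0 outside \<open>I\<close>, because integrability is asked for at
      every index.\<close>
    let ?h = "\<lambda>i x. if i \<in> I then indicator G x * b i x * Z i x else 0"
    have "AE x in M. real_cond_exp M F (\<lambda>x. \<Sum>i\<in>I. ?h i x) x = (\<Sum>i\<in>I. real_cond_exp M F (?h i) x)"
    proof (rule real_cond_exp_sum)
      show "integrable M (?h i)" for i
        using int by (cases "i \<in> I") auto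
    qed
    then show ?thesis by simp
  qed
  have "AE x in M. \<forall>i\<in>I. real_cond_exp M F (\<lambda>x. indicator G x * b i x * Z i x) x = 0"
    using I 1 by (rule AE_finite_allI)
  with 2 have 3: "AE x in M. real_cond_exp M F (\<lambda>x. \<Sum>i\<in>I. indicator G x * b i x * Z i x) x = 0"
    by eventually_elim simp
  have "AE x in M. real_cond_exp M F (\<lambda>x. indicator G x * Y x) x =
      real_cond_exp M F (\<lambda>x. \<Sum>i\<in>I. indicator G x * b i x * Z i x) x"
  proof (rule real_cond_exp_cong)
    show "AE x in M. indicator G x * Y x = (\<Sum>i\<in>I. indicator G x * b i x * Z i x)"
      using eq by eventually_elim (simp add: sum_distrib_left mult.assoc)
    show "(\<lambda>x. \<Sum>i\<in>I. indicator G x * b i x * Z i x) \<in> borel_measurable M"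
      using int by (intro borel_measurable_sum) auto
  qed (use borel_measurable_integrable[OF Y] in measurable)
  with 3 show "AE x in M. real_cond_exp M F
      (\<lambda>x. indicator {x \<in> space M. \<bar>\<Sum>i\<in>I. \<bar>b i x\<bar>\<bar> \<le> real k} x * Y x) x = 0"
    unfolding G_def[symmetric] by eventually_elim simp
qed

section \<open>Measurable versions of derivatives\<close>

lemma measurable_completion_if_AE_eq:
  fixes f g :: "'a \<Rightarrow> real"
  assumes g: "g \<in> borel_measurable M" and eq: "AE x in M. f x = g x"
  shows "f \<in> borel_measurable (completion M)"
proof (rule measurableI)
  fix A :: "real set" assume A: "A \<in> sets borel"
  have "AE x in completion M. x \<in> g -` A \<inter> space M \<longleftrightarrow> x \<in> f -` A \<inter> space M"
    using AE_completion[OF eq] by eventually_elim auto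
  then have "f -` A \<inter> space M \<in> sets (completion M)"
    by (rule completion.in_sets_AE) (use measurable_sets[OF g A] in auto)
  then show "f -` A \<inter> space (completion M) \<in> sets (completion M)"
    by simp
qed auto

text \<open>The defining choice has an unsatisfiable predicate, hence one and the same value for all
  singular matrices. This keeps \<open>matrix_inv\<close> measurable across the singular
  set.\<close>

lemma matrix_inv_not_invertible:
  fixes A :: "real^'n^'n"
  shows "\<not> invertible A \<Longrightarrow> matrix_inv A = (SOME A'. False)"
  unfolding matrix_inv_def invertible_def by (rule arg_cong[where f = Eps]) blast

lemma borel_measurable_det:
  fixes A :: "'w \<Rightarrow> real^'n^'n"
  assumes [measurable]: "\<And>k l. (\<lambda>w. A w $ k $ l) \<in> borel_measurable G"
  shows "(\<lambda>w. det (A w)) \<in> borel_measurable G"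
  unfolding det_def by measurable

lemma borel_measurable_matrix_inv:
  fixes A :: "'w \<Rightarrow> real^'n^'n"
  assumes A: "\<And>k l. (\<lambda>w. A w $ k $ l) \<in> borel_measurable G"
  shows "(\<lambda>w. matrix_inv (A w) $ k $ l) \<in> borel_measurable G"
proof -
  note [measurable] = borel_measurable_det[of A, OF A]
  have "(\<lambda>w. if j = k then axis l 1 $ i else A w $ i $ j) \<in> borel_measurable G" for i j
    using A by (cases "j = k") auto
  then have [measurable]: "(\<lambda>w. det (\<chi> i j. if j = k then axis l 1 $ i else A w $ i $ j)) \<in> borel_measurable G"
    by (intro borel_measurable_det) simp
  have "(\<lambda>w. if det (A w) \<noteq> 0 then det (\<chi> i j. if j = k then axis l 1 $ i else A w $ i $ j) / det (A w)
      else (SOME A'. False) $ k $ l) \<in> borel_measurable G"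
    by measurable
  also have "(\<lambda>w. if det (A w) \<noteq> 0 then det (\<chi> i j. if j = k then axis l 1 $ i else A w $ i $ j) / det (A w)
      else (SOME A'. False) $ k $ l) = (\<lambda>w. matrix_inv (A w) $ k $ l)"
  proof (rule ext)
    fix w
    show "(if det (A w) \<noteq> 0 then det (\<chi> i j. if j = k then axis l 1 $ i else A w $ i $ j) / det (A w)
      else (SOME A'. False) $ k $ l) = matrix_inv (A w) $ k $ l"
      using matrix_inv_cramer[of "A w" k l] matrix_inv_not_invertible[of "A w"]
      by (cases "det (A w) = 0") (simp_all only: invertible_det_nz if_True if_False simp_thms)
  qed
  finally show ?thesis .
qed

lemma partial_eq_lim:
  fixes f :: "real^'m \<Rightarrow> real"
  assumes "(f has_derivative (\<lambda>v. F \<bullet> v)) (at u)" "\<eta> > 0"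
  shows "lim (\<lambda>n. (f (u + (\<eta> / real (n + 2)) *\<^sub>R axis i 1) - f u) / (\<eta> / real (n + 2))) = partial i f u"
proof -
  have "((\<lambda>h. (f (u + h *\<^sub>R axis i 1) - f u) / h) \<longlongrightarrow> F $ i) (at 0)"
    using has_real_derivative_along_axis[OF assms(1), of i] by (simp add: DERIV_def)
  moreover have "filterlim (\<lambda>n. \<eta> / real (n + 2)) (at 0) sequentially"
    using assms(2) by (intro filterlim_atI) (real_asymp | simp)+
  ultimately have "(\<lambda>n. (f (u + (\<eta> / real (n + 2)) *\<^sub>R axis i 1) - f u) / (\<eta> / real (n + 2))) \<longlonglongrightarrow> F $ i"
    by (rule filterlim_compose)
  then show ?thesis
    unfolding partial_eqI[OF assms(1)] by (rule limI)
qed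

text \<open>A limit of difference quotients along one fixed sequence of steps is measurable on the
  whole space, also on the paths where \<open>f\<close> is not differentiable and
  \<open>partial\<close> is uncontrolled.\<close>

lemma partial_measurable_version:
  fixes f :: "real^'m \<Rightarrow> 'w \<Rightarrow> real"
  assumes U: "open U" "u \<in> U" and f: "\<And>v. v \<in> U \<Longrightarrow> f v \<in> borel_measurable G"
  obtains g where "g \<in> borel_measurable G"
    "\<And>w. times_differentiable_on (Suc 0) (\<lambda>v. f v w) U \<Longrightarrow> g w = partial i (\<lambda>v. f v w) u"
proof -
  obtain \<eta> where \<eta>: "\<eta> > 0" "ball u \<eta> \<subseteq> U"
    using U openE by blast
  \<comment> \<open>The offset 2 keeps even the first step strictly inside the ball of radius
    \<open>\<eta>\<close>.\<close>
  define g where "g w = lim (\<lambda>n. (f (u + (\<eta> / real (n + 2)) *\<^sub>R axis i 1) w - f u w) / (\<eta> / real (n + 2)))"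
    for w
  have "u + (\<eta> / real (n + 2)) *\<^sub>R axis i 1 \<in> ball u \<eta>" for n
    using \<eta>(1) by (simp add: dist_norm field_simps add_pos_nonneg)
  then have mem: "u + (\<eta> / real (n + 2)) *\<^sub>R axis i 1 \<in> U" for n
    using \<eta>(2) by blast
  have "(\<lambda>w. (f (u + (\<eta> / real (n + 2)) *\<^sub>R axis i 1) w - f u w) / (\<eta> / real (n + 2)))
      \<in> borel_measurable G" for n
    by (intro borel_measurable_divide borel_measurable_diff borel_measurable_const f mem U)
  then have "g \<in> borel_measurable G"
    unfolding g_def[abs_def] by (rule borel_measurable_lim_metric)
  moreover have "g w = partial i (\<lambda>v. f v w) u"
    if w: "times_differentiable_on (Suc 0) (\<lambda>v. f v w) U" for w
    unfolding g_def by (rule partial_eq_lim[OF times_differentiable_on_partial(2)[OF U(1) w U(2)] \<eta>(1)])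
  ultimately show thesis
    by (rule that)
qed

text \<open>The construction is iterated on a whole family of versions. On a smooth path they agree
  with the first derivative throughout the open set \<open>U\<close>, so differentiating them at
  \<open>u\<close> gives the true second derivative.\<close>

lemma second_partial_measurable_version:
  fixes f :: "real^'m \<Rightarrow> 'w \<Rightarrow> real"
  assumes U: "open U" "u \<in> U" and f: "\<And>v. v \<in> U \<Longrightarrow> f v \<in> borel_measurable G"
  obtains g where "g \<in> borel_measurable G"
    "\<And>w. times_differentiable_on 2 (\<lambda>v. f v w) U \<Longrightarrow> g w = partial i (partial j (\<lambda>v. f v w)) u"
proof -
  have "\<exists>g. g \<in> borel_measurable G \<and>
      (\<forall>w. times_differentiable_on (Suc 0) (\<lambda>v. f v w) U \<longrightarrow> g w = partial j (\<lambda>v. f v w) v)"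
    if v: "v \<in> U" for v
  proof -
    obtain g where "g \<in> borel_measurable G"
      "\<And>w. times_differentiable_on (Suc 0) (\<lambda>v. f v w) U \<Longrightarrow> g w = partial j (\<lambda>v. f v w) v"
      using partial_measurable_version[where f = f, OF U(1) v f] by blast
    then show ?thesis by blast
  qed
  then obtain p where p: "\<And>v. v \<in> U \<Longrightarrow> p v \<in> borel_measurable G"
    "\<And>v w. v \<in> U \<Longrightarrow> times_differentiable_on (Suc 0) (\<lambda>v. f v w) U \<Longrightarrow> p v w = partial j (\<lambda>v. f v w) v"
    by metis
  obtain g where g: "g \<in> borel_measurable G"
    "\<And>w. times_differentiable_on (Suc 0) (\<lambda>v. p v w) U \<Longrightarrow> g w = partial i (\<lambda>v. p v w) u"
    using partial_measurable_version[where f = p, OF U p(1)] by blast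
  show ?thesis
  proof
    fix w assume w: "times_differentiable_on 2 (\<lambda>v. f v w) U"
    then have w1: "times_differentiable_on (Suc 0) (\<lambda>v. f v w) U"
      unfolding numeral_2_eq_2 by (rule times_differentiable_on_SucD)
    have "times_differentiable_on (Suc 0) (partial j (\<lambda>v. f v w)) U"
      using w unfolding numeral_2_eq_2 by (rule times_differentiable_on_partial(1)[OF U(1)])
    then have "times_differentiable_on (Suc 0) (\<lambda>v. p v w) U"
      by (rule times_differentiable_on_cong[OF U(1), rotated]) (simp add: p(2)[OF _ w1])
    then have "g w = partial i (\<lambda>v. p v w) u"
      by (rule g(2))
    also have "\<dots> = partial i (partial j (\<lambda>v. f v w)) u"
      by (rule partial_cong_open[OF U]) (rule p(2)[OF _ w1])
    finally show "g w = partial i (partial j (\<lambda>v. f v w)) u" .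
  qed (rule g(1))
qed

lemma partial_affine_sum:
  fixes f :: "'i \<Rightarrow> real^'m \<Rightarrow> real"
  assumes U: "open U" "u \<in> U" and f: "\<And>t. t \<in> T \<Longrightarrow> times_differentiable_on (Suc k) (f t) U"
  shows "partial i (\<lambda>v. c * (\<Sum>t\<in>T. f t v) + b) u = c * (\<Sum>t\<in>T. partial i (f t) u)"
proof -
  have "((\<lambda>v. c * (\<Sum>t\<in>T. f t v) + b) has_derivative
      (\<lambda>v. c * (\<Sum>t\<in>T. (\<chi> i. partial i (f t) u) \<bullet> v) + 0)) (at u)"
    using times_differentiable_on_partial(2)[OF U(1) f U(2)]
    by (intro has_derivative_add has_derivative_mult_right has_derivative_sum has_derivative_const)
  then have "((\<lambda>v. c * (\<Sum>t\<in>T. f t v) + b) has_derivative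
      (\<lambda>v. (c *\<^sub>R (\<Sum>t\<in>T. (\<chi> i. partial i (f t) u))) \<bullet> v)) (at u)"
    by (simp add: inner_sum_left)
  from partial_eqI[OF this] show ?thesis
    by simp
qed

lemma space_natural_sigma [simp]: "space (natural_sigma M x t) = space M"
  unfolding natural_sigma_def by (simp add: space_measure_of_conv)

lemma sets_natural_sigma:
  "sets (natural_sigma M x t) =
     sigma_sets (space M) {x s -` A \<inter> space M | s A. s \<in> {1..t} \<and> A \<in> sets borel}"
  unfolding natural_sigma_def by (rule sets_measure_of) auto

lemma subalgebra_natural_sigma_mono:
  "s \<le> t \<Longrightarrow> subalgebra (natural_sigma M x t) (natural_sigma M x s)"
  unfolding subalgebra_def sets_natural_sigma
  by (intro conjI sigma_sets_mono') (simp, fastforce)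

lemma subalgebra_natural_sigma:
  assumes "\<And>s. s \<ge> 1 \<Longrightarrow> x s \<in> borel_measurable M" "sets M \<subseteq> sets N" "space N = space M"
  shows "subalgebra N (natural_sigma M x t)"
proof -
  have "{x s -` A \<inter> space M | s A. s \<in> {1..t} \<and> A \<in> sets borel} \<subseteq> sets M"
    using assms(1) by (auto intro: measurable_sets)
  then have "sets (natural_sigma M x t) \<subseteq> sets M"
    unfolding sets_natural_sigma by (rule sets.sigma_sets_subset)
  then show ?thesis
    unfolding subalgebra_def using assms by auto
qed

lemma measurable_natural_sigma:
  "1 \<le> s \<Longrightarrow> s \<le> t \<Longrightarrow> x s \<in> borel_measurable (natural_sigma M x t)"
  by (rule measurableI) (auto simp: sets_natural_sigma intro!: sigma_sets.Basic)

lemma borel_measurable_component: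
  fixes f :: "'w \<Rightarrow> real^'n"
  assumes "f \<in> borel_measurable G"
  shows "(\<lambda>w. f w $ k) \<in> borel_measurable G"
  by (rule measurable_compose[OF assms borel_measurable_continuous_onI]) (intro continuous_intros)

section \<open>The quasi-likelihood\<close>

locale qml_model =
  fixes M :: "'w measure"
    and P :: "real^'m \<Rightarrow> 'w measure"
    and \<Theta> :: "(real^'m) set"
    and \<theta>0 :: "real^'m"
    and x :: "nat \<Rightarrow> 'w \<Rightarrow> real^'r"
    and \<mu> :: "nat \<Rightarrow> real^'m \<Rightarrow> 'w \<Rightarrow> real^'r"
    and S :: "nat \<Rightarrow> real^'m \<Rightarrow> 'w \<Rightarrow> real^'r^'r"
  assumes Theta: "open \<Theta>" "\<theta>0 \<in> \<Theta>"
    and prob: "prob_space (P \<theta>0)"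
    and sets_P: "sets (P \<theta>0) = sets M"
    and x_meas: "\<And>t. t \<ge> 1 \<Longrightarrow> x t \<in> borel_measurable M"
    and x_sq: "\<And>t. t \<ge> 1 \<Longrightarrow> integrable (P \<theta>0) (\<lambda>w. (norm (x t w))\<^sup>2)"
    and cond_mean: "is_cond_mean M P \<Theta> x \<mu>"
    and cond_cov: "is_cond_cov M P \<Theta> x \<mu> S"
    and inv: "\<And>t. t \<ge> 1 \<Longrightarrow> AE w in P \<theta>0. \<forall>\<theta>\<in>\<Theta>. invertible (S t \<theta> w)"
    and e_smooth: "\<And>t. t \<ge> 1 \<Longrightarrow> AE w in P \<theta>0.
          twice_continuously_differentiable_on (\<lambda>\<theta>. innovation x \<mu> t \<theta> w) \<Theta>"
    and S_smooth: "\<And>t. t \<ge> 1 \<Longrightarrow> AE w in P \<theta>0.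
          twice_continuously_differentiable_on (\<lambda>\<theta>. S t \<theta> w) \<Theta>"
begin

abbreviation "F \<equiv> natural_sigma M x"

abbreviation "e t k w \<equiv> innovation x \<mu> t \<theta>0 w $ k"

text \<open>Fixes a ball inside \<open>\<Theta>\<close>. Its connectedness, which
  \<open>\<Theta>\<close> may lack, settles the sign of the determinant of \<open>S\<close>.\<close>

definition "r0 = (SOME r. r > 0 \<and> ball \<theta>0 r \<subseteq> \<Theta>)"

abbreviation "U \<equiv> ball \<theta>0 r0"

lemma r0: "r0 > 0" "U \<subseteq> \<Theta>"
proof -
  have "\<exists>r. r > 0 \<and> ball \<theta>0 r \<subseteq> \<Theta>"
    using Theta openE by blast
  from someI_ex[OF this] show "r0 > 0" "U \<subseteq> \<Theta>"
    unfolding r0_def by auto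
qed

lemma \<theta>0_mem: "\<theta>0 \<in> U"
  using r0 by simp

section \<open>Filtration and measurability\<close>

lemma space_P: "space (P \<theta>0) = space M"
  using sets_P by (rule sets_eq_imp_space_eq)

lemma subalgebra_P: "subalgebra (P \<theta>0) (F t)"
  using x_meas by (rule subalgebra_natural_sigma) (simp_all add: sets_P space_P)

lemma subalgebra_completion: "subalgebra (completion (P \<theta>0)) (F t)"
  using subalgebra_P unfolding subalgebra_def by auto

lemma subalgebra_M: "subalgebra M (F t)"
  using x_meas by (rule subalgebra_natural_sigma) simp_all

lemma finite_measure_subalgebra_P: "finite_measure_subalgebra (P \<theta>0) (F t)"
proof -
  interpret prob_space "P \<theta>0" by (rule prob)
  show ?thesis
    by unfold_locales (rule subalgebra_P)
qed

lemma prob_space_completion: "prob_space (completion (P \<theta>0))"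
proof -
  interpret prob_space "P \<theta>0" by (rule prob)
  show ?thesis
    by (rule prob_spaceI) (simp add: emeasure_space_1)
qed

lemma finite_measure_subalgebra_completion: "finite_measure_subalgebra (completion (P \<theta>0)) (F t)"
proof -
  interpret prob_space "completion (P \<theta>0)" by (rule prob_space_completion)
  show ?thesis
    by unfold_locales (rule subalgebra_completion)
qed

lemma \<mu>_measurable:
  "t \<ge> 1 \<Longrightarrow> \<theta> \<in> \<Theta> \<Longrightarrow> (\<lambda>w. \<mu> t \<theta> w $ k) \<in> borel_measurable (F (t - 1))"
  using cond_mean unfolding is_cond_mean_def is_cond_exp_def by blast

lemma S_measurable:
  "t \<ge> 1 \<Longrightarrow> \<theta> \<in> \<Theta> \<Longrightarrow> (\<lambda>w. S t \<theta> w $ k $ l) \<in> borel_measurable (F (t - 1))"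
  using cond_cov unfolding is_cond_cov_def is_cond_exp_def by blast

lemma measurable_F_mono:
  "f \<in> borel_measurable (F s) \<Longrightarrow> s \<le> t \<Longrightarrow> f \<in> borel_measurable (F t)"
  using measurable_from_subalg[OF subalgebra_natural_sigma_mono] by blast

lemma innovation_measurable:
  assumes "t \<ge> 1" "\<theta> \<in> \<Theta>"
  shows "(\<lambda>w. innovation x \<mu> t \<theta> w $ k) \<in> borel_measurable (F t)"
proof -
  have "x t \<in> borel_measurable (F t)"
    using assms by (intro measurable_natural_sigma) auto
  then have "(\<lambda>w. x t w $ k) \<in> borel_measurable (F t)"
    by (rule borel_measurable_component)
  moreover have "(\<lambda>w. \<mu> t \<theta> w $ k) \<in> borel_measurable (F t)"
    by (rule measurable_F_mono[OF \<mu>_measurable[OF assms]]) simp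
  ultimately show ?thesis
    unfolding innovation_def vector_minus_component by (rule borel_measurable_diff)
qed

lemma alpha_measurable:
  assumes "t \<ge> 1" "\<theta> \<in> \<Theta>"
  shows "(\<lambda>w. qml_alpha x \<mu> S t w \<theta>) \<in> borel_measurable (F t)"
proof -
  note innovation_measurable[OF assms, measurable]
  have S: "(\<lambda>w. S t \<theta> w $ k $ l) \<in> borel_measurable (F t)" for k l
    by (rule measurable_F_mono[OF S_measurable[OF assms]]) simp
  note borel_measurable_det[of "S t \<theta>", OF S, measurable]
    borel_measurable_matrix_inv[of "S t \<theta>", OF S, measurable]
  show ?thesis
    unfolding qml_alpha_def inner_vec_def matrix_vector_mult_def by simp measurable
qed

lemma Q_measurable:
  assumes "\<theta> \<in> \<Theta>"
  shows "(\<lambda>w. qml_Q x \<mu> S n w \<theta>) \<in> borel_measurable (F n)"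
proof -
  have "(\<lambda>w. qml_alpha x \<mu> S t w \<theta>) \<in> borel_measurable (F n)" if "t \<in> {1..n}" for t
    using that by (intro measurable_F_mono[OF alpha_measurable[OF _ assms], of t]) auto
  then show ?thesis
    unfolding qml_Q_def by (intro borel_measurable_add borel_measurable_times borel_measurable_sum
        borel_measurable_const)
qed

section \<open>Conditional moments at the true parameter\<close>

text \<open>Conditional Jensen for the square carries the second moment from \<open>x t\<close> to
  its conditional mean, and so to the innovation.\<close>

lemma innovation_square_integrable:
  assumes t: "t \<ge> 1"
  shows "integrable (P \<theta>0) (\<lambda>w. e t k w * e t l w)"
    and "integrable (P \<theta>0) (e t k)"
    and "AE w in P \<theta>0. real_cond_exp (P \<theta>0) (F (t - 1)) (e t k) w = 0"
proof -
  interpret finite_measure_subalgebra "P \<theta>0" "F (t - 1)"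
    by (rule finite_measure_subalgebra_P)
  interpret prob_space "P \<theta>0" by (rule prob)
  have xM: "x t \<in> borel_measurable (P \<theta>0)"
    using x_meas[OF t] measurable_cong_sets[OF sets_P refl] by blast
  have x_k: "(\<lambda>w. x t w $ k) \<in> borel_measurable (P \<theta>0)" for k
    using xM by (rule borel_measurable_component)
  have x2: "integrable (P \<theta>0) (\<lambda>w. (x t w $ k)\<^sup>2)" for k
  proof (rule Bochner_Integration.integrable_bound[OF x_sq[OF t]])
    have "\<bar>x t w $ k\<bar>\<^sup>2 \<le> (norm (x t w))\<^sup>2" for w
      by (intro power_mono component_le_norm_cart) auto
    then show "AE w in P \<theta>0. norm ((x t w $ k)\<^sup>2) \<le> norm ((norm (x t w))\<^sup>2)"
      by simp
    show "(\<lambda>w. (x t w $ k)\<^sup>2) \<in> borel_measurable (P \<theta>0)"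
      using x_k by (rule borel_measurable_power)
  qed
  have x1: "integrable (P \<theta>0) (\<lambda>w. x t w $ k)" for k
    using x_k x2 by (rule integrable_if_square_integrable)
  have \<mu>_eq: "AE w in P \<theta>0. \<mu> t \<theta>0 w $ k = real_cond_exp (P \<theta>0) (F (t - 1)) (\<lambda>w. x t w $ k) w" for k
    using cond_mean t Theta(2) unfolding is_cond_mean_def is_cond_exp_def by blast
  have \<mu>_F: "(\<lambda>w. \<mu> t \<theta>0 w $ k) \<in> borel_measurable (F (t - 1))" for k
    by (rule \<mu>_measurable[OF t Theta(2)])
  then have \<mu>_k: "(\<lambda>w. \<mu> t \<theta>0 w $ k) \<in> borel_measurable (P \<theta>0)" for k
    using measurable_from_subalg[OF subalgebra_P] by blast
  have \<mu>2: "integrable (P \<theta>0) (\<lambda>w. (\<mu> t \<theta>0 w $ k)\<^sup>2)" for k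
  proof -
    have "integrable (P \<theta>0) (\<lambda>w. (real_cond_exp (P \<theta>0) (F (t - 1)) (\<lambda>w. x t w $ k) w)\<^sup>2)"
      using x1 x2 by (intro integrable_convex_cond_exp[where I = UNIV and q = "\<lambda>y. y\<^sup>2"])
        (auto simp: convex_power2)
    then show ?thesis
    proof (rule integrable_cong_AE_imp)
      show "(\<lambda>w. (\<mu> t \<theta>0 w $ k)\<^sup>2) \<in> borel_measurable (P \<theta>0)"
        using \<mu>_k by (rule borel_measurable_power)
      show "AE w in P \<theta>0. (real_cond_exp (P \<theta>0) (F (t - 1)) (\<lambda>w. x t w $ k) w)\<^sup>2 = (\<mu> t \<theta>0 w $ k)\<^sup>2"
        using \<mu>_eq[of k] by eventually_elim simp
    qed
  qed
  have \<mu>1: "integrable (P \<theta>0) (\<lambda>w. \<mu> t \<theta>0 w $ k)" for k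
    using \<mu>_k \<mu>2 by (rule integrable_if_square_integrable)
  have e_k: "e t k \<in> borel_measurable (P \<theta>0)" for k
    unfolding innovation_def vector_minus_component by (rule borel_measurable_diff[OF x_k \<mu>_k])
  have e2: "integrable (P \<theta>0) (\<lambda>w. (e t k w)\<^sup>2)" for k
  proof -
    have "integrable (P \<theta>0) (\<lambda>w. (x t w $ k)\<^sup>2 + (\<mu> t \<theta>0 w $ k)\<^sup>2 - 2 * (x t w $ k * \<mu> t \<theta>0 w $ k))"
      using x2 \<mu>2 integrable_mult_if_square_integrable[OF x_k x2 \<mu>_k \<mu>2]
      by (intro Bochner_Integration.integrable_diff Bochner_Integration.integrable_add integrable_mult_right)
    then show ?thesis
      unfolding innovation_def vector_minus_component power2_diff mult.assoc .
  qed
  show "integrable (P \<theta>0) (\<lambda>w. e t k w * e t l w)"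
    by (rule integrable_mult_if_square_integrable[OF e_k e2 e_k e2])
  show "integrable (P \<theta>0) (e t k)"
    using e_k e2 by (rule integrable_if_square_integrable)
  have "AE w in P \<theta>0. real_cond_exp (P \<theta>0) (F (t - 1)) (\<lambda>w. x t w $ k - \<mu> t \<theta>0 w $ k) w =
      real_cond_exp (P \<theta>0) (F (t - 1)) (\<lambda>w. x t w $ k) w -
      real_cond_exp (P \<theta>0) (F (t - 1)) (\<lambda>w. \<mu> t \<theta>0 w $ k) w"
    using x1 \<mu>1 by (rule real_cond_exp_diff)
  moreover have "AE w in P \<theta>0. real_cond_exp (P \<theta>0) (F (t - 1)) (\<lambda>w. \<mu> t \<theta>0 w $ k) w = \<mu> t \<theta>0 w $ k"
    using \<mu>1 \<mu>_F by (rule real_cond_exp_F_meas)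
  ultimately show "AE w in P \<theta>0. real_cond_exp (P \<theta>0) (F (t - 1)) (e t k) w = 0"
    using \<mu>_eq[of k] unfolding innovation_def vector_minus_component by eventually_elim simp
qed

lemma conditional_covariance:
  assumes t: "t \<ge> 1"
  shows "AE w in P \<theta>0. S t \<theta>0 w $ k $ l =
      real_cond_exp (P \<theta>0) (F (t - 1)) (\<lambda>w. e t k w * e t l w) w"
    and "integrable (P \<theta>0) (\<lambda>w. S t \<theta>0 w $ k $ l)"
    and "AE w in P \<theta>0. real_cond_exp (P \<theta>0) (F (t - 1)) (\<lambda>w. e t k w * e t l w - S t \<theta>0 w $ k $ l) w = 0"
proof -
  interpret finite_measure_subalgebra "P \<theta>0" "F (t - 1)"
    by (rule finite_measure_subalgebra_P)
  note int = innovation_square_integrable(1)[OF t, of k l]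
  show eq: "AE w in P \<theta>0. S t \<theta>0 w $ k $ l =
      real_cond_exp (P \<theta>0) (F (t - 1)) (\<lambda>w. e t k w * e t l w) w"
    using cond_cov t Theta(2) unfolding is_cond_cov_def is_cond_exp_def by blast
  have SF: "(\<lambda>w. S t \<theta>0 w $ k $ l) \<in> borel_measurable (F (t - 1))"
    by (rule S_measurable[OF t Theta(2)])
  show S1: "integrable (P \<theta>0) (\<lambda>w. S t \<theta>0 w $ k $ l)"
    by (rule integrable_cong_AE_imp[OF real_cond_exp_int(1)[OF int]])
      (use eq measurable_from_subalg[OF subalgebra_P SF] in \<open>auto\<close>)
  have "AE w in P \<theta>0. real_cond_exp (P \<theta>0) (F (t - 1)) (\<lambda>w. e t k w * e t l w - S t \<theta>0 w $ k $ l) w =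
      real_cond_exp (P \<theta>0) (F (t - 1)) (\<lambda>w. e t k w * e t l w) w -
      real_cond_exp (P \<theta>0) (F (t - 1)) (\<lambda>w. S t \<theta>0 w $ k $ l) w"
    using int S1 by (rule real_cond_exp_diff)
  moreover have "AE w in P \<theta>0. real_cond_exp (P \<theta>0) (F (t - 1)) (\<lambda>w. S t \<theta>0 w $ k $ l) w = S t \<theta>0 w $ k $ l"
    using S1 SF by (rule real_cond_exp_F_meas)
  ultimately show "AE w in P \<theta>0. real_cond_exp (P \<theta>0) (F (t - 1)) (\<lambda>w. e t k w * e t l w - S t \<theta>0 w $ k $ l) w = 0"
    using eq by eventually_elim simp
qed

lemma S_symmetric:
  assumes t: "t \<ge> 1"
  shows "AE w in P \<theta>0. \<forall>k l. S t \<theta>0 w $ k $ l = S t \<theta>0 w $ l $ k"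
proof -
  have "AE w in P \<theta>0. S t \<theta>0 w $ k $ l = S t \<theta>0 w $ l $ k" for k l
    using conditional_covariance(1)[OF t, of k l] conditional_covariance(1)[OF t, of l k]
    by eventually_elim (simp add: mult.commute)
  then show ?thesis
    by (simp add: AE_all_countable)
qed

text \<open>For fixed \<open>v\<close> the quadratic form is a conditional expectation of the square
  of the inner product of \<open>v\<close> with the innovation. The exceptional null set depends on
  \<open>v\<close>, so a countable dense set is used and the inequality is extended by
  closedness.\<close>

lemma S_positive_semidefinite:
  assumes t: "t \<ge> 1"
  shows "AE w in P \<theta>0. \<forall>v. 0 \<le> v \<bullet> (S t \<theta>0 w *v v)"
proof -
  interpret finite_measure_subalgebra "P \<theta>0" "F (t - 1)"
    by (rule finite_measure_subalgebra_P)
  let ?E = "real_cond_exp (P \<theta>0) (F (t - 1))"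
  \<comment> \<open>Indexing by pairs makes the double sum a single one, to which linearity of the
    conditional expectation applies directly.\<close>
  define q where "q v p w = (v $ fst p * v $ snd p) * (e t (fst p) w * e t (snd p) w)"
    for v :: "real^'r" and p :: "'r \<times> 'r" and w
  have int: "integrable (P \<theta>0) (q v p)" for v p
    unfolding q_def by (intro integrable_mult_right innovation_square_integrable t)
  have quad: "v \<bullet> (A *v v) = (\<Sum>p\<in>UNIV. (v $ fst p * v $ snd p) * A $ fst p $ snd p)"
    for v :: "real^'r" and A
  proof -
    have "v \<bullet> (A *v v) = (\<Sum>k\<in>UNIV. \<Sum>l\<in>UNIV. (v $ k * v $ l) * A $ k $ l)"
      by (simp add: inner_vec_def matrix_vector_mult_def sum_distrib_left mult_ac)
    then show ?thesis
      by (simp add: sum.cartesian_product case_prod_beta)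
  qed
  have square: "(\<Sum>p\<in>UNIV. q v p w) = (\<Sum>k\<in>UNIV. v $ k * e t k w)\<^sup>2" for v w
  proof -
    have "(\<Sum>k\<in>UNIV. v $ k * e t k w)\<^sup>2 =
        (\<Sum>k\<in>UNIV. \<Sum>l\<in>UNIV. (v $ k * v $ l) * (e t k w * e t l w))"
      by (simp add: power2_eq_square sum_product mult_ac)
    then show ?thesis
      by (simp add: q_def sum.cartesian_product case_prod_beta)
  qed
  have pos: "AE w in P \<theta>0. 0 \<le> v \<bullet> (S t \<theta>0 w *v v)" for v
  proof -
    have "AE w in P \<theta>0. ?E (\<lambda>w. \<Sum>p\<in>UNIV. q v p w) w \<ge> 0"
    proof (rule real_cond_exp_pos)
      show "(\<lambda>w. \<Sum>p\<in>UNIV. q v p w) \<in> borel_measurable (P \<theta>0)"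
        by (intro borel_measurable_integrable Bochner_Integration.integrable_sum int)
    qed (simp add: square)
    moreover have "AE w in P \<theta>0. ?E (\<lambda>w. \<Sum>p\<in>UNIV. q v p w) w = (\<Sum>p\<in>UNIV. ?E (q v p) w)"
      by (rule real_cond_exp_sum) (rule int)
    moreover have "AE w in P \<theta>0. ?E (q v p) w = (v $ fst p * v $ snd p) * S t \<theta>0 w $ fst p $ snd p" for p
      using real_cond_exp_cmult[OF innovation_square_integrable(1)[OF t, of "fst p" "snd p"], of "v $ fst p * v $ snd p"]
        conditional_covariance(1)[OF t, of "fst p" "snd p"]
      unfolding q_def by eventually_elim simp
    then have "AE w in P \<theta>0. \<forall>p. ?E (q v p) w = (v $ fst p * v $ snd p) * S t \<theta>0 w $ fst p $ snd p"
      unfolding AE_all_countable by blast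
    ultimately show ?thesis
      unfolding quad by eventually_elim (simp del: split_paired_All)
  qed
  obtain D :: "(real^'r) set" where D: "countable D" "UNIV \<subseteq> closure D"
    by (rule separable[of "UNIV :: (real^'r) set"]) blast
  have "AE w in P \<theta>0. \<forall>v\<in>D. 0 \<le> v \<bullet> (S t \<theta>0 w *v v)"
    unfolding AE_ball_countable[OF D(1)] using pos by blast
  then show ?thesis
  proof eventually_elim
    case (elim w)
    have "closed {v. 0 \<le> v \<bullet> (S t \<theta>0 w *v v)}"
      by (rule closed_Collect_le[OF continuous_on_const
          continuous_on_inner[OF continuous_on_id matrix_vector_mult_linear_continuous_on]])
    then have "closure D \<subseteq> {v. 0 \<le> v \<bullet> (S t \<theta>0 w *v v)}"
      using elim by (intro closure_minimal) auto
    then show ?case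
      using D(2) by blast
  qed
qed

section \<open>Smooth paths\<close>

text \<open>
  The sign of \<open>det (S t \<theta> w)\<close> is only known from positivity at \<open>\<theta>0\<close>: for \<open>\<theta> \<noteq> \<theta>0\<close> the matrix is a conditional
  covariance under \<open>P \<theta>\<close>, which need not be absolutely continuous with respect to \<open>P \<theta>0\<close>.
\<close>

definition regular :: "nat \<Rightarrow> 'w \<Rightarrow> bool" where
  "regular t w \<longleftrightarrow>
     (\<forall>k. times_differentiable_on 2 (\<lambda>\<theta>. innovation x \<mu> t \<theta> w $ k) U) \<and>
     (\<forall>k l. times_differentiable_on 2 (\<lambda>\<theta>. S t \<theta> w $ k $ l) U) \<and>
     (\<forall>\<theta>\<in>U. det (S t \<theta> w) > 0) \<and> (\<forall>k l. S t \<theta>0 w $ k $ l = S t \<theta>0 w $ l $ k)"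

lemma AE_regular:
  assumes t: "t \<ge> 1"
  shows "AE w in P \<theta>0. regular t w"
  using e_smooth[OF t] S_smooth[OF t] S_symmetric[OF t] S_positive_semidefinite[OF t] inv[OF t]
proof eventually_elim
  case (elim w)
  have 1: "times_differentiable_on 2 (\<lambda>\<theta>. innovation x \<mu> t \<theta> w $ k) U" for k
    using twice_continuously_differentiable_on_imp_times_differentiable_on[OF elim(1) bounded_linear_vec_nth]
      r0(2) by (rule times_differentiable_on_subset)
  have 2: "times_differentiable_on 2 (\<lambda>\<theta>. S t \<theta> w $ k $ l) U" for k l
    using twice_continuously_differentiable_on_imp_times_differentiable_on[OF elim(2)
        bounded_linear_compose[OF bounded_linear_vec_nth bounded_linear_vec_nth]]
      r0(2) by (rule times_differentiable_on_subset)
  have "det (S t \<theta>0 w) > 0"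
    using elim(4,5) Theta(2) by (intro det_pos_if_psd_invertible) auto
  moreover have "det (S t \<theta> w) \<noteq> 0" if "\<theta> \<in> U" for \<theta>
    using elim(5) that r0(2) invertible_det_nz[of "S t \<theta> w"] by (meson subsetD)
  moreover have "times_differentiable_on (Suc 0) (\<lambda>\<theta>. S t \<theta> w $ k $ l) U" for k l
    using 2 unfolding numeral_2_eq_2 by (rule times_differentiable_on_SucD)
  ultimately have "det (S t \<theta> w) > 0" if "\<theta> \<in> U" for \<theta>
    by (intro det_pos_on_connected[OF connected_ball open_ball _ _ \<theta>0_mem _ that, of "\<lambda>\<theta>. S t \<theta> w"])
  then show ?case
    unfolding regular_def using 1 2 elim(3) by simp
qed

lemma regular_matrix_inv:
  assumes "regular t w"
  shows "times_differentiable_on 2 (\<lambda>\<theta>. matrix_inv (S t \<theta> w) $ k $ l) U"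
  using assms unfolding regular_def by (intro times_differentiable_on_matrix_inv) force+

lemma regular_alpha:
  assumes "regular t w"
  shows "times_differentiable_on 2 (qml_alpha x \<mu> S t w) U"
proof -
  have "times_differentiable_on 2 (\<lambda>\<theta>. ln (det (S t \<theta> w)) +
      (\<Sum>k\<in>UNIV. innovation x \<mu> t \<theta> w $ k *
        (\<Sum>l\<in>UNIV. matrix_inv (S t \<theta> w) $ k $ l * innovation x \<mu> t \<theta> w $ l))) U"
    using assms unfolding regular_def
    by (intro times_differentiable_on_add times_differentiable_on_ln times_differentiable_on_det
        times_differentiable_on_sum times_differentiable_on_mult regular_matrix_inv[OF assms]) blast+
  then show ?thesis
    unfolding qml_alpha_def[abs_def] inner_vec_def matrix_vector_mult_def by simp
qed

section \<open>The score as a martingale difference\<close>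

text \<open>\<open>quasi_likelihood_derivative\<close> along the \<open>i\<close>-th axis through
  \<open>\<theta>0\<close>, identified with the partial derivative by uniqueness of derivatives.
  Only the factors \<open>e t k\<close> involve the observation at time \<open>t\<close>.\<close>

lemma score_formula:
  assumes "regular t w"
  shows "qml_score x \<mu> S t i \<theta>0 w =
     (\<Sum>k\<in>UNIV. \<Sum>l\<in>UNIV. partial i (\<lambda>\<theta>. matrix_inv (S t \<theta> w) $ k $ l) \<theta>0 *
        (e t k w * e t l w - S t \<theta>0 w $ k $ l)) +
     (\<Sum>k\<in>UNIV. (\<Sum>l\<in>UNIV. partial i (\<lambda>\<theta>. innovation x \<mu> t \<theta> w $ l) \<theta>0 *
        (matrix_inv (S t \<theta>0 w) $ l $ k + matrix_inv (S t \<theta>0 w) $ k $ l)) * e t k w)"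
proof -
  let ?y = "\<lambda>h. \<theta>0 + h *\<^sub>R axis i (1::real)"
  have along: "((\<lambda>h. f (?y h)) has_real_derivative partial i f \<theta>0) (at 0)"
    if "times_differentiable_on 2 f U" for f
  proof -
    have "(f has_derivative (\<lambda>v. (\<chi> i. partial i f \<theta>0) \<bullet> v)) (at \<theta>0)"
      using that \<theta>0_mem unfolding numeral_2_eq_2
      by (intro times_differentiable_on_partial[OF open_ball])
    from has_real_derivative_along_axis[OF this, of i] show ?thesis by simp
  qed
  have "\<forall>\<^sub>F h in nhds (0::real). ?y h \<in> U"
  proof (rule topological_tendstoD)
    show "(?y \<longlongrightarrow> \<theta>0) (nhds 0)"
      by (rule tendsto_eq_intros filterlim_ident refl | simp)+
  qed (use \<theta>0_mem in auto)
  then have pos: "\<forall>\<^sub>F h in nhds (0::real). det (S t (?y h) w) > 0"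
    by eventually_elim (use assms in \<open>auto simp: regular_def\<close>)
  have "((\<lambda>h. ln (det (S t (?y h) w)) + innovation x \<mu> t (?y h) w \<bullet>
      (matrix_inv (S t (?y h) w) *v innovation x \<mu> t (?y h) w)) has_real_derivative
      (\<Sum>k\<in>UNIV. \<Sum>l\<in>UNIV. (\<chi> k l. partial i (\<lambda>\<theta>. matrix_inv (S t \<theta> w) $ k $ l) \<theta>0) $ k $ l *
        (innovation x \<mu> t (?y 0) w $ k * innovation x \<mu> t (?y 0) w $ l - S t (?y 0) w $ k $ l)) +
     (\<Sum>k\<in>UNIV. (\<Sum>l\<in>UNIV. (\<chi> l. partial i (\<lambda>\<theta>. innovation x \<mu> t \<theta> w $ l) \<theta>0) $ l *
        (matrix_inv (S t (?y 0) w) $ l $ k + matrix_inv (S t (?y 0) w) $ k $ l)) *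
          innovation x \<mu> t (?y 0) w $ k)) (at 0)"
  proof (rule quasi_likelihood_derivative)
    show "((\<lambda>h. S t (?y h) w $ k $ l) has_real_derivative
        (\<chi> k l. partial i (\<lambda>\<theta>. S t \<theta> w $ k $ l) \<theta>0) $ k $ l) (at 0)" for k l
      using along[of "\<lambda>\<theta>. S t \<theta> w $ k $ l"] assms unfolding regular_def by simp
    show "((\<lambda>h. matrix_inv (S t (?y h) w) $ k $ l) has_real_derivative
        (\<chi> k l. partial i (\<lambda>\<theta>. matrix_inv (S t \<theta> w) $ k $ l) \<theta>0) $ k $ l) (at 0)" for k l
      using along[OF regular_matrix_inv[OF assms]] by simp
    show "((\<lambda>h. innovation x \<mu> t (?y h) w $ k) has_real_derivative
        (\<chi> l. partial i (\<lambda>\<theta>. innovation x \<mu> t \<theta> w $ l) \<theta>0) $ k) (at 0)" for k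
      using along[of "\<lambda>\<theta>. innovation x \<mu> t \<theta> w $ k"] assms unfolding regular_def by simp
    show "S t (?y 0) w $ k $ l = S t (?y 0) w $ l $ k" for k l
      using assms unfolding regular_def by simp
  qed (rule pos)
  moreover have "((\<lambda>h. qml_alpha x \<mu> S t w (?y h)) has_real_derivative
      partial i (qml_alpha x \<mu> S t w) \<theta>0) (at 0)"
    by (rule along[OF regular_alpha[OF assms]])
  ultimately show ?thesis
    unfolding qml_score_def qml_alpha_def using DERIV_unique by fastforce
qed

lemma score_version:
  assumes t: "t \<ge> 1"
  obtains g where "g \<in> borel_measurable (F t)" "AE w in P \<theta>0. g w = qml_score x \<mu> S t i \<theta>0 w"
proof -
  have "(\<lambda>w. qml_alpha x \<mu> S t w v) \<in> borel_measurable (F t)" if "v \<in> U" for v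
    using alpha_measurable[OF t] r0(2) that by blast
  then obtain g where g: "g \<in> borel_measurable (F t)"
    "\<And>w. times_differentiable_on (Suc 0) (\<lambda>v. qml_alpha x \<mu> S t w v) U \<Longrightarrow>
      g w = partial i (\<lambda>v. qml_alpha x \<mu> S t w v) \<theta>0"
    by (rule partial_measurable_version[OF open_ball \<theta>0_mem, where f = "\<lambda>v w. qml_alpha x \<mu> S t w v"]) blast+
  have "AE w in P \<theta>0. g w = qml_score x \<mu> S t i \<theta>0 w"
    using AE_regular[OF t]
  proof eventually_elim
    case (elim w)
    have "times_differentiable_on (Suc 0) (qml_alpha x \<mu> S t w) U"
      using regular_alpha[OF elim] unfolding numeral_2_eq_2 by (rule times_differentiable_on_SucD)
    then show ?case
      unfolding qml_score_def by (rule g(2))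
  qed
  with g(1) show thesis
    by (rule that)
qed

lemma hess_version:
  assumes t: "t \<ge> 1"
  obtains g where "g \<in> borel_measurable (F t)" "AE w in P \<theta>0. g w = qml_hess x \<mu> S t i j \<theta>0 w"
proof -
  have "(\<lambda>w. qml_alpha x \<mu> S t w v) \<in> borel_measurable (F t)" if "v \<in> U" for v
    using alpha_measurable[OF t] r0(2) that by blast
  then obtain g where g: "g \<in> borel_measurable (F t)"
    "\<And>w. times_differentiable_on 2 (\<lambda>v. qml_alpha x \<mu> S t w v) U \<Longrightarrow>
      g w = partial i (partial j (\<lambda>v. qml_alpha x \<mu> S t w v)) \<theta>0"
    by (rule second_partial_measurable_version[OF open_ball \<theta>0_mem, where f = "\<lambda>v w. qml_alpha x \<mu> S t w v"]) blast+
  have "AE w in P \<theta>0. g w = qml_hess x \<mu> S t i j \<theta>0 w"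
    using AE_regular[OF t]
    by eventually_elim (simp only: qml_hess_def g(2)[OF regular_alpha])
  with g(1) show thesis
    by (rule that)
qed

text \<open>In \<open>score_formula\<close> the coefficients are known at time \<open>t - 1\<close>,
  and the remaining factors are conditionally centred by the choice of \<open>\<mu>\<close> and
  \<open>S\<close> as conditional moments at \<open>\<theta>0\<close>.\<close>

lemma score_conditional_expectation:
  assumes t: "t \<ge> 1" and g: "integrable (P \<theta>0) g" "AE w in P \<theta>0. g w = qml_score x \<mu> S t i \<theta>0 w"
  shows "AE w in P \<theta>0. real_cond_exp (P \<theta>0) (F (t - 1)) g w = 0"
proof -
  interpret finite_measure_subalgebra "P \<theta>0" "F (t - 1)"
    by (rule finite_measure_subalgebra_P)
  have S_F: "(\<lambda>w. S t \<theta> w $ k $ l) \<in> borel_measurable (F (t - 1))" if "\<theta> \<in> U" for \<theta> k l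
    using S_measurable[OF t] r0(2) that by blast
  have inv_F: "(\<lambda>w. matrix_inv (S t \<theta> w) $ k $ l) \<in> borel_measurable (F (t - 1))" if "\<theta> \<in> U" for \<theta> k l
    by (rule borel_measurable_matrix_inv) (rule S_F[OF that])
  have "\<exists>G. G \<in> borel_measurable (F (t - 1)) \<and> (\<forall>w. regular t w \<longrightarrow>
      G w = partial i (\<lambda>\<theta>. matrix_inv (S t \<theta> w) $ k $ l) \<theta>0)" for k l
  proof -
    obtain G where "G \<in> borel_measurable (F (t - 1))"
      "\<And>w. times_differentiable_on (Suc 0) (\<lambda>\<theta>. matrix_inv (S t \<theta> w) $ k $ l) U \<Longrightarrow>
        G w = partial i (\<lambda>\<theta>. matrix_inv (S t \<theta> w) $ k $ l) \<theta>0"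
      using inv_F[of _ k l] by (rule partial_measurable_version[OF open_ball \<theta>0_mem,
        where f = "\<lambda>\<theta> w. matrix_inv (S t \<theta> w) $ k $ l"]) blast+
    moreover have "times_differentiable_on (Suc 0) (\<lambda>\<theta>. matrix_inv (S t \<theta> w) $ k $ l) U" if "regular t w" for w
      using regular_matrix_inv[OF that] unfolding numeral_2_eq_2 by (rule times_differentiable_on_SucD)
    ultimately show ?thesis by blast
  qed
  then obtain R where R: "\<And>k l. R k l \<in> borel_measurable (F (t - 1))"
    "\<And>k l w. regular t w \<Longrightarrow> R k l w = partial i (\<lambda>\<theta>. matrix_inv (S t \<theta> w) $ k $ l) \<theta>0"
    by metis
  have "\<exists>G. G \<in> borel_measurable (F (t - 1)) \<and> (\<forall>w. regular t w \<longrightarrow>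
      G w = partial i (\<lambda>\<theta>. innovation x \<mu> t \<theta> w $ l) \<theta>0)" for l
  proof -
    \<comment> \<open>The innovation is only known at time \<open>t\<close>, but \<open>x t\<close>
      is constant in the parameter: the derivative is that of \<open>- \<mu>\<close>, which is known
      at time \<open>t - 1\<close>.\<close>
    have "(\<lambda>w. - \<mu> t \<theta> w $ l) \<in> borel_measurable (F (t - 1))" if "\<theta> \<in> U" for \<theta>
      using \<mu>_measurable[OF t, of \<theta> l] r0(2) that by (intro borel_measurable_uminus) blast
    then obtain G where G: "G \<in> borel_measurable (F (t - 1))"
      "\<And>w. times_differentiable_on (Suc 0) (\<lambda>\<theta>. - \<mu> t \<theta> w $ l) U \<Longrightarrow>
        G w = partial i (\<lambda>\<theta>. - \<mu> t \<theta> w $ l) \<theta>0"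
      by (rule partial_measurable_version[OF open_ball \<theta>0_mem, where f = "\<lambda>\<theta> w. - \<mu> t \<theta> w $ l"]) blast+
    have "G w = partial i (\<lambda>\<theta>. innovation x \<mu> t \<theta> w $ l) \<theta>0" if w: "regular t w" for w
    proof -
      have eq: "(\<lambda>\<theta>. - \<mu> t \<theta> w $ l) = (\<lambda>\<theta>. innovation x \<mu> t \<theta> w $ l + - (x t w $ l))"
        unfolding innovation_def by simp
      have "times_differentiable_on 2 (\<lambda>\<theta>. innovation x \<mu> t \<theta> w $ l) U"
        using w unfolding regular_def by blast
      then have d: "times_differentiable_on (Suc 0) (\<lambda>\<theta>. innovation x \<mu> t \<theta> w $ l) U"
        unfolding numeral_2_eq_2 by (rule times_differentiable_on_SucD)
      then have "times_differentiable_on (Suc 0) (\<lambda>\<theta>. - \<mu> t \<theta> w $ l) U"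
        unfolding eq by (rule times_differentiable_on_add[OF _ times_differentiable_on_const])
      from G(2)[OF this] show ?thesis
        unfolding eq partial_add_const[OF open_ball d \<theta>0_mem] .
    qed
    with G(1) show ?thesis by blast
  qed
  then obtain N where N: "\<And>l. N l \<in> borel_measurable (F (t - 1))"
    "\<And>l w. regular t w \<Longrightarrow> N l w = partial i (\<lambda>\<theta>. innovation x \<mu> t \<theta> w $ l) \<theta>0"
    by metis
  \<comment> \<open>The index type is a disjoint sum: pairs stand for the centred products, single
    indices for the innovations.\<close>
  define b where "b = case_sum (\<lambda>p. R (fst p) (snd p))
    (\<lambda>k w. \<Sum>l\<in>UNIV. N l w * (matrix_inv (S t \<theta>0 w) $ l $ k + matrix_inv (S t \<theta>0 w) $ k $ l))"
  define Z where "Z = case_sum (\<lambda>p w. e t (fst p) w * e t (snd p) w - S t \<theta>0 w $ fst p $ snd p) (e t)"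
  show ?thesis
  proof (rule real_cond_exp_linear_combination_0[OF g(1), where I = UNIV and b = b and Z = Z])
    show "AE w in P \<theta>0. g w = (\<Sum>p\<in>UNIV. b p w * Z p w)"
      using g(2) AE_regular[OF t]
    proof eventually_elim
      case (elim w)
      have "(\<Sum>p\<in>UNIV. b p w * Z p w) =
          (\<Sum>p\<in>UNIV. R (fst p) (snd p) w * (e t (fst p) w * e t (snd p) w - S t \<theta>0 w $ fst p $ snd p)) +
          (\<Sum>k\<in>UNIV. (\<Sum>l\<in>UNIV. N l w * (matrix_inv (S t \<theta>0 w) $ l $ k + matrix_inv (S t \<theta>0 w) $ k $ l)) * e t k w)"
        unfolding UNIV_Plus_UNIV[symmetric] by (subst sum.Plus) (simp_all add: b_def Z_def)
      also have "\<dots> = qml_score x \<mu> S t i \<theta>0 w"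
        unfolding score_formula[OF elim(2)] R(2)[OF elim(2)] N(2)[OF elim(2)]
        by (simp add: sum.cartesian_product case_prod_beta)
      finally show ?case
        using elim(1) by simp
    qed
    fix p :: "('r \<times> 'r) + 'r"
    show "b p \<in> borel_measurable (F (t - 1))"
      unfolding b_def
      by (cases p) (auto intro!: R(1) borel_measurable_sum borel_measurable_times borel_measurable_add
          N(1) inv_F[OF \<theta>0_mem] simp del: One_nat_def)
    show "integrable (P \<theta>0) (Z p)"
      unfolding Z_def using innovation_square_integrable[OF t] conditional_covariance(2)[OF t]
      by (cases p) (auto intro!: Bochner_Integration.integrable_diff simp del: One_nat_def)
    show "AE w in P \<theta>0. real_cond_exp (P \<theta>0) (F (t - 1)) (Z p) w = 0"
      unfolding Z_def using innovation_square_integrable(3)[OF t] conditional_covariance(3)[OF t]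
      by (cases p) (auto simp del: One_nat_def)
  qed simp
qed

section \<open>Almost sure rates\<close>

lemma score_AE_tendsto_0:
  assumes a: "\<And>t. t \<ge> 1 \<Longrightarrow>
      (\<integral>\<^sup>+ w. ennreal (\<bar>qml_score x \<mu> S t i \<theta>0 w\<bar> ^ 4) \<partial>completion (P \<theta>0)) \<le> ennreal C"
    and C: "C > 0"
  shows "AE w in P \<theta>0. (\<lambda>n. real n powr (- 7 / 8) * (\<Sum>t=1..n. qml_score x \<mu> S t i \<theta>0 w)) \<longlonglongrightarrow> 0"
proof -
  interpret prob_space "P \<theta>0" by (rule prob)
  have "\<forall>t. \<exists>g. t \<ge> 1 \<longrightarrow> g \<in> borel_measurable (F t) \<and> (AE w in P \<theta>0. g w = qml_score x \<mu> S t i \<theta>0 w)"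
    using score_version by metis
  then obtain g where g: "\<And>t. t \<ge> 1 \<Longrightarrow> g t \<in> borel_measurable (F t)"
    "\<And>t. t \<ge> 1 \<Longrightarrow> AE w in P \<theta>0. g t w = qml_score x \<mu> S t i \<theta>0 w"
    by metis
  have gP: "g t \<in> borel_measurable (P \<theta>0)" if "t \<ge> 1" for t
    by (rule measurable_from_subalg[OF subalgebra_P g(1)[OF that]])
  have bnd: "(\<integral>\<^sup>+ w. ennreal ((g t w)\<^sup>2) \<partial>P \<theta>0) \<le> ennreal (1 + C)" if t: "t \<ge> 1" for t
  proof -
    \<comment> \<open>Passes from the fourth moment in (a) to the second moment of the martingale
      argument, giving the constant \<open>1 + C\<close>.\<close>
    have "ennreal (y\<^sup>2) \<le> 1 + ennreal (\<bar>y\<bar> ^ 4)" for y :: real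
    proof -
      have "\<bar>y\<bar> ^ 4 = (y\<^sup>2)\<^sup>2"
        by (simp add: power4_eq_xxxx power2_eq_square)
      then have "2 * y\<^sup>2 \<le> 1 + \<bar>y\<bar> ^ 4"
        using sum_squares_bound[of 1 "y\<^sup>2"] by simp
      then have "y\<^sup>2 \<le> 1 + \<bar>y\<bar> ^ 4"
        using zero_le_power2[of y] by linarith
      then have "ennreal (y\<^sup>2) \<le> ennreal (1 + \<bar>y\<bar> ^ 4)"
        by (rule ennreal_leI)
      then show ?thesis
        by (simp add: ennreal_plus)
    qed
    then have "(\<integral>\<^sup>+ w. ennreal ((g t w)\<^sup>2) \<partial>P \<theta>0) \<le> (\<integral>\<^sup>+ w. 1 + ennreal (\<bar>g t w\<bar> ^ 4) \<partial>P \<theta>0)"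
      by (intro nn_integral_mono)
    also have "\<dots> = 1 + (\<integral>\<^sup>+ w. ennreal (\<bar>g t w\<bar> ^ 4) \<partial>P \<theta>0)"
      using gP[OF t] by (subst nn_integral_add) (auto simp: emeasure_space_1)
    also have "(\<integral>\<^sup>+ w. ennreal (\<bar>g t w\<bar> ^ 4) \<partial>P \<theta>0) =
        (\<integral>\<^sup>+ w. ennreal (\<bar>qml_score x \<mu> S t i \<theta>0 w\<bar> ^ 4) \<partial>P \<theta>0)"
      by (rule nn_integral_cong_AE) (use g(2)[OF t] in eventually_elim, simp)
    also have "\<dots> \<le> ennreal C"
      using a[OF t] unfolding nn_integral_completion .
    finally show ?thesis
      using C by (simp add: ennreal_plus)
  qed
  have "AE w in P \<theta>0. (\<lambda>n. real n powr (- 7 / 8) * (\<Sum>t=1..n. g t w)) \<longlonglongrightarrow> 0"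
  proof (rule martingale_difference_AE_tendsto_0[where F = F and C = "1 + C"])
    show "AE w in P \<theta>0. real_cond_exp (P \<theta>0) (F (t - 1)) (g t) w = 0" if t: "t \<ge> 1" for t
    proof (rule score_conditional_expectation[OF t _ g(2)[OF t]])
      have "integrable (P \<theta>0) (\<lambda>w. (g t w)\<^sup>2)"
      proof (rule integrableI_bounded)
        show "(\<lambda>w. (g t w)\<^sup>2) \<in> borel_measurable (P \<theta>0)"
          using gP[OF t] by (rule borel_measurable_power)
        show "(\<integral>\<^sup>+ w. ennreal (norm ((g t w)\<^sup>2)) \<partial>P \<theta>0) < \<infinity>"
          using bnd[OF t] by (simp add: le_less_trans)
      qed
      with gP[OF t] show "integrable (P \<theta>0) (g t)"
        by (rule integrable_if_square_integrable)
    qed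
  qed (use subalgebra_P subalgebra_natural_sigma_mono g(1) bnd C in auto)
  moreover have "AE w in P \<theta>0. \<forall>t. t \<ge> 1 \<longrightarrow> g t w = qml_score x \<mu> S t i \<theta>0 w"
    unfolding AE_all_countable using g(2) by auto
  ultimately show ?thesis
    by eventually_elim simp
qed

text \<open>The argument runs under the completion, where \<open>qml_hess\<close> is measurable and
  \<open>qml_cond_hess\<close> is its conditional expectation. The version \<open>g\<close> supplies
  adaptedness to the filtration, which \<open>qml_hess\<close> itself may lack on a null
  set.\<close>

lemma hess_AE_tendsto_0:
  assumes b: "\<And>t. t \<ge> 1 \<Longrightarrow>
      (\<integral>\<^sup>+ w. ennreal (\<bar>qml_hess x \<mu> S t i j \<theta>0 w - qml_cond_hess M (P \<theta>0) x \<mu> S t i j \<theta>0 w\<bar>\<^sup>2)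
        \<partial>completion (P \<theta>0)) \<le> ennreal C"
    and C: "C > 0"
  shows "AE w in P \<theta>0. (\<lambda>n. real n powr (- 7 / 8) *
    (\<Sum>t=1..n. qml_hess x \<mu> S t i j \<theta>0 w - qml_cond_hess M (P \<theta>0) x \<mu> S t i j \<theta>0 w)) \<longlonglongrightarrow> 0"
proof -
  let ?N = "completion (P \<theta>0)"
  let ?h = "\<lambda>t. qml_hess x \<mu> S t i j \<theta>0"
  let ?c = "\<lambda>t. qml_cond_hess M (P \<theta>0) x \<mu> S t i j \<theta>0"
  interpret prob_space ?N by (rule prob_space_completion)
  have "\<forall>t. \<exists>g. t \<ge> 1 \<longrightarrow> g \<in> borel_measurable (F t) \<and> (AE w in P \<theta>0. g w = ?h t w)"
    using hess_version by metis
  then obtain g where g: "\<And>t. t \<ge> 1 \<Longrightarrow> g t \<in> borel_measurable (F t)"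
    "\<And>t. t \<ge> 1 \<Longrightarrow> AE w in P \<theta>0. g t w = ?h t w"
    by metis
  have hN: "?h t \<in> borel_measurable ?N" if "t \<ge> 1" for t
  proof (rule measurable_completion_if_AE_eq)
    show "g t \<in> borel_measurable (P \<theta>0)"
      by (rule measurable_from_subalg[OF subalgebra_P g(1)[OF that]])
    show "AE w in P \<theta>0. ?h t w = g t w"
      using g(2)[OF that] by eventually_elim simp
  qed
  have cF: "?c t \<in> borel_measurable (F (t - 1))" for t
    unfolding qml_cond_hess_def by (rule borel_measurable_cond_exp)
  have XF: "(\<lambda>w. g t w - ?c t w) \<in> borel_measurable (F t)" if "t \<ge> 1" for t
    using g(1)[OF that] measurable_F_mono[OF cF, of t t] by (intro borel_measurable_diff) auto
  have eq: "AE w in ?N. g t w - ?c t w = ?h t w - ?c t w" if "t \<ge> 1" for t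
    using AE_completion[OF g(2)[OF that]] by eventually_elim simp
  have "AE w in ?N. (\<lambda>n. real n powr (- 7 / 8) * (\<Sum>t=1..n. g t w - ?c t w)) \<longlonglongrightarrow> 0"
  proof (rule martingale_difference_AE_tendsto_0[where F = F and C = C])
    show bnd: "(\<integral>\<^sup>+ w. ennreal ((g t w - ?c t w)\<^sup>2) \<partial>?N) \<le> ennreal C" if t: "t \<ge> 1" for t
    proof -
      have "(\<integral>\<^sup>+ w. ennreal ((g t w - ?c t w)\<^sup>2) \<partial>?N) = (\<integral>\<^sup>+ w. ennreal (\<bar>?h t w - ?c t w\<bar>\<^sup>2) \<partial>?N)"
        by (rule nn_integral_cong_AE) (use eq[OF t] in eventually_elim, simp)
      then show ?thesis
        using b[OF t] by simp
    qed
    show "AE w in ?N. real_cond_exp ?N (F (t - 1)) (\<lambda>w. g t w - ?c t w) w = 0" if t: "t \<ge> 1" for t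
    proof -
      interpret G: finite_measure_subalgebra ?N "F (t - 1)"
        by (rule finite_measure_subalgebra_completion)
      have gN: "(\<lambda>w. g t w - ?c t w) \<in> borel_measurable ?N"
        by (rule measurable_from_subalg[OF subalgebra_completion XF[OF t]])
      have "?c t \<in> borel_measurable ?N"
        by (rule measurable_from_subalg[OF subalgebra_completion cF])
      with hN[OF t] have dN: "(\<lambda>w. ?h t w - ?c t w) \<in> borel_measurable ?N"
        by (rule borel_measurable_diff)
      have "integrable ?N (\<lambda>w. (?h t w - ?c t w)\<^sup>2)"
      proof (rule integrableI_bounded)
        show "(\<lambda>w. (?h t w - ?c t w)\<^sup>2) \<in> borel_measurable ?N"
          using dN by (rule borel_measurable_power)
        show "(\<integral>\<^sup>+ w. ennreal (norm ((?h t w - ?c t w)\<^sup>2)) \<partial>?N) < \<infinity>"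
          using b[OF t] by (simp add: le_less_trans)
      qed
      with dN have "integrable ?N (\<lambda>w. ?h t w - ?c t w)"
        by (rule integrable_if_square_integrable)
      then have "AE w in ?N. real_cond_exp ?N (F (t - 1)) (\<lambda>w. ?h t w - ?c t w) w = 0"
        unfolding qml_cond_hess_def by (rule G.real_cond_exp_diff_self[OF hN[OF t]])
      with G.real_cond_exp_cong[OF eq[OF t] gN dN] show ?thesis
        by eventually_elim simp
    qed
  qed (use subalgebra_completion subalgebra_natural_sigma_mono XF C in auto)
  then have "AE w in P \<theta>0. (\<lambda>n. real n powr (- 7 / 8) * (\<Sum>t=1..n. g t w - ?c t w)) \<longlonglongrightarrow> 0"
    unfolding AE_completion_iff .
  moreover have "AE w in P \<theta>0. \<forall>t. t \<ge> 1 \<longrightarrow> g t w = ?h t w"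
    unfolding AE_all_countable using g(2) by auto
  ultimately show ?thesis
    by eventually_elim simp
qed

section \<open>Localisation on shrinking balls\<close>

text \<open>The factor \<open>r0 / 2\<close> keeps every ball inside \<open>U\<close>; the exponent
  is 7/8 - 1, which makes \<open>n * \<rho> n\<close> of the order that the scores stay below. For
  \<open>n = 0\<close> the radius is 0, as \<open>0 powr a = 0\<close>.\<close>

definition "\<rho> n = r0 / 2 * real n powr (- 1 / 8)"

lemma cball_\<rho>: "cball \<theta>0 (\<rho> n) \<subseteq> U"
proof -
  have "real n powr (- 1 / 8) \<le> 1"
  proof (cases "n = 0")
    case False
    then have "real n powr (- 1 / 8) \<le> real n powr 0"
      by (intro powr_mono) auto
    then show ?thesis using False by simp
  qed simp
  then have "\<rho> n \<le> r0 / 2 * 1"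
    unfolding \<rho>_def using r0(1) by (intro mult_left_mono) auto
  then have "\<rho> n < r0"
    using r0(1) by linarith
  then show ?thesis by auto
qed

lemma \<rho>_nonneg: "\<rho> n \<ge> 0"
  unfolding \<rho>_def using r0(1) by simp

lemma \<rho>_tendsto_0: "\<rho> \<longlonglongrightarrow> 0"
proof -
  have "(\<lambda>n. real n powr (- 1 / 8)) \<longlonglongrightarrow> 0"
    by real_asymp
  then have "(\<lambda>n. r0 / 2 * real n powr (- 1 / 8)) \<longlonglongrightarrow> r0 / 2 * 0"
    by (intro tendsto_mult tendsto_const)
  then show ?thesis
    unfolding \<rho>_def[abs_def] by simp
qed

lemma Q_twice_differentiable:
  assumes "\<And>t. t \<ge> 1 \<Longrightarrow> regular t w"
  shows "times_differentiable_on 2 (qml_Q x \<mu> S n w) U"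
  unfolding qml_Q_def[abs_def]
  by (intro times_differentiable_on_add times_differentiable_on_mult times_differentiable_on_const
      times_differentiable_on_sum) (auto intro!: regular_alpha assms)

lemma partial_Q:
  assumes "\<And>t. t \<ge> 1 \<Longrightarrow> regular t w" "u \<in> U"
  shows "partial i (qml_Q x \<mu> S n w) u = 1 / 2 * (\<Sum>t=1..n. qml_score x \<mu> S t i u w)"
proof -
  have "times_differentiable_on (Suc (Suc 0)) (qml_alpha x \<mu> S t w) U" if "t \<in> {1..n}" for t
    using regular_alpha[OF assms(1)] that unfolding numeral_2_eq_2 by simp
  from partial_affine_sum[OF open_ball assms(2) this] show ?thesis
    unfolding qml_Q_def[abs_def] qml_score_def .
qed

lemma second_partial_Q:
  assumes "\<And>t. t \<ge> 1 \<Longrightarrow> regular t w" "u \<in> U"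
  shows "partial i (partial j (qml_Q x \<mu> S n w)) u = 1 / 2 * (\<Sum>t=1..n. qml_hess x \<mu> S t i j u w)"
proof -
  have "times_differentiable_on (Suc (Suc 0)) (qml_alpha x \<mu> S t w) U" if "t \<in> {1..n}" for t
    using regular_alpha[OF assms(1)] that unfolding numeral_2_eq_2 by simp
  then have d: "times_differentiable_on (Suc 0) (partial j (qml_alpha x \<mu> S t w)) U" if "t \<in> {1..n}" for t
    using times_differentiable_on_partial(1)[OF open_ball] that by blast
  have "partial i (partial j (qml_Q x \<mu> S n w)) u =
      partial i (\<lambda>v. 1 / 2 * (\<Sum>t=1..n. partial j (qml_alpha x \<mu> S t w) v) + 0) u"
    by (rule partial_cong_open[OF open_ball assms(2)])
      (simp add: partial_Q[OF assms(1)] qml_score_def)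
  also have "\<dots> = 1 / 2 * (\<Sum>t=1..n. qml_hess x \<mu> S t i j u w)"
    unfolding qml_hess_def by (rule partial_affine_sum[OF open_ball assms(2) d])
  finally show ?thesis .
qed

text \<open>The pathwise core: \<open>w\<close> is fixed and all probability sits in the
  assumptions. Half of the coercivity of \<open>V\<close> is sacrificed to the two Hessian errors,
  at \<open>\<theta>0\<close> and across the ball.\<close>

lemma eventually_argmin_found:
  fixes V :: "real^'m^'m"
  assumes reg: "\<And>t. t \<ge> 1 \<Longrightarrow> regular t w"
    and score: "\<And>i. (\<lambda>n. real n powr (- 7 / 8) * (\<Sum>t=1..n. qml_score x \<mu> S t i \<theta>0 w)) \<longlonglongrightarrow> 0"
    and hess: "\<And>i j. (\<lambda>n. real n powr (- 7 / 8) * (\<Sum>t=1..n. qml_hess x \<mu> S t i j \<theta>0 w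
      - qml_cond_hess M (P \<theta>0) x \<mu> S t i j \<theta>0 w)) \<longlonglongrightarrow> 0"
    and c: "\<And>i j. (\<lambda>n. 1 / (2 * real n) * (\<Sum>t=1..n. qml_cond_hess M (P \<theta>0) x \<mu> S t i j \<theta>0 w))
      \<longlonglongrightarrow> V $ i $ j"
    and V: "strictly_positive_definite V"
    and d: "\<And>i j. \<exists>\<delta>>0. limsup (\<lambda>n. SUP \<Delta>\<in>{0<..<\<delta>}. SUP \<theta>\<in>ball \<theta>0 \<Delta>. SUP \<theta>s\<in>closed_segment \<theta>0 \<theta>.
        ereal (inverse (real n * \<Delta>) *
          \<bar>\<Sum>t=1..n. (qml_hess x \<mu> S t i j \<theta>s w - qml_hess x \<mu> S t i j \<theta>0 w)\<bar>)) < \<infinity>"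
    and D: "\<And>n. range (D n) \<subseteq> cball \<theta>0 (\<rho> n)" "\<And>n. cball \<theta>0 (\<rho> n) \<subseteq> closure (range (D n))"
  shows "\<forall>\<^sub>F n in sequentially. argmin_found (D n) \<theta>0 (\<rho> n) (qml_Q x \<mu> S n w)"
proof -
  let ?H = "\<lambda>n i j u. \<Sum>t=1..n. qml_hess x \<mu> S t i j u w"
  obtain \<nu> where \<nu>: "\<nu> > 0" "\<And>v. \<nu> * (norm v)\<^sup>2 \<le> v \<bullet> (V *v v)"
    using strictly_positive_definite_lower_bound[OF V] by blast
  \<comment> \<open>Chosen so that an entrywise error \<open>\<epsilon>\<close> costs at most
    \<open>\<nu> / 2\<close> in \<open>quadratic_form_perturbation\<close>; each of the two sources
    of error receives half of it.\<close>
  define \<epsilon> where "\<epsilon> = \<nu> / (2 * (real CARD('m))\<^sup>2)"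
  have \<epsilon>: "\<epsilon> > 0" "(real CARD('m))\<^sup>2 * \<epsilon> = \<nu> / 2"
    unfolding \<epsilon>_def using \<nu>(1) by auto
  have at_\<theta>0: "(\<lambda>n. 1 / (2 * real n) * ?H n i j \<theta>0) \<longlonglongrightarrow> V $ i $ j" for i j
  proof -
    let ?X = "\<lambda>n. \<Sum>t=1..n. qml_hess x \<mu> S t i j \<theta>0 w - qml_cond_hess M (P \<theta>0) x \<mu> S t i j \<theta>0 w"
    have "(\<lambda>n. 1 / 2 * real n powr (- 1 / 8)) \<longlonglongrightarrow> 0"
      by real_asymp
    from tendsto_add[OF c tendsto_mult[OF this hess]]
    have "(\<lambda>n. 1 / (2 * real n) * (\<Sum>t=1..n. qml_cond_hess M (P \<theta>0) x \<mu> S t i j \<theta>0 w) +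
        1 / 2 * real n powr (- 1 / 8) * (real n powr (- 7 / 8) * ?X n)) \<longlonglongrightarrow> V $ i $ j"
      by simp
    \<comment> \<open>The spare factor \<open>real n powr (- 1 / 8)\<close> raises the rate to
      \<open>1 / n\<close>; at \<open>n = 0\<close> both sides are 0 by convention.\<close>
    moreover have "1 / 2 * real n powr (- 1 / 8) * (real n powr (- 7 / 8) * y) = 1 / (2 * real n) * y" for n y
    proof -
      have "real n powr (- 1 / 8) * real n powr (- 7 / 8) = 1 / real n"
        unfolding powr_add[symmetric] by (cases "n = 0") (simp_all add: powr_minus_divide)
      then show ?thesis by (simp add: mult.assoc[symmetric])
    qed
    ultimately show ?thesis
      by (simp only: distrib_left[symmetric] sum.distrib[symmetric]) simp
  qed
  have ev1: "\<forall>\<^sub>F n in sequentially. \<forall>i j. \<bar>1 / (2 * real n) * ?H n i j \<theta>0 - V $ i $ j\<bar> < \<epsilon> / 2"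
  proof (intro eventually_all_finite)
    show "\<forall>\<^sub>F n in sequentially. \<bar>1 / (2 * real n) * ?H n i j \<theta>0 - V $ i $ j\<bar> < \<epsilon> / 2" for i j
      using tendstoD[OF at_\<theta>0, of "\<epsilon> / 2"] \<epsilon>(1) unfolding dist_real_def by simp
  qed
  have "\<forall>\<^sub>F n in sequentially. \<forall>u\<in>cball \<theta>0 (\<rho> n).
      \<bar>1 / (2 * real n) * ?H n i j u - 1 / (2 * real n) * ?H n i j \<theta>0\<bar> < \<epsilon> / 2" for i j
  proof -
    obtain \<delta> where \<delta>: "\<delta> > 0" "limsup (\<lambda>n. SUP \<Delta>\<in>{0<..<\<delta>}. SUP \<theta>\<in>ball \<theta>0 \<Delta>. SUP \<theta>s\<in>closed_segment \<theta>0 \<theta>.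
        ereal (inverse (real n * \<Delta>) *
          \<bar>\<Sum>t=1..n. (qml_hess x \<mu> S t i j \<theta>s w - qml_hess x \<mu> S t i j \<theta>0 w)\<bar>)) < \<infinity>"
      using d by blast
    obtain K where K: "\<forall>\<^sub>F n in sequentially. \<forall>\<Delta>\<in>{0<..<\<delta>}. \<forall>u\<in>ball \<theta>0 \<Delta>.
        \<bar>\<Sum>t=1..n. (qml_hess x \<mu> S t i j u w - qml_hess x \<mu> S t i j \<theta>0 w)\<bar> \<le> K * (real n * \<Delta>)"
      using local_Lipschitz_of_limsup[OF \<delta>(2)] by blast
    have "\<forall>\<^sub>F n in sequentially. 2 * \<rho> n < \<delta>"
      using order_tendstoD(2)[OF tendsto_mult_right_zero[OF \<rho>_tendsto_0, of 2] \<delta>(1)] .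
    moreover have "\<forall>\<^sub>F n in sequentially. K * \<rho> n < \<epsilon> / 2"
      using order_tendstoD(2)[OF tendsto_mult_right_zero[OF \<rho>_tendsto_0, of K], of "\<epsilon> / 2"] \<epsilon>(1) by simp
    ultimately show ?thesis
      using K eventually_gt_at_top[of 0]
    proof eventually_elim
      case (elim n)
      have \<rho>: "\<rho> n > 0"
        unfolding \<rho>_def using r0(1) elim(4) by simp
      show ?case
      proof
        fix u assume "u \<in> cball \<theta>0 (\<rho> n)"
        \<comment> \<open>The bound from (d) concerns open balls, hence the doubled radius; the 2
          cancels against the normalisation by \<open>2 * real n\<close>.\<close>
        then have "u \<in> ball \<theta>0 (2 * \<rho> n)"
          using \<rho> by simp
        then have "\<bar>\<Sum>t=1..n. (qml_hess x \<mu> S t i j u w - qml_hess x \<mu> S t i j \<theta>0 w)\<bar> \<le> K * (real n * (2 * \<rho> n))"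
          using elim(1,3) \<rho> by simp
        then have "1 / (2 * real n) * \<bar>?H n i j u - ?H n i j \<theta>0\<bar> \<le> 1 / (2 * real n) * (K * (real n * (2 * \<rho> n)))"
          by (intro mult_left_mono) (simp_all add: sum_subtractf)
        also have "\<dots> = K * \<rho> n"
          using elim(4) by simp
        also have "1 / (2 * real n) * \<bar>?H n i j u - ?H n i j \<theta>0\<bar> =
            \<bar>1 / (2 * real n) * ?H n i j u - 1 / (2 * real n) * ?H n i j \<theta>0\<bar>"
          unfolding right_diff_distrib[symmetric] abs_mult by simp
        finally show "\<bar>1 / (2 * real n) * ?H n i j u - 1 / (2 * real n) * ?H n i j \<theta>0\<bar> < \<epsilon> / 2"
          using elim(2) by linarith
      qed
    qed
  qed
  then have ev2: "\<forall>\<^sub>F n in sequentially. \<forall>i j. \<forall>u\<in>cball \<theta>0 (\<rho> n).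
      \<bar>1 / (2 * real n) * ?H n i j u - 1 / (2 * real n) * ?H n i j \<theta>0\<bar> < \<epsilon> / 2"
    by (intro eventually_all_finite)
  let ?G = "\<lambda>n. \<chi> i. \<Sum>t=1..n. qml_score x \<mu> S t i \<theta>0 w"
  have "(\<lambda>n. real n powr (- 7 / 8) *\<^sub>R ?G n) \<longlonglongrightarrow> 0"
    by (rule vec_tendstoI)
      (simp only: vector_scaleR_component real_scaleR_def vec_lambda_beta zero_index score)
  \<comment> \<open>With \<open>c = real n * (\<nu> / 2)\<close> the admissible gradient
    \<open>c * \<rho> n / 2\<close> is \<open>\<nu> * r0 / 8\<close> times
    \<open>real n powr (7 / 8)\<close>. The gradient of \<open>qml_Q\<close> is half the summed
    score, so this threshold leaves a factor 2 to spare.\<close>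
  then have "\<forall>\<^sub>F n in sequentially. dist (real n powr (- 7 / 8) *\<^sub>R ?G n) 0 < \<nu> * r0 / 8"
    by (rule tendstoD) (use \<nu>(1) r0(1) in simp)
  then show ?thesis
    using ev1 ev2 eventually_gt_at_top[of 0]
  proof eventually_elim
    case (elim n)
    define c where "c = real n * (\<nu> / 2)"
    show ?case
    proof (rule argmin_found_if_strongly_convex[OF open_ball cball_\<rho> Q_twice_differentiable[OF reg] D])
      show "c > 0"
        unfolding c_def using elim(4) \<nu>(1) by simp
      show "c * (norm v)\<^sup>2 \<le> (\<Sum>i\<in>UNIV. \<Sum>j\<in>UNIV. v $ i * v $ j * partial i (partial j (qml_Q x \<mu> S n w)) u)"
        if u: "u \<in> cball \<theta>0 (\<rho> n)" for u v
      proof -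
        have "\<bar>1 / (2 * real n) * ?H n i j u - V $ i $ j\<bar> \<le> \<epsilon>" for i j
          using elim(2)[rule_format, of i j] elim(3)[rule_format, OF u, of i j] by linarith
        from quadratic_form_perturbation[of "\<lambda>i j. 1 / (2 * real n) * ?H n i j u", OF this, of v]
        have "\<nu> / 2 * (norm v)\<^sup>2 \<le> (\<Sum>i\<in>UNIV. \<Sum>j\<in>UNIV. v $ i * v $ j * (1 / (2 * real n) * ?H n i j u))"
          using \<nu>(2)[of v] unfolding \<epsilon>(2) by (simp add: algebra_simps)
        then have "real n * (\<nu> / 2 * (norm v)\<^sup>2) \<le>
            real n * (\<Sum>i\<in>UNIV. \<Sum>j\<in>UNIV. v $ i * v $ j * (1 / (2 * real n) * ?H n i j u))"
          by (rule mult_left_mono) simp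
        also have "\<dots> = (\<Sum>i\<in>UNIV. \<Sum>j\<in>UNIV. v $ i * v $ j * (1 / 2 * ?H n i j u))"
          using elim(4) by (simp add: sum_distrib_left[of "real n"] mult_ac)
        finally show ?thesis
          by (simp only: c_def second_partial_Q[OF reg subsetD[OF cball_\<rho> u]] mult.assoc[of "real n"])
      qed
      have "(\<chi> i. partial i (qml_Q x \<mu> S n w) \<theta>0) = (1 / 2) *\<^sub>R ?G n"
        by (simp add: vec_eq_iff partial_Q[OF reg \<theta>0_mem])
      then have "norm (\<chi> i. partial i (qml_Q x \<mu> S n w) \<theta>0) = 1 / 2 * norm (?G n)"
        by simp
      also have "norm (?G n) < real n powr (7 / 8) * (\<nu> * r0 / 8)"
      proof -
        have "norm (?G n) = real n powr (7 / 8) * (real n powr (- 7 / 8) * norm (?G n))"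
          using elim(4) by (simp add: mult.assoc[symmetric] powr_add[symmetric])
        also have "\<dots> < real n powr (7 / 8) * (\<nu> * r0 / 8)"
          using elim(1,4) by (intro mult_strict_left_mono) simp_all
        finally show ?thesis .
      qed
      also have "real n powr (7 / 8) = real n * real n powr (- 1 / 8)"
        using elim(4) powr_add[of "real n" 1 "- 1 / 8"] by simp
      also have "1 / 2 * (real n * real n powr (- 1 / 8) * (\<nu> * r0 / 8)) \<le> c * \<rho> n / 2"
        unfolding c_def \<rho>_def using elim(4) \<nu>(1) r0(1) by (simp add: field_simps)
      finally show "norm (\<chi> i. partial i (qml_Q x \<mu> S n w) \<theta>0) < c * \<rho> n / 2"
        by simp
    qed
  qed
qed

text \<open>The limit lies in the open ball, so the minimum over the closed ball is a local one and
  Fermat's rule applies along each axis.\<close>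

lemma argmin_in_ball_critical:
  assumes reg: "\<And>t. t \<ge> 1 \<Longrightarrow> regular t w"
    and D: "range D \<subseteq> cball \<theta>0 (\<rho> n)" "cball \<theta>0 (\<rho> n) \<subseteq> closure (range D)"
    and found: "argmin_found D \<theta>0 (\<rho> n) (qml_Q x \<mu> S n w)"
  defines "u \<equiv> argmin_in_ball D \<theta>0 (\<rho> n) (qml_Q x \<mu> S n w)"
  shows "\<forall>\<^sub>F \<theta> in nhds u. qml_Q x \<mu> S n w u \<le> qml_Q x \<mu> S n w \<theta>"
    and "((\<lambda>h. qml_Q x \<mu> S n w (u + h *\<^sub>R axis i 1)) has_real_derivative 0) (at 0)"
proof -
  let ?f = "qml_Q x \<mu> S n w"
  have diff: "times_differentiable_on (Suc (Suc 0)) ?f U"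
    using Q_twice_differentiable[OF reg] unfolding numeral_2_eq_2 .
  then have cont: "continuous_on (cball \<theta>0 (\<rho> n)) ?f"
    using cball_\<rho> by (rule times_differentiable_on_imp_continuous_on)
  have u: "u \<in> ball \<theta>0 (\<rho> n)" "u = lim (approx_argmin D ?f)" and C: "Cauchy (approx_argmin D ?f)"
    using found unfolding u_def argmin_in_ball_def argmin_found_def by auto
  have min: "?f u \<le> ?f v" if "v \<in> ball \<theta>0 (\<rho> n)" for v
    unfolding u(2) using that by (intro lim_approx_argmin(2)[OF cont compact_cball D C]) auto
  have "\<forall>\<^sub>F v in nhds u. v \<in> ball \<theta>0 (\<rho> n)"
    using u(1) by (intro eventually_nhds_in_open) auto
  then show "\<forall>\<^sub>F v in nhds u. ?f u \<le> ?f v"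
    by eventually_elim (rule min)
  have "u \<in> U"
    using u(1) cball_\<rho> by (meson ball_subset_cball subsetD)
  then have "(?f has_derivative (\<lambda>v. (\<chi> i. partial i ?f u) \<bullet> v)) (at u)"
    by (rule times_differentiable_on_partial(2)[OF open_ball diff])
  from has_real_derivative_along_axis[OF this, of i]
  have der: "((\<lambda>h. ?f (u + h *\<^sub>R axis i 1)) has_real_derivative partial i ?f u) (at 0)"
    by simp
  obtain \<eta> where \<eta>: "\<eta> > 0" "ball u \<eta> \<subseteq> ball \<theta>0 (\<rho> n)"
    using u(1) openE[OF open_ball] by blast
  have "partial i ?f u = 0"
  proof (rule DERIV_local_min[OF der \<eta>(1)], intro allI impI)
    fix h :: real assume "\<bar>0 - h\<bar> < \<eta>"
    then have "u + h *\<^sub>R axis i 1 \<in> ball u \<eta>"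
      by (simp add: dist_norm)
    then show "?f (u + 0 *\<^sub>R axis i 1) \<le> ?f (u + h *\<^sub>R axis i 1)"
      using min \<eta>(2) by auto
  qed
  with der show "((\<lambda>h. ?f (u + h *\<^sub>R axis i 1)) has_real_derivative 0) (at 0)"
    by simp
qed

section \<open>Events of large probability and conclusion\<close>

text \<open>Continuity from below along the events that \<open>A n\<close> holds for every
  \<open>n > k\<close>. Removing a null set that covers the failure of \<open>R\<close> secures
  \<open>R\<close> at every point of the event, although \<open>R\<close> itself may not be
  measurable.\<close>

lemma AE_eventually_imp_event:
  assumes reg: "AE w in P \<theta>0. R w"
    and A: "\<And>n. {w \<in> space M. A n w} \<in> sets M"
    and ev: "AE w in P \<theta>0. \<forall>\<^sub>F n in sequentially. A n w" and "\<epsilon> > 0"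
  shows "\<exists>E\<in>sets M. \<exists>n0. measure (P \<theta>0) E > 1 - \<epsilon> \<and> (\<forall>w\<in>E. R w \<and> (\<forall>n>n0. A n w))"
proof -
  interpret prob_space "P \<theta>0" by (rule prob)
  obtain Z where Z: "Z \<in> null_sets (P \<theta>0)" "{w \<in> space M. \<not> R w} \<subseteq> Z"
    using reg unfolding eventually_ae_filter space_P by auto
  define E where "E k = (\<Inter>n\<in>{k<..}. {w \<in> space M. A n w}) - Z" for k
  have EM: "E k \<in> sets (P \<theta>0)" for k
    unfolding E_def sets_P using A Z(1)
    by (intro sets.Diff sets.countable_INT') (auto simp: sets_P dest: null_setsD2)
  have "incseq E"
    unfolding incseq_def E_def by (auto; fastforce)
  then have lim: "(\<lambda>k. prob (E k)) \<longlonglongrightarrow> prob (\<Union>k. E k)"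
    using EM by (intro finite_Lim_measure_incseq) auto
  have "AE w in P \<theta>0. w \<in> (\<Union>k. E k)"
    using ev AE_not_in[OF Z(1)] AE_space
  proof eventually_elim
    case (elim w)
    then obtain k where "\<And>n. n \<ge> k \<Longrightarrow> A n w"
      unfolding eventually_sequentially by blast
    then have "w \<in> E k"
      using elim unfolding E_def space_P by auto
    then show ?case by blast
  qed
  then have "prob (\<Union>k. E k) = 1"
    using EM by (intro prob_eq_1[THEN iffD2]) auto
  then have "\<forall>\<^sub>F k in sequentially. prob (E k) > 1 - \<epsilon>"
    using order_tendstoD(1)[OF lim, of "1 - \<epsilon>"] \<open>\<epsilon> > 0\<close> by simp
  then obtain k where "prob (E k) > 1 - \<epsilon>"
    using eventually_happens'[OF sequentially_bot] by blast
  moreover have "R w \<and> (\<forall>n>k. A n w)" if "w \<in> E k" for w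
  proof -
    have w: "\<forall>n\<in>{k<..}. w \<in> space M \<and> A n w" "w \<notin> Z"
      using that unfolding E_def by auto
    then have "w \<in> space M" by (metis greaterThan_iff lessI)
    then show ?thesis
      using w Z(2) by auto
  qed
  ultimately show ?thesis
    using EM[of k] unfolding sets_P by blast
qed

lemma consistent_estimators:
  fixes V :: "real^'m^'m"
  assumes C_pos: "C1 > 0" "C2 > 0"
    and a: "\<And>t i. t \<ge> 1 \<Longrightarrow>
      (\<integral>\<^sup>+ w. ennreal (\<bar>qml_score x \<mu> S t i \<theta>0 w\<bar> ^ 4) \<partial>completion (P \<theta>0)) \<le> ennreal C1"
    and b: "\<And>t i j. t \<ge> 1 \<Longrightarrow>
      (\<integral>\<^sup>+ w. ennreal (\<bar>qml_hess x \<mu> S t i j \<theta>0 w - qml_cond_hess M (P \<theta>0) x \<mu> S t i j \<theta>0 w\<bar>\<^sup>2)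
        \<partial>completion (P \<theta>0)) \<le> ennreal C2"
    and c: "\<And>i j. AE w in P \<theta>0.
      (\<lambda>n. 1 / (2 * real n) * (\<Sum>t=1..n. qml_cond_hess M (P \<theta>0) x \<mu> S t i j \<theta>0 w)) \<longlonglongrightarrow> V $ i $ j"
    and V: "strictly_positive_definite V"
    and d: "\<And>i j. AE w in P \<theta>0. \<exists>\<delta>>0.
      limsup (\<lambda>n. SUP \<Delta>\<in>{0<..<\<delta>}. SUP \<theta>\<in>ball \<theta>0 \<Delta>. SUP \<theta>s\<in>closed_segment \<theta>0 \<theta>.
        ereal (inverse (real n * \<Delta>) *
          \<bar>\<Sum>t=1..n. (qml_hess x \<mu> S t i j \<theta>s w - qml_hess x \<mu> S t i j \<theta>0 w)\<bar>)) < \<infinity>"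
  shows "\<exists>\<theta>h :: nat \<Rightarrow> 'w \<Rightarrow> real^'m.
           (\<forall>n. \<theta>h n \<in> borel_measurable (F n)) \<and>
           (\<forall>n. \<forall>w\<in>space M. \<theta>h n w \<in> \<Theta>) \<and>
           (AE w in P \<theta>0. (\<lambda>n. \<theta>h n w) \<longlonglongrightarrow> \<theta>0) \<and>
           (\<forall>\<epsilon>>0. \<exists>E\<in>sets M. \<exists>n0. measure (P \<theta>0) E > 1 - \<epsilon> \<and>
              (\<forall>w\<in>E. \<forall>n>n0.
                 (\<forall>i. ((\<lambda>h. qml_Q x \<mu> S n w (\<theta>h n w + h *\<^sub>R axis i 1))
                         has_real_derivative 0) (at 0)) \<and>
                 (\<forall>\<^sub>F \<theta> in nhds (\<theta>h n w). qml_Q x \<mu> S n w (\<theta>h n w) \<le> qml_Q x \<mu> S n w \<theta>)))"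
proof -
  have "\<exists>d :: nat \<Rightarrow> real^'m. range d \<subseteq> cball \<theta>0 (\<rho> n) \<and> cball \<theta>0 (\<rho> n) \<subseteq> closure (range d)" for n
  proof -
    have "cball \<theta>0 (\<rho> n) \<noteq> {}"
      using \<rho>_nonneg[of n] by simp
    then show ?thesis
      using dense_sequence by metis
  qed
  then obtain D :: "nat \<Rightarrow> nat \<Rightarrow> real^'m" where D: "\<And>n. range (D n) \<subseteq> cball \<theta>0 (\<rho> n)"
    "\<And>n. cball \<theta>0 (\<rho> n) \<subseteq> closure (range (D n))"
    by metis
  define found where "found n w \<longleftrightarrow> argmin_found (D n) \<theta>0 (\<rho> n) (qml_Q x \<mu> S n w)" for n w
  define \<theta>h where "\<theta>h n w = argmin_in_ball (D n) \<theta>0 (\<rho> n) (qml_Q x \<mu> S n w)" for n w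
  \<comment> \<open>Only the values of \<open>qml_Q\<close> at fixed parameters enter the estimator;
    each depends on the observations up to time \<open>n\<close> alone.\<close>
  have Q_D: "(\<lambda>w. qml_Q x \<mu> S n w (D n l)) \<in> borel_measurable (F n)" for n l
    using D(1)[of n] cball_\<rho>[of n] r0(2) by (intro Q_measurable) blast
  have dist_\<theta>h: "dist (\<theta>h n w) \<theta>0 \<le> \<rho> n" for n w
    using argmin_in_ball_mem[of "D n" \<theta>0 "\<rho> n" "qml_Q x \<mu> S n w"] \<rho>_nonneg[of n]
    unfolding \<theta>h_def[symmetric] by (auto simp: dist_commute)
  \<comment> \<open>Convergence holds on every path, since the estimator never leaves the ball of
    radius \<open>\<rho> n\<close>; success of the search matters only for the critical-point
    claim.\<close>
  have conv: "(\<lambda>n. \<theta>h n w) \<longlonglongrightarrow> \<theta>0" for w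
  proof -
    have "(\<lambda>n. dist (\<theta>h n w) \<theta>0) \<longlonglongrightarrow> 0"
      by (rule Lim_null_comparison[OF _ \<rho>_tendsto_0]) (simp add: dist_\<theta>h)
    then show ?thesis
      by (rule tendsto_dist_iff[THEN iffD2])
  qed
  have in_\<Theta>: "\<theta>h n w \<in> \<Theta>" for n w
  proof -
    have "\<theta>h n w \<in> cball \<theta>0 (\<rho> n)"
      using dist_\<theta>h[of n w] by (simp add: dist_commute)
    then show ?thesis
      using cball_\<rho> r0(2) by blast
  qed
  have reg: "AE w in P \<theta>0. \<forall>t. t \<ge> 1 \<longrightarrow> regular t w"
    unfolding AE_all_countable using AE_regular by auto
  have "AE w in P \<theta>0. \<forall>i. (\<lambda>n. real n powr (- 7 / 8) * (\<Sum>t=1..n. qml_score x \<mu> S t i \<theta>0 w)) \<longlonglongrightarrow> 0"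
    unfolding AE_all_countable using score_AE_tendsto_0[OF a C_pos(1)] by blast
  moreover have "AE w in P \<theta>0. \<forall>i j. (\<lambda>n. real n powr (- 7 / 8) * (\<Sum>t=1..n. qml_hess x \<mu> S t i j \<theta>0 w
      - qml_cond_hess M (P \<theta>0) x \<mu> S t i j \<theta>0 w)) \<longlonglongrightarrow> 0"
    unfolding AE_all_countable using hess_AE_tendsto_0[OF b C_pos(2)] by blast
  moreover have "AE w in P \<theta>0. \<forall>i j.
      (\<lambda>n. 1 / (2 * real n) * (\<Sum>t=1..n. qml_cond_hess M (P \<theta>0) x \<mu> S t i j \<theta>0 w)) \<longlonglongrightarrow> V $ i $ j"
    unfolding AE_all_countable using c by blast
  moreover have "AE w in P \<theta>0. \<forall>i j. \<exists>\<delta>>0.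
      limsup (\<lambda>n. SUP \<Delta>\<in>{0<..<\<delta>}. SUP \<theta>\<in>ball \<theta>0 \<Delta>. SUP \<theta>s\<in>closed_segment \<theta>0 \<theta>.
        ereal (inverse (real n * \<Delta>) *
          \<bar>\<Sum>t=1..n. (qml_hess x \<mu> S t i j \<theta>s w - qml_hess x \<mu> S t i j \<theta>0 w)\<bar>)) < \<infinity>"
    unfolding AE_all_countable using d by blast
  ultimately have ev: "AE w in P \<theta>0. \<forall>\<^sub>F n in sequentially. found n w"
    using reg
  proof eventually_elim
    case (elim w)
    show ?case
      unfolding found_def
      by (rule eventually_argmin_found[OF _ _ _ _ V _ D]) (use elim in blast)+
  qed
  have found_M: "{w \<in> space M. found n w} \<in> sets M" for n
    using argmin_found_measurable[of "\<lambda>w. qml_Q x \<mu> S n w" "D n", OF Q_D, of \<theta>0 "\<rho> n"] subalgebra_M[of n]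
    unfolding found_def subalgebra_def by auto
  show ?thesis
  proof (intro exI[of _ \<theta>h] conjI allI ballI impI)
    show "\<theta>h n \<in> borel_measurable (F n)" for n
      unfolding \<theta>h_def[abs_def] by (rule argmin_in_ball_measurable) (rule Q_D)
    show "\<theta>h n w \<in> \<Theta>" for n w
      by (rule in_\<Theta>)
    show "AE w in P \<theta>0. (\<lambda>n. \<theta>h n w) \<longlonglongrightarrow> \<theta>0"
      using conv by simp
    fix \<epsilon> :: real assume "\<epsilon> > 0"
    obtain E n0 where E: "E \<in> sets M" "measure (P \<theta>0) E > 1 - \<epsilon>"
      "\<And>w. w \<in> E \<Longrightarrow> (\<forall>t. t \<ge> 1 \<longrightarrow> regular t w) \<and> (\<forall>n>n0. found n w)"
      using AE_eventually_imp_event[where A = found, OF reg found_M ev \<open>\<epsilon> > 0\<close>] by blast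
    have "(\<forall>i. ((\<lambda>h. qml_Q x \<mu> S n w (\<theta>h n w + h *\<^sub>R axis i 1)) has_real_derivative 0) (at 0)) \<and>
        (\<forall>\<^sub>F \<theta> in nhds (\<theta>h n w). qml_Q x \<mu> S n w (\<theta>h n w) \<le> qml_Q x \<mu> S n w \<theta>)"
      if "w \<in> E" "n > n0" for w n
    proof -
      have w: "\<And>t. t \<ge> 1 \<Longrightarrow> regular t w" "argmin_found (D n) \<theta>0 (\<rho> n) (qml_Q x \<mu> S n w)"
        using E(3)[OF that(1)] that(2) unfolding found_def by blast+
      show ?thesis
        unfolding \<theta>h_def using argmin_in_ball_critical[OF w(1) D w(2)] by blast
    qed
    with E(1,2) show "\<exists>E\<in>sets M. \<exists>n0. measure (P \<theta>0) E > 1 - \<epsilon> \<and>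
        (\<forall>w\<in>E. \<forall>n>n0.
           (\<forall>i. ((\<lambda>h. qml_Q x \<mu> S n w (\<theta>h n w + h *\<^sub>R axis i 1)) has_real_derivative 0) (at 0)) \<and>
           (\<forall>\<^sub>F \<theta> in nhds (\<theta>h n w). qml_Q x \<mu> S n w (\<theta>h n w) \<le> qml_Q x \<mu> S n w \<theta>))"
      by blast
  qed
qed

end

theorem theorem2p1:
  fixes M :: "'w measure"
    and P :: "real^'m \<Rightarrow> 'w measure"
    and \<Theta> :: "(real^'m) set"
    and \<theta>0 :: "real^'m"
    and x :: "nat \<Rightarrow> 'w \<Rightarrow> real^'r"
    and \<mu> :: "nat \<Rightarrow> real^'m \<Rightarrow> 'w \<Rightarrow> real^'r"
    and S :: "nat \<Rightarrow> real^'m \<Rightarrow> 'w \<Rightarrow> real^'r^'r"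
    and V :: "real^'m^'m"
    and C1 C2 :: real
  assumes Theta: "open \<Theta>" "\<theta>0 \<in> \<Theta>"
    and prob: "\<And>\<theta>. \<theta> \<in> \<Theta> \<Longrightarrow> prob_space (P \<theta>)"
    and sets_P: "\<And>\<theta>. \<theta> \<in> \<Theta> \<Longrightarrow> sets (P \<theta>) = sets M"
    and x_meas: "\<And>t. t \<ge> 1 \<Longrightarrow> x t \<in> borel_measurable M"
    and x_sq: "\<And>\<theta> t. \<theta> \<in> \<Theta> \<Longrightarrow> t \<ge> 1 \<Longrightarrow> integrable (P \<theta>) (\<lambda>w. (norm (x t w))\<^sup>2)"
    and cond_mean: "is_cond_mean M P \<Theta> x \<mu>"
    and cond_cov: "is_cond_cov M P \<Theta> x \<mu> S"
    and inv: "\<And>t. t \<ge> 1 \<Longrightarrow> AE w in P \<theta>0. \<forall>\<theta>\<in>\<Theta>. invertible (S t \<theta> w)"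
    and e_smooth: "\<And>t. t \<ge> 1 \<Longrightarrow> AE w in P \<theta>0.
          twice_continuously_differentiable_on (\<lambda>\<theta>. innovation x \<mu> t \<theta> w) \<Theta>"
    and S_smooth: "\<And>t. t \<ge> 1 \<Longrightarrow> AE w in P \<theta>0.
          twice_continuously_differentiable_on (\<lambda>\<theta>. S t \<theta> w) \<Theta>"
    and C_pos: "C1 > 0" "C2 > 0"
    and a: "\<And>t i. t \<ge> 1 \<Longrightarrow>
          (\<integral>\<^sup>+ w. ennreal (\<bar>qml_score x \<mu> S t i \<theta>0 w\<bar> ^ 4) \<partial>completion (P \<theta>0)) \<le> ennreal C1"
    and b: "\<And>t i j. t \<ge> 1 \<Longrightarrow>
          (\<integral>\<^sup>+ w. ennreal (\<bar>qml_hess x \<mu> S t i j \<theta>0 w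
                          - qml_cond_hess M (P \<theta>0) x \<mu> S t i j \<theta>0 w\<bar>\<^sup>2) \<partial>completion (P \<theta>0))
            \<le> ennreal C2"
    and c: "\<And>i j. AE w in P \<theta>0.
          (\<lambda>n. 1 / (2 * real n) * (\<Sum>t=1..n. qml_cond_hess M (P \<theta>0) x \<mu> S t i j \<theta>0 w))
            \<longlonglongrightarrow> V $ i $ j"
    and V: "strictly_positive_definite V"
    and d: "\<And>i j. AE w in P \<theta>0. \<exists>\<delta>>0.
          limsup (\<lambda>n. SUP \<Delta>\<in>{0<..<\<delta>}. SUP \<theta>\<in>ball \<theta>0 \<Delta>. SUP \<theta>s\<in>closed_segment \<theta>0 \<theta>.
            ereal (inverse (real n * \<Delta>) *
              \<bar>\<Sum>t=1..n. (qml_hess x \<mu> S t i j \<theta>s w - qml_hess x \<mu> S t i j \<theta>0 w)\<bar>)) < \<infinity>"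
  shows "\<exists>\<theta>h :: nat \<Rightarrow> 'w \<Rightarrow> real^'m.
           (\<forall>n. \<theta>h n \<in> borel_measurable (natural_sigma M x n)) \<and>
           (\<forall>n. \<forall>w\<in>space M. \<theta>h n w \<in> \<Theta>) \<and>
           (AE w in P \<theta>0. (\<lambda>n. \<theta>h n w) \<longlonglongrightarrow> \<theta>0) \<and>
           (\<forall>\<epsilon>>0. \<exists>E\<in>sets M. \<exists>n0. measure (P \<theta>0) E > 1 - \<epsilon> \<and>
              (\<forall>w\<in>E. \<forall>n>n0.
                 (\<forall>i. ((\<lambda>h. qml_Q x \<mu> S n w (\<theta>h n w + h *\<^sub>R axis i 1))
                         has_real_derivative 0) (at 0)) \<and>
                 (\<forall>\<^sub>F \<theta> in nhds (\<theta>h n w). qml_Q x \<mu> S n w (\<theta>h n w) \<le> qml_Q x \<mu> S n w \<theta>)))"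
proof -
  interpret qml_model M P \<Theta> \<theta>0 x \<mu> S
    by (rule qml_model.intro) (fact Theta prob[OF Theta(2)] sets_P[OF Theta(2)] x_meas
        x_sq[OF Theta(2)] cond_mean cond_cov inv e_smooth S_smooth)+
  show ?thesis
    by (rule consistent_estimators[OF C_pos a b c V d])
qed

end
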